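(* Let $A=\langle Q,F,\delta,\gamma\rangle$ be a finite, fork-acyclic and well-structured pomset automaton. Given states $q_1,q_2\in Q$, it is decidable whether $L_A(q_1)=L_A(q_2)$.
   Context: Fix a finite alphabet $\Sigma$. A pomset is an isomorphism class of finite labelled posets $(S,\le,\lambda)$ with $\lambda:S\to\Sigma$; $1$ denotes the empty pomset and, for $a\in\Sigma$, $a$ also denotes the one-element pomset labelled $a$. For pomsets $U=[S_u,\le_u,\lambda_u]$ and $V=[S_v,\le_v,\lambda_v]$ with disjoint carriers, $U\cdot V=[S_u\cup S_v,\ \le_u\cup\le_v\cup(S_u\times S_v),\ \lambda_u\cup\lambda_v]$ and $U\parallel V=[S_u\cup S_v,\ \le_u\cup\le_v,\ \lambda_u\cup\lambda_v]$. $\mathsf{SP}(\Sigma)$ is the smallest set of pomsets containing $1$ and all one-element pomsets and closed under $\cdot$ and $\parallel$. $\mathbb{M}(Q)$ denotes the finite multisets over $Q$. A pomset automaton (PA) is a tuple $A=\langle Q,F,\delta,\gamma\rangle$ with $F\subseteq Q$, $\delta:Q\times\Sigma\to 2^Q$, $\gamma:Q\times\mathbb{M}(Q)\to 2^Q$, such that for each $q\in Q$ only finitely many $\phi$ satisfy $\gamma(q,\phi)\neq\emptyset$; it is finite if $Q$ is finite. The run relation $\to_A\subseteq Q\times\mathsf{SP}(\Sigma)\times Q$ is the smallest relation such that: $q\xrightarrow{1}_A q$; $q\xrightarrow{a}_A q'$ whenever $q'\in\delta(q,a)$; $q\xrightarrow{U\cdot V}_A q'$ whenever $q\xrightarrow{U}_A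 q''$ and $q''\xrightarrow{V}_A q'$; and $q\xrightarrow{U_1\parallel\cdots\parallel U_n}_A q'$ whenever $q'\in\gamma(q,\{\!|q_1,\dots,q_n|\!\})$ and for each $i$ there is $q_i'\in F$ with $q_i\xrightarrow{U_i}_A q_i'$. The language of $q$ is $L_A(q)=\{U\in\mathsf{SP}(\Sigma)\mid \exists q'\in F.\ q\xrightarrow{U}_A q'\}$. The support relation $\preceq_A$ is the smallest preorder on $Q$ such that $q'\preceq_A q$ whenever $q'\in\delta(q,a)$ for some $a\in\Sigma$, or $q'\in\gamma(q,\phi)$ for some $\phi$, or $q'\in\phi$ for some $\phi$ with $\gamma(q,\phi)\neq\emptyset$. $A$ is fork-acyclic if whenever $r\in\phi$ and $\gamma(q,\phi)\ne\emptyset$, we have $q\not\preceq_A r$. $A$ is well-structured if for all $q,q'\in Q$ and $\phi\in\mathbb{M}(Q)$ with $q'\in\phi$ and $\gamma(q,\phi)\neq\emptyset$: $|\phi|\ge 2$, $q'\notin F$, and $\gamma(q',\phi')\cap F=\emptyset$ for all $\phi'\in\mathbb{M}(Q)$. *)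

theory Defs
  imports Main "HOL-Library.Multiset" "HOL-Library.Nat_Bijection"
begin

datatype recf = Zf | Sf | Proj nat | Comp recf "recf list" | Prim recf recf | Mn recf

inductive eval :: "recf \<Rightarrow> nat list \<Rightarrow> nat \<Rightarrow> bool" where
  eval_Z: "eval Zf xs 0"
| eval_S: "eval Sf (x # xs) (Suc x)"
| eval_Proj: "i < length xs \<Longrightarrow> eval (Proj i) xs (xs ! i)"
| eval_Comp: "length gs = length ys \<Longrightarrow> (\<forall>i<length gs. eval (gs ! i) xs (ys ! i))
     \<Longrightarrow> eval f ys z \<Longrightarrow> eval (Comp f gs) xs z"
| eval_Prim0: "eval f xs z \<Longrightarrow> eval (Prim f g) (0 # xs) z"
| eval_PrimS: "eval (Prim f g) (n # xs) y \<Longrightarrow> eval g (n # y # xs) z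
     \<Longrightarrow> eval (Prim f g) (Suc n # xs) z"
| eval_Mn: "eval f (n # xs) 0 \<Longrightarrow> (\<forall>m<n. \<exists>y. eval f (m # xs) y \<and> 0 < y)
     \<Longrightarrow> eval (Mn f) xs n"

section \<open>Labelled posets (representatives of pomsets), labels are naturals\<close>

text \<open>A representative: carrier, order relation, labelling (only relevant on the carrier).\<close>
type_synonym lpo = "nat set \<times> (nat \<times> nat) set \<times> (nat \<Rightarrow> nat)"

definition lpo_iso :: "lpo \<Rightarrow> lpo \<Rightarrow> bool" where
  "lpo_iso U V \<longleftrightarrow> (case U of (S, R, l) \<Rightarrow> case V of (S', R', l') \<Rightarrow>
     R \<subseteq> S \<times> S \<and> R' \<subseteq> S' \<times> S' \<and>
     (\<exists>f. bij_betw f S S' \<and> (\<forall>x\<in>S. \<forall>y\<in>S. (x, y) \<in> R \<longleftrightarrow> (f x, f y) \<in> R')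
          \<and> (\<forall>x\<in>S. l' (f x) = l x)))"

definition lpo_carrier :: "lpo \<Rightarrow> nat set" where
  "lpo_carrier U = fst U"

definition lpo_empty :: lpo where
  "lpo_empty = ({}, {}, (\<lambda>_. 0))"

definition lpo_single :: "nat \<Rightarrow> nat \<Rightarrow> lpo" where
  "lpo_single x a = ({x}, {(x, x)}, (\<lambda>_. a))"

text \<open>Sequential and parallel composition (meant for disjoint carriers).\<close>
definition lpo_seq :: "lpo \<Rightarrow> lpo \<Rightarrow> lpo" where
  "lpo_seq U V = (case U of (S1, R1, l1) \<Rightarrow> case V of (S2, R2, l2) \<Rightarrow>
     (S1 \<union> S2, R1 \<union> R2 \<union> S1 \<times> S2, (\<lambda>x. if x \<in> S1 then l1 x else l2 x)))"

definition lpo_par :: "lpo \<Rightarrow> lpo \<Rightarrow> lpo" where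
  "lpo_par U V = (case U of (S1, R1, l1) \<Rightarrow> case V of (S2, R2, l2) \<Rightarrow>
     (S1 \<union> S2, R1 \<union> R2, (\<lambda>x. if x \<in> S1 then l1 x else l2 x)))"

definition lpo_par_list :: "lpo list \<Rightarrow> lpo" where
  "lpo_par_list Us = foldr lpo_par Us lpo_empty"

definition pairwise_disjoint_lpos :: "lpo list \<Rightarrow> bool" where
  "pairwise_disjoint_lpos Us \<longleftrightarrow>
     (\<forall>i j. i < j \<and> j < length Us \<longrightarrow> lpo_carrier (Us ! i) \<inter> lpo_carrier (Us ! j) = {})"

inductive sp :: "nat \<Rightarrow> lpo \<Rightarrow> bool" for k :: nat where
  sp_empty: "lpo_iso U lpo_empty \<Longrightarrow> sp k U"
| sp_single: "a < k \<Longrightarrow> lpo_iso U (lpo_single x a) \<Longrightarrow> sp k U"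
| sp_seq: "sp k V \<Longrightarrow> sp k W \<Longrightarrow> lpo_carrier V \<inter> lpo_carrier W = {}
     \<Longrightarrow> lpo_iso U (lpo_seq V W) \<Longrightarrow> sp k U"
| sp_par: "sp k V \<Longrightarrow> sp k W \<Longrightarrow> lpo_carrier V \<inter> lpo_carrier W = {}
     \<Longrightarrow> lpo_iso U (lpo_par V W) \<Longrightarrow> sp k U"

inductive run :: "'q set \<Rightarrow> ('q \<Rightarrow> nat \<Rightarrow> 'q set) \<Rightarrow> ('q \<Rightarrow> 'q multiset \<Rightarrow> 'q set)
    \<Rightarrow> 'q \<Rightarrow> lpo \<Rightarrow> 'q \<Rightarrow> bool"
  for F :: "'q set" and \<delta> :: "'q \<Rightarrow> nat \<Rightarrow> 'q set" and \<gamma> :: "'q \<Rightarrow> 'q multiset \<Rightarrow> 'q set" where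
  run_empty: "lpo_iso U lpo_empty \<Longrightarrow> run F \<delta> \<gamma> q U q"
| run_letter: "q' \<in> \<delta> q a \<Longrightarrow> lpo_iso U (lpo_single x a) \<Longrightarrow> run F \<delta> \<gamma> q U q'"
| run_seq: "run F \<delta> \<gamma> q V q'' \<Longrightarrow> run F \<delta> \<gamma> q'' W q' \<Longrightarrow>
     lpo_carrier V \<inter> lpo_carrier W = {} \<Longrightarrow> lpo_iso U (lpo_seq V W) \<Longrightarrow> run F \<delta> \<gamma> q U q'"
| run_par: "q' \<in> \<gamma> q (mset qs) \<Longrightarrow> length Us = length qs \<Longrightarrow>
     (\<forall>i<length qs. \<exists>qf\<in>F. run F \<delta> \<gamma> (qs ! i) (Us ! i) qf) \<Longrightarrow>
     pairwise_disjoint_lpos Us \<Longrightarrow> lpo_iso U (lpo_par_list Us) \<Longrightarrow> run F \<delta> \<gamma> q U q'"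

definition pa_lang :: "nat \<Rightarrow> 'q set \<Rightarrow> ('q \<Rightarrow> nat \<Rightarrow> 'q set) \<Rightarrow> ('q \<Rightarrow> 'q multiset \<Rightarrow> 'q set)
    \<Rightarrow> 'q \<Rightarrow> lpo set" where
  "pa_lang k F \<delta> \<gamma> q = {U. sp k U \<and> (\<exists>qf\<in>F. run F \<delta> \<gamma> q U qf)}"

definition support_step :: "nat \<Rightarrow> ('q \<Rightarrow> nat \<Rightarrow> 'q set) \<Rightarrow> ('q \<Rightarrow> 'q multiset \<Rightarrow> 'q set)
    \<Rightarrow> 'q \<Rightarrow> 'q \<Rightarrow> bool" where
  "support_step k \<delta> \<gamma> q' q \<longleftrightarrow>
     (\<exists>a<k. q' \<in> \<delta> q a) \<or> (\<exists>\<phi>. q' \<in> \<gamma> q \<phi>) \<or> (\<exists>\<phi>. q' \<in># \<phi> \<and> \<gamma> q \<phi> \<noteq> {})"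

definition support :: "nat \<Rightarrow> ('q \<Rightarrow> nat \<Rightarrow> 'q set) \<Rightarrow> ('q \<Rightarrow> 'q multiset \<Rightarrow> 'q set)
    \<Rightarrow> 'q \<Rightarrow> 'q \<Rightarrow> bool" where
  "support k \<delta> \<gamma> = (support_step k \<delta> \<gamma>)\<^sup>*\<^sup>*"

definition fork_acyclic :: "nat \<Rightarrow> ('q \<Rightarrow> nat \<Rightarrow> 'q set) \<Rightarrow> ('q \<Rightarrow> 'q multiset \<Rightarrow> 'q set) \<Rightarrow> bool" where
  "fork_acyclic k \<delta> \<gamma> \<longleftrightarrow> (\<forall>q \<phi> r. r \<in># \<phi> \<and> \<gamma> q \<phi> \<noteq> {} \<longrightarrow> \<not> support k \<delta> \<gamma> q r)"

definition well_structured :: "'q set \<Rightarrow> ('q \<Rightarrow> 'q multiset \<Rightarrow> 'q set) \<Rightarrow> bool" where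
  "well_structured F \<gamma> \<longleftrightarrow> (\<forall>q q' \<phi>. q' \<in># \<phi> \<and> \<gamma> q \<phi> \<noteq> {} \<longrightarrow>
     size \<phi> \<ge> 2 \<and> q' \<notin> F \<and> (\<forall>\<phi>'. \<gamma> q' \<phi>' \<inter> F = {}))"

text \<open>A description: number of states n (states are 0..<n), accepting states,
  letter transitions (q, a, q'), fork transitions (q, list of forked states, q').\<close>
type_synonym pa_desc = "nat \<times> nat list \<times> (nat \<times> nat \<times> nat) list \<times> (nat \<times> nat list \<times> nat) list"

definition desc_states :: "pa_desc \<Rightarrow> nat" where
  "desc_states d = fst d"

definition desc_F :: "pa_desc \<Rightarrow> nat set" where
  "desc_F d = set (fst (snd d))"

definition desc_delta :: "pa_desc \<Rightarrow> nat \<Rightarrow> nat \<Rightarrow> nat set" where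
  "desc_delta d q a = {q'. (q, a, q') \<in> set (fst (snd (snd d)))}"

definition desc_gamma :: "pa_desc \<Rightarrow> nat \<Rightarrow> nat multiset \<Rightarrow> nat set" where
  "desc_gamma d q \<phi> = {q'. \<exists>ps. (q, ps, q') \<in> set (snd (snd (snd d))) \<and> mset ps = \<phi>}"

definition valid_desc :: "nat \<Rightarrow> pa_desc \<Rightarrow> bool" where
  "valid_desc k d \<longleftrightarrow> (case d of (n, Fs, dl, gl) \<Rightarrow>
     (\<forall>q\<in>set Fs. q < n) \<and>
     (\<forall>(q, a, q')\<in>set dl. q < n \<and> a < k \<and> q' < n) \<and>
     (\<forall>(q, ps, q')\<in>set gl. q < n \<and> (\<forall>p\<in>set ps. p < n) \<and> q' < n))"

definition encode_desc :: "pa_desc \<Rightarrow> nat" where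
  "encode_desc d = (case d of (n, Fs, dl, gl) \<Rightarrow>
     list_encode [n, list_encode Fs,
       list_encode (map (\<lambda>(q, a, q'). list_encode [q, a, q']) dl),
       list_encode (map (\<lambda>(q, ps, q'). list_encode [q, list_encode ps, q']) gl)])"

definition encode_input :: "pa_desc \<Rightarrow> nat \<Rightarrow> nat \<Rightarrow> nat" where
  "encode_input d q1 q2 = list_encode [encode_desc d, q1, q2]"

end

theory Submission
  imports Defs "HOL-Computational_Algebra.Primes"
begin

text \<open>
  A fork may have the empty multiset of branches even in a well-structured automaton, and is then a
  silent move. Hence forked states can be nullable and can accept parallel pomsets. The proof copes
  with this using fork-acyclicity alone.

  Unfolding forks inside forks turns a fork into finitely many multisets of leaves, each of which has
  to accept a connected (non-empty, parallel-irreducible) pomset; fork-acyclicity bounds the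
  unfolding. If all leaves but one have been erased, a sequential pomset crosses the fork, so runs are
  tracked on stacks of states. The type of a pomset \<open>U\<close> consists of the relation that
  \<open>U\<close> induces on stacks and of the multisets of leaves that can read the connected components of
  \<open>U\<close>. By Levi's lemma and the uniqueness of the decomposition into components, types are
  compositional, and there are only finitely many. Two states are equivalent iff they agree on the
  empty pomset and on every type that is realized by a non-empty pomset.

  The program searches for a list code that is closed under the rules defining the unfoldings, and
  then for one that is closed under composition of types. The least code closed under such rules
  contains nothing but derivable elements, because dropping elements from a list decreases its code.
\<close>

section \<open>Closure properties of computable functions\<close>

text \<open>The difficulty is that types have to compose along both products at once. A fork step
  over a pomset that is not connected may be atomic, because such a pomset cannot be cut
  sequentially. A fork step over a connected pomset may not, because a cut can fall inside it;
  pushes and pops replace it there. Conversely, leaves have to read connected sets, because only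
  then does a parallel cut hand each leaf as a whole to one of the two sides. An empty factor spoils
  both facts: it can make a sequential product disconnected or a parallel product connected. Hence
  only non-empty pomsets receive types. Stacks stay finite in number because a pushed leaf has
  smaller rank in the support preorder than the state that forked. No size bound for the tables is
  computed. A closed finite table is shown to exist, and minimisation finds the least one.
  Closedness is expressed with bounded quantifiers and hence is decidable; it only says that nothing
  is missing.\<close>

definition computable :: "nat \<Rightarrow> (nat list \<Rightarrow> nat) \<Rightarrow> bool" where
  "computable n f \<longleftrightarrow> (\<exists>p. \<forall>xs. length xs = n \<longrightarrow> eval p xs (f xs))"

definition decidable :: "nat \<Rightarrow> (nat list \<Rightarrow> bool) \<Rightarrow> bool" where
  "decidable n P \<longleftrightarrow> computable n (\<lambda>e. of_bool (P e))"

lemma cmI: "(\<And>xs. length xs = n \<Longrightarrow> eval p xs (f xs)) \<Longrightarrow> computable n f"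
  unfolding computable_def by blast

lemma computable_cong: "computable n f \<Longrightarrow> (\<And>xs. length xs = n \<Longrightarrow> f xs = g xs) \<Longrightarrow> computable n g"
  unfolding computable_def by auto

lemma computable_nth: "i < n \<Longrightarrow> computable n (\<lambda>e. e ! i)"
  by (rule cmI[of _ "Proj i"]) (simp add: eval_Proj)

lemma computable_compose:
  assumes "computable (length fs) g" and "\<And>f. f \<in> set fs \<Longrightarrow> computable n f"
  shows "computable n (\<lambda>e. g (map (\<lambda>f. f e) fs))"
proof -
  obtain p where p: "\<And>xs. length xs = length fs \<Longrightarrow> eval p xs (g xs)"
    using assms(1) unfolding computable_def by blast
  have "\<forall>f\<in>set fs. \<exists>r. \<forall>xs. length xs = n \<longrightarrow> eval r xs (f xs)"
    using assms(2) unfolding computable_def by blast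
  then obtain r where r: "\<And>f xs. f \<in> set fs \<Longrightarrow> length xs = n \<Longrightarrow> eval (r f) xs (f xs)"
    by metis
  show ?thesis
    by (rule cmI[of _ "Comp p (map r fs)"], rule eval_Comp[where ys = "map (\<lambda>f. f _) fs"])
      (auto intro!: p r)
qed

text \<open>Arguments are addressed as \<open>hd e\<close>, \<open>hd (tl e)\<close> and so on
  because recursion and bounded quantifiers put a new value in front of the list. Goals then match
  the rules in \<open>computable_intro\<close> syntactically, also under binders.\<close>

lemma computable_compose1:
  assumes "computable 1 (\<lambda>e. g (hd e))" "computable n f1"
  shows "computable n (\<lambda>e. g (f1 e))"
  using computable_compose[of "[f1]" "\<lambda>e. g (hd e)" n] assms by simp

lemma computable_compose2:
  assumes "computable 2 (\<lambda>e. g (hd e) (hd (tl e)))" "computable n f1" "computable n f2"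
  shows "computable n (\<lambda>e. g (f1 e) (f2 e))"
  using computable_compose[of "[f1, f2]" "\<lambda>e. g (hd e) (hd (tl e))" n] assms
  by (auto simp: numeral_eq_Suc)

lemma computable_compose3:
  assumes "computable 3 (\<lambda>e. g (hd e) (hd (tl e)) (hd (tl (tl e))))" "computable n f1"
    "computable n f2" "computable n f3"
  shows "computable n (\<lambda>e. g (f1 e) (f2 e) (f3 e))"
  using computable_compose[of "[f1, f2, f3]" "\<lambda>e. g (hd e) (hd (tl e)) (hd (tl (tl e)))" n] assms
  by (auto simp: numeral_eq_Suc)

lemma computable_compose4:
  assumes "computable 4 (\<lambda>e. g (hd e) (hd (tl e)) (hd (tl (tl e))) (hd (tl (tl (tl e)))))"
    "computable n f1" "computable n f2" "computable n f3" "computable n f4"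
  shows "computable n (\<lambda>e. g (f1 e) (f2 e) (f3 e) (f4 e))"
  using computable_compose[of "[f1, f2, f3, f4]"
      "\<lambda>e. g (hd e) (hd (tl e)) (hd (tl (tl e))) (hd (tl (tl (tl e))))" n] assms
  by (auto simp: numeral_eq_Suc)

lemma computable_compose5:
  assumes "computable 5 (\<lambda>e. g (hd e) (hd (tl e)) (hd (tl (tl e))) (hd (tl (tl (tl e))))
      (hd (tl (tl (tl (tl e))))))"
    "computable n f1" "computable n f2" "computable n f3" "computable n f4" "computable n f5"
  shows "computable n (\<lambda>e. g (f1 e) (f2 e) (f3 e) (f4 e) (f5 e))"
  using computable_compose[of "[f1, f2, f3, f4, f5]"
      "\<lambda>e. g (hd e) (hd (tl e)) (hd (tl (tl e))) (hd (tl (tl (tl e))))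
        (hd (tl (tl (tl (tl e)))))" n]
    assms by (auto simp: numeral_eq_Suc)

lemmas decidable_compose1 = computable_compose1[where g = "\<lambda>a. of_bool (P a)" for P,
  folded decidable_def]
lemmas decidable_compose2 = computable_compose2[where g = "\<lambda>a b. of_bool (P a b)" for P,
  folded decidable_def]
lemmas decidable_compose3 = computable_compose3[where g = "\<lambda>a b c. of_bool (P a b c)" for P,
  folded decidable_def]
lemmas decidable_compose4 = computable_compose4[where g = "\<lambda>a b c d. of_bool (P a b c d)" for P,
  folded decidable_def]
lemmas decidable_compose5 = computable_compose5[where g = "\<lambda>a b c d e. of_bool (P a b c d e)" for P,
  folded decidable_def]

lemma computable_var: "i < n \<Longrightarrow> computable n (\<lambda>e. hd ((tl ^^ i) e))"
proof -
  have "(tl ^^ i) e = drop i e" for e :: "nat list" by (induction i) (auto simp: drop_Suc tl_drop)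
  then show "i < n \<Longrightarrow> ?thesis"
    by (intro computable_cong[OF computable_nth[of i n]]) (auto simp: hd_drop_conv_nth)
qed

named_theorems computable_intro

text \<open>Ten positions are provided because the deepest formula, the run part of
  \<open>typ_par\<close>, has four parameters below six quantifiers.\<close>

lemmas computable_vars [computable_intro] =
  computable_var[of 0, simplified] computable_var[of "Suc 0", simplified]
  computable_var[of "Suc (Suc 0)", simplified] computable_var[of "Suc (Suc (Suc 0))", simplified]
  computable_var[of "Suc (Suc (Suc (Suc 0)))", simplified]
  computable_var[of "Suc (Suc (Suc (Suc (Suc 0))))", simplified]
  computable_var[of "Suc (Suc (Suc (Suc (Suc (Suc 0)))))", simplified]
  computable_var[of "Suc (Suc (Suc (Suc (Suc (Suc (Suc 0))))))", simplified]
  computable_var[of "Suc (Suc (Suc (Suc (Suc (Suc (Suc (Suc 0)))))))", simplified]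
  computable_var[of "Suc (Suc (Suc (Suc (Suc (Suc (Suc (Suc (Suc 0))))))))", simplified]

lemma computable_Suc [computable_intro]: "computable n f \<Longrightarrow> computable n (\<lambda>e. Suc (f e))"
proof (rule computable_compose1[of Suc])
  show "computable 1 (\<lambda>e. Suc (hd e))"
    by (rule cmI[of _ Sf]) (auto simp: length_Suc_conv intro: eval_S)
qed

lemma computable_const [computable_intro]: "computable n (\<lambda>e. c)"
proof (induction c)
  case 0 show ?case by (rule cmI[of _ Zf]) (rule eval_Z)
next
  case (Suc c) then show ?case by (rule computable_Suc)
qed

lemma computable_rec_nat:
  assumes f: "computable n f" and b: "computable n b"
    and g: "computable (Suc (Suc n)) (\<lambda>e. g (hd e) (hd (tl e)) (tl (tl e)))"
  shows "computable n (\<lambda>e. rec_nat (f e) (\<lambda>m y. g m y e) (b e))"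
proof -
  obtain pf where pf: "\<And>xs. length xs = n \<Longrightarrow> eval pf xs (f xs)"
    using f unfolding computable_def by blast
  obtain pg where pg: "\<And>xs. length xs = Suc (Suc n) \<Longrightarrow> eval pg xs (g (hd xs) (hd (tl xs))
    (tl (tl xs)))"
    using g unfolding computable_def by blast
  have "eval (Prim pf pg) (m # xs) (rec_nat (f xs) (\<lambda>m y. g m y xs) m)" if "length xs = n" for m xs
  proof (induction m)
    case 0 show ?case using pf that by (simp add: eval_Prim0)
  next
    case (Suc m)
    show ?case
      using eval_PrimS[OF Suc] pg[of "m # rec_nat (f xs) (\<lambda>m y. g m y xs) m # xs"] that by simp
  qed
  then have 1: "computable (Suc n) (\<lambda>e. rec_nat (f (tl e)) (\<lambda>m y. g m y (tl e)) (hd e))"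
    by (intro cmI[of _ "Prim pf pg"]) (auto simp: length_Suc_conv)
  \<comment> \<open>\<open>Prim\<close> recurses on the head of its argument list, so the recursion
    argument \<open>b\<close> is put in front of a copy of all parameters.\<close>
  let ?fs = "b # map (\<lambda>i e. e ! i) [0..<n]"
  have "computable n (\<lambda>e. (\<lambda>e. rec_nat (f (tl e)) (\<lambda>m y. g m y (tl e)) (hd e)) (map (\<lambda>f. f e) ?fs))"
    by (rule computable_compose) (use 1 b computable_nth in auto)
  then show ?thesis
  proof (rule computable_cong)
    fix xs :: "nat list" assume "length xs = n"
    then have "map (\<lambda>f. f xs) (map (\<lambda>i e. e ! i) [0..<n]) = xs"
      using map_nth[of xs] by (simp add: comp_def)
    then show "rec_nat (f (tl (map (\<lambda>f. f xs) ?fs))) (\<lambda>m y. g m y (tl (map (\<lambda>f. f xs) ?fs)))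
        (hd (map (\<lambda>f. f xs) ?fs)) = rec_nat (f xs) (\<lambda>m y. g m y xs) (b xs)"
      by simp
  qed
qed

lemma computable_add [computable_intro]:
  assumes "computable n f" "computable n g" shows "computable n (\<lambda>e. f e + g e)"
proof (rule computable_compose2[OF _ assms])
  have "computable 2 (\<lambda>e. rec_nat (hd e) (\<lambda>m y. Suc y) (hd (tl e)))"
    by (rule computable_rec_nat) (intro computable_intro; simp)+
  moreover have "rec_nat a (\<lambda>m y. Suc y) b = a + b" for a b :: nat by (induction b) auto
  ultimately show "computable 2 (\<lambda>e. hd e + hd (tl e))" by simp
qed

lemma computable_pred: "computable n f \<Longrightarrow> computable n (\<lambda>e. f e - Suc 0)"
proof (rule computable_compose1[of "\<lambda>a. a - Suc 0"])
  have "computable 1 (\<lambda>e. rec_nat 0 (\<lambda>m y. m) (hd e))"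
    by (rule computable_rec_nat) (intro computable_intro; simp)+
  moreover have "rec_nat 0 (\<lambda>m y. m) b = b - Suc 0" for b :: nat by (cases b) auto
  ultimately show "computable 1 (\<lambda>e. hd e - Suc 0)" by simp
qed

lemma computable_diff [computable_intro]:
  assumes "computable n f" "computable n g" shows "computable n (\<lambda>e. f e - g e)"
proof (rule computable_compose2[OF _ assms])
  have "computable 2 (\<lambda>e. rec_nat (hd e) (\<lambda>m y. y - Suc 0) (hd (tl e)))"
    by (rule computable_rec_nat) (intro computable_intro computable_pred; simp)+
  moreover have "rec_nat a (\<lambda>m y. y - Suc 0) b = a - b" for a b :: nat by (induction b) auto
  ultimately show "computable 2 (\<lambda>e. hd e - hd (tl e))" by simp
qed

lemma computable_mult [computable_intro]:
  assumes "computable n f" "computable n g" shows "computable n (\<lambda>e. f e * g e)"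
proof (rule computable_compose2[OF _ assms])
  have "computable 2 (\<lambda>e. rec_nat 0 (\<lambda>m y. y + hd e) (hd (tl e)))"
    by (rule computable_rec_nat) (intro computable_intro; simp)+
  moreover have "rec_nat 0 (\<lambda>m y. y + a) b = a * b" for a b :: nat by (induction b) auto
  ultimately show "computable 2 (\<lambda>e. hd e * hd (tl e))" by simp
qed

lemma decidable_cong: "decidable n P \<Longrightarrow> (\<And>xs. length xs = n \<Longrightarrow> P xs = Q xs) \<Longrightarrow> decidable n Q"
  unfolding decidable_def by (erule computable_cong) simp

lemma decidable_not [computable_intro]: "decidable n P \<Longrightarrow> decidable n (\<lambda>e. \<not> P e)"
  unfolding decidable_def
    by (rule computable_cong[OF computable_diff[OF computable_const[of n 1]]]) auto

lemma decidable_conj [computable_intro]: "decidable n P \<Longrightarrow> decidable n Q \<Longrightarrow> decidable n (\<lambda>e. P e \<and>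
  Q e)"
  unfolding decidable_def of_bool_conj by (rule computable_mult)

lemma decidable_disj [computable_intro]: "decidable n P \<Longrightarrow> decidable n Q \<Longrightarrow>
  decidable n (\<lambda>e. P e \<or> Q e)"
  by (rule decidable_cong[OF decidable_not[OF decidable_conj[OF decidable_not decidable_not]]]) auto

lemma decidable_imp [computable_intro]: "decidable n P \<Longrightarrow> decidable n Q \<Longrightarrow> decidable n (\<lambda>e. P e \<longrightarrow>
  Q e)"
  by (rule decidable_cong[OF decidable_disj[OF decidable_not]]) auto

lemma decidable_iff [computable_intro]: "decidable n P \<Longrightarrow> decidable n Q \<Longrightarrow> decidable n (\<lambda>e. P e \<longleftrightarrow>
  Q e)"
  by (rule decidable_cong[of n "\<lambda>e. (P e \<longrightarrow> Q e) \<and> (Q e \<longrightarrow> P e)"]) (intro computable_intro | auto)+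

lemma decidable_eq [computable_intro]:
  assumes "computable n f" "computable n g" shows "decidable n (\<lambda>e. f e = g e)"
  unfolding decidable_def
  by (rule computable_cong[of n "\<lambda>e. 1 - ((f e - g e) + (g e - f e))"])
    (intro computable_intro assms | auto)+

lemma decidable_less [computable_intro]:
  assumes "computable n f" "computable n g" shows "decidable n (\<lambda>e. f e < g e)"
  by (rule decidable_cong[of n "\<lambda>e. \<not> g e - f e = 0"]) (intro computable_intro assms | auto)+

lemma computable_if [computable_intro]:
  assumes "decidable n P" "computable n f" "computable n g" shows
    "computable n (\<lambda>e. if P e then f e else g e)"
proof (rule computable_cong)
  show "computable n (\<lambda>e. of_bool (P e) * f e + of_bool (\<not> P e) * g e)"
    by (intro computable_intro assms assms(1)[unfolded decidable_def]
      decidable_not[unfolded decidable_def])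
qed auto

text \<open>The search is a primitive recursion that carries a flag.\<close>

lemma decidable_bex [computable_intro]:
  assumes b: "computable n b" and P: "decidable (Suc n) (\<lambda>e. P (hd e) (tl e))"
  shows "decidable n (\<lambda>e. \<exists>y<b e. P y e)"
proof -
  \<comment> \<open>The step function of the recursion sees the flag in second position, so
    \<open>P\<close> has to be weakened by a variable there.\<close>
  have P': "decidable (Suc (Suc n)) (\<lambda>e. P (hd e) (tl (tl e)))"
  proof -
    let ?fs = "(\<lambda>e. e ! 0) # map (\<lambda>i e. e ! Suc (Suc i)) [0..<n]"
    have "computable (Suc (Suc n)) (\<lambda>e. (\<lambda>e. of_bool (P (hd e) (tl e))) (map (\<lambda>f. f e) ?fs))"
      by (rule computable_compose) (use P computable_nth[of 0 "Suc (Suc n)"]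
        in \<open>auto simp: decidable_def intro: computable_nth\<close>)
    then show ?thesis unfolding decidable_def
    proof (rule computable_cong)
      fix xs :: "nat list" assume *: "length xs = Suc (Suc n)"
      have "map (\<lambda>f. f xs) (map (\<lambda>i e. e ! Suc (Suc i)) [0..<n]) = tl (tl xs)"
        by (rule nth_equalityI) (use * in \<open>auto simp: nth_tl\<close>)
      then show "of_bool (P (hd (map (\<lambda>f. f xs) ?fs)) (tl (map (\<lambda>f. f xs) ?fs))) =
          (of_bool (P (hd xs) (tl (tl xs))) :: nat)"
        using * by (cases xs) auto
    qed
  qed
  have "computable n (\<lambda>e. rec_nat 0 (\<lambda>m y. if P m e then 1 else y) (b e))"
    by (rule computable_rec_nat) (intro computable_intro b P' | simp)+
  moreover have "rec_nat 0 (\<lambda>m y. if P m e then 1 else y) c = (of_bool (\<exists>y<c. P y e) :: nat)" for e c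
    by (induction c) (auto simp: less_Suc_eq)
  ultimately show ?thesis by (simp only: decidable_def)
qed

lemma decidable_ball [computable_intro]:
  assumes "computable n b" and "decidable (Suc n) (\<lambda>e. P (hd e) (tl e))"
  shows "decidable n (\<lambda>e. \<forall>y<b e. P y e)"
  by (rule decidable_cong[OF decidable_not[OF decidable_bex[OF assms(1) decidable_not[OF assms(2)]]]]) auto

text \<open>\<open>Mn\<close> looks for a zero, so it is applied to the characteristic function of
  the negation. A witness is demanded only for the argument at hand; this matters because tables are
  shown to exist for valid inputs only.\<close>

lemma computable_Least:
  assumes P: "decidable (Suc n) (\<lambda>e. P (hd e) (tl e))"
  shows "\<exists>p. \<forall>xs. length xs = n \<longrightarrow> (\<exists>m. P m xs) \<longrightarrow> eval p xs (LEAST m. P m xs)"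
proof -
  have "decidable (Suc n) (\<lambda>e. \<not> P (hd e) (tl e))" using P by (rule decidable_not)
  then obtain p where p: "\<And>xs. length xs = Suc n \<Longrightarrow> eval p xs (of_bool (\<not> P (hd xs) (tl xs)))"
    unfolding computable_def decidable_def by blast
  have "eval (Mn p) xs (LEAST m. P m xs)" if "length xs = n" "\<exists>m. P m xs" for xs
  proof (rule eval_Mn)
    show "eval p ((LEAST m. P m xs) # xs) 0"
      using p[of "(LEAST m. P m xs) # xs"] LeastI_ex[OF that(2)] that(1) by simp
    show "\<forall>m<(LEAST m. P m xs). \<exists>y. eval p (m # xs) y \<and> 0 < y"
    proof (intro allI impI)
      fix m assume "m < (LEAST m. P m xs)"
      then have "\<not> P m xs" by (rule not_less_Least)
      then show "\<exists>y. eval p (m # xs) y \<and> 0 < y"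
        using p[of "m # xs"] that(1) by (intro exI[of _ 1]) simp
    qed
  qed
  then show ?thesis by blast
qed

lemma computable_Least_total:
  assumes P: "decidable (Suc n) (\<lambda>e. P (hd e) (tl e))" and "\<And>e. \<exists>m. P m e"
  shows "computable n (\<lambda>e. LEAST m. P m e)"
  using computable_Least[OF P] assms(2) unfolding computable_def by auto

lemma computable_prod_encode [computable_intro]:
  assumes "computable n f" "computable n g" shows "computable n (\<lambda>e. prod_encode (f e, g e))"
proof -
  have "computable 1 (\<lambda>e. rec_nat 0 (\<lambda>m y. y + Suc m) (hd e))"
    by (rule computable_rec_nat) (intro computable_intro; simp)+
  moreover have "rec_nat 0 (\<lambda>m y. y + Suc m) b = triangle b" for b by (induction b) auto
  ultimately have "computable 1 (\<lambda>e. triangle (hd e))" by simp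
  note [computable_intro] = computable_compose1[OF this]
  show ?thesis unfolding prod_encode_def by simp (intro computable_intro assms)
qed

section \<open>Arithmetic on list codes\<close>

definition lhd :: "nat \<Rightarrow> nat" where "lhd l = fst (prod_decode (l - 1))"
definition ltl :: "nat \<Rightarrow> nat" where "ltl l = snd (prod_decode (l - 1))"

text \<open>The component is found by search. The other component is at most the code of the pair,
  which bounds the inner quantifier.\<close>

lemma computable_lhd [computable_intro]: "computable n f \<Longrightarrow> computable n (\<lambda>e. lhd (f e))"
proof (rule computable_compose1[of lhd])
  have *: "\<exists>a b. b < Suc y \<and> prod_encode (a, b) = y" for y
    by (metis le_imp_less_Suc le_prod_encode_2 prod_decode_inverse surj_pair)
  have "computable 1 (\<lambda>e. LEAST a. \<exists>b<Suc (hd e - 1). prod_encode (a, b) = hd e - 1)"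
    by (rule computable_Least_total) (intro computable_intro; simp | use * in blast)+
  moreover have "lhd l = (LEAST a. \<exists>b<Suc (l - 1). prod_encode (a, b) = l - 1)" for l
    unfolding lhd_def
    by (rule Least_equality[symmetric])
       (metis le_imp_less_Suc le_prod_encode_2 prod_decode_inverse prod.collapse,
        metis fst_conv order_refl prod_encode_inverse)
  ultimately show "computable 1 (\<lambda>e. lhd (hd e))" by simp
qed

lemma computable_ltl [computable_intro]: "computable n f \<Longrightarrow> computable n (\<lambda>e. ltl (f e))"
proof (rule computable_compose1[of ltl])
  have *: "\<exists>b a. a < Suc y \<and> prod_encode (a, b) = y" for y
    by (metis le_imp_less_Suc le_prod_encode_1 prod_decode_inverse surj_pair)
  have "computable 1 (\<lambda>e. LEAST b. \<exists>a<Suc (hd e - 1). prod_encode (a, b) = hd e - 1)"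
    by (rule computable_Least_total) (intro computable_intro; simp | use * in blast)+
  moreover have "ltl l = (LEAST b. \<exists>a<Suc (l - 1). prod_encode (a, b) = l - 1)" for l
    unfolding ltl_def
    by (rule Least_equality[symmetric])
       (metis le_imp_less_Suc le_prod_encode_1 prod_decode_inverse prod.collapse,
        metis snd_conv order_refl prod_encode_inverse)
  ultimately show "computable 1 (\<lambda>e. ltl (hd e))" by simp
qed

lemma lhd_encode [simp]: "lhd (Suc (prod_encode (x, y))) = x"
  by (simp add: lhd_def)

text \<open>This includes \<open>[]\<close>: its code 0 stays 0 under the truncated predecessor and
  decodes to the pair (0, 0), so the empty list is its own tail and \<open>ldrop\<close> beyond the
  end remains there.\<close>

lemma ltl_encode [simp]: "ltl (list_encode xs) = list_encode (tl xs)"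
  by (cases xs) (simp_all add: ltl_def, simp add: prod_decode_def prod_decode_aux.simps)

definition ldrop :: "nat \<Rightarrow> nat \<Rightarrow> nat" where "ldrop i l = rec_nat l (\<lambda>_. ltl) i"
definition lnth :: "nat \<Rightarrow> nat \<Rightarrow> nat" where "lnth l i = lhd (ldrop i l)"

lemma computable_ldrop [computable_intro]: "computable n f \<Longrightarrow> computable n g \<Longrightarrow>
  computable n (\<lambda>e. ldrop (f e) (g e))"
  unfolding ldrop_def by (rule computable_rec_nat, assumption+) (intro computable_intro; simp)

lemma computable_lnth [computable_intro]: "computable n f \<Longrightarrow> computable n g \<Longrightarrow>
  computable n (\<lambda>e. lnth (f e) (g e))"
  unfolding lnth_def by (intro computable_intro)

lemma ldrop_encode [simp]: "ldrop i (list_encode xs) = list_encode (drop i xs)"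
  by (induction i) (auto simp: ldrop_def drop_Suc tl_drop)

lemma list_encode_eq_0_iff [simp]: "list_encode xs = 0 \<longleftrightarrow> xs = []"
  by (cases xs) auto

lemma lnth_encode [simp]: "i < length xs \<Longrightarrow> lnth (list_encode xs) i = xs ! i"
  by (simp add: lnth_def flip: Cons_nth_drop_Suc)

lemma length_le_list_encode: "length xs \<le> list_encode xs"
proof (induction xs)
  case (Cons x xs)
  show ?case using Cons le_prod_encode_2[of "list_encode xs" x] by simp
qed simp

text \<open>A list is no longer than its code, so the code itself bounds the positions;
  \<open>ldrop i l \<noteq> 0\<close> says that position \<open>i\<close> lies inside the
  list.\<close>

definition lmem :: "nat \<Rightarrow> nat \<Rightarrow> bool" where
  "lmem y l \<longleftrightarrow> (\<exists>i<l. ldrop i l \<noteq> 0 \<and> lnth l i = y)"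

lemma decidable_lmem [computable_intro]: "computable n f \<Longrightarrow> computable n g \<Longrightarrow>
  decidable n (\<lambda>e. lmem (f e) (g e))"
  by (rule decidable_compose2[where P = lmem]) (unfold lmem_def, (intro computable_intro; simp))

lemma lmem_encode [simp]: "lmem y (list_encode xs) \<longleftrightarrow> y \<in> set xs"
proof -
  have "(\<exists>i<list_encode xs. ldrop i (list_encode xs) \<noteq> 0 \<and> lnth (list_encode xs) i = y)
      \<longleftrightarrow> (\<exists>i<length xs. xs ! i = y)"
    using length_le_list_encode[of xs]
    by (metis drop_eq_Nil ldrop_encode list_encode_eq_0_iff lnth_encode not_le order_less_le_trans)
  then show ?thesis unfolding lmem_def in_set_conv_nth .
qed

section \<open>Multisets coded as products of primes\<close>

primrec nth_prime :: "nat \<Rightarrow> nat" where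
  "nth_prime 0 = 2"
| "nth_prime (Suc i) = (LEAST p. prime p \<and> nth_prime i < p)"

lemma prime_nth_prime_Suc: "prime (nth_prime (Suc i)) \<and> nth_prime i < nth_prime (Suc i)"
  unfolding nth_prime.simps by (rule LeastI_ex) (use bigger_prime in blast)

lemma prime_nth_prime: "prime (nth_prime i)"
  by (cases i) (use prime_nth_prime_Suc in auto)

lemma inj_nth_prime: "inj nth_prime"
  by (rule strict_mono_imp_inj_on) (use prime_nth_prime_Suc strict_mono_Suc_iff in blast)

lemma decidable_prime [computable_intro]: "computable n f \<Longrightarrow> decidable n (\<lambda>e. prime (f e :: nat))"
proof (rule decidable_compose1[where P = prime])
  have "decidable 1 (\<lambda>e. 1 < hd e \<and> (\<forall>a<hd e. \<forall>b<hd e. a * b \<noteq> hd e))"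
    by (intro computable_intro; simp)
  moreover have "prime p \<longleftrightarrow> 1 < p \<and> (\<forall>a<p. \<forall>b<p. a * b \<noteq> p)" for p :: nat
  proof (intro iffI conjI)
    assume p: "prime p"
    show "1 < p" using p by (rule prime_gt_1_nat)
    show "\<forall>a<p. \<forall>b<p. a * b \<noteq> p"
    proof (intro allI impI notI)
      fix a b assume "a < p" "b < p" "a * b = p"
      moreover from this have "a = 1 \<or> b = 1" using p prime_product by blast
      ultimately show False by auto
    qed
  next
    assume *: "1 < p \<and> (\<forall>a<p. \<forall>b<p. a * b \<noteq> p)"
    show "prime p" unfolding prime_nat_iff
    proof (intro conjI allI impI)
      show "1 < p" using * by blast
      fix a assume "a dvd p"
      then obtain b where b: "p = a * b" by (auto simp: dvd_def)
      then have pos: "0 < a" "0 < b" using * by (auto intro!: Nat.gr0I)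
      then have "a \<le> p" "b \<le> p" using b by auto
      moreover have "\<not> (a < p \<and> b < p)" using * b by blast
      ultimately have "a = p \<or> b = p" by linarith
      then show "a = 1 \<or> a = p" using b pos by auto
    qed
  qed
  ultimately show "decidable 1 (\<lambda>e. prime (hd e))" by simp
qed

lemma computable_nth_prime [computable_intro]: "computable n f \<Longrightarrow> computable n (\<lambda>e. nth_prime (f e))"
proof (rule computable_compose1[of nth_prime])
  have "computable 1 (\<lambda>e. LEAST p. prime p \<and> hd e < p)"
    by (rule computable_Least_total) (intro computable_intro; simp | use bigger_prime in blast)+
  note [computable_intro] = computable_compose1[OF this]
  have "computable 1 (\<lambda>e. rec_nat 2 (\<lambda>i y. LEAST p. prime p \<and> y < p) (hd e))"
    by (rule computable_rec_nat) (intro computable_intro; simp)+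
  moreover have "rec_nat 2 (\<lambda>i y. LEAST p. prime p \<and> y < p) i = nth_prime i" for i
    by (induction i) auto
  ultimately show "computable 1 (\<lambda>e. nth_prime (hd e))" by simp
qed

text \<open>In contrast to a list code this does not depend on an order of the leaves, and sums of
  multisets become products, so the closure rules of the tables turn into plain arithmetic.\<close>

definition mcode :: "nat multiset \<Rightarrow> nat" where
  "mcode \<phi> = prod_mset (image_mset nth_prime \<phi>)"

lemma mcode_simps [simp]: "mcode {#} = 1" "mcode (add_mset x \<phi>) = nth_prime x * mcode \<phi>"
  "mcode (\<phi> + \<psi>) = mcode \<phi> * mcode \<psi>"
  by (simp_all add: mcode_def)

lemma mcode_pos: "0 < mcode \<phi>"
  by (induction \<phi>) (use prime_nth_prime prime_gt_0_nat in auto)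

text \<open>Unique factorization recovers the multiset of primes, and distinct states have distinct
  primes.\<close>

lemma inj_mcode: "mcode \<phi> = mcode \<psi> \<longleftrightarrow> \<phi> = \<psi>"
proof
  assume "mcode \<phi> = mcode \<psi>"
  then have "prime_factorization (mcode \<phi>) = prime_factorization (mcode \<psi>)" by simp
  then have "image_mset nth_prime \<phi> = image_mset nth_prime \<psi>"
    unfolding mcode_def
    by (subst (asm) (1 2) prime_factorization_prod_mset_primes) (use prime_nth_prime in auto)
  then show "\<phi> = \<psi>" by (rule injD[OF multiset.inj_map[OF inj_nth_prime]])
qed simp

text \<open>The code serves as an upper bound for the number of iterations; those beyond the end of
  the list leave the product unchanged.\<close>

definition lcode :: "nat \<Rightarrow> nat" where
  "lcode l = rec_nat 1 (\<lambda>i y. if ldrop i l = 0 then y else nth_prime (lnth l i) * y) l"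

lemma computable_lcode [computable_intro]: "computable n f \<Longrightarrow> computable n (\<lambda>e. lcode (f e))"
  by (rule computable_compose1[of lcode]) (unfold lcode_def, rule computable_rec_nat,
    (intro computable_intro; simp)+)

lemma lcode_encode [simp]: "lcode (list_encode ps) = mcode (mset ps)"
proof -
  have "rec_nat 1 (\<lambda>i y. if ldrop i (list_encode ps) = 0 then y else nth_prime (lnth (list_encode ps) i) * y) m
      = mcode (mset (take m ps))" for m
    by (induction m) (auto simp: take_Suc_conv_app_nth not_le)
  then show ?thesis unfolding lcode_def using length_le_list_encode[of ps] by simp
qed

lemma computable_list_encode [computable_intro]:
  "computable n (\<lambda>e. list_encode [])"
  "computable n f \<Longrightarrow> computable n (\<lambda>e. list_encode (g e)) \<Longrightarrow>
    computable n (\<lambda>e. list_encode (f e # g e))"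
  unfolding list_encode.simps by (intro computable_intro)+

section \<open>Runs on subsets of a labelled poset\<close>

text \<open>The negative half makes \<open>X\<close> and \<open>Y\<close> disjoint, whatever the
  relation \<open>R\<close> is.\<close>

definition seqsep :: "(nat \<times> nat) set \<Rightarrow> nat set \<Rightarrow> nat set \<Rightarrow> bool" where
  "seqsep R X Y \<longleftrightarrow> (\<forall>x\<in>X. \<forall>y\<in>Y. (x, y) \<in> R \<and> (y, x) \<notin> R)"

definition parsep :: "(nat \<times> nat) set \<Rightarrow> nat set \<Rightarrow> nat set \<Rightarrow> bool" where
  "parsep R X Y \<longleftrightarrow> X \<inter> Y = {} \<and> (\<forall>x\<in>X. \<forall>y\<in>Y. (x, y) \<notin> R \<and> (y, x) \<notin> R)"

definition conn :: "(nat \<times> nat) set \<Rightarrow> nat set \<Rightarrow> bool" where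
  "conn R X \<longleftrightarrow> X \<noteq> {} \<and> (\<forall>A B. X = A \<union> B \<and> parsep R A B \<longrightarrow> A = {} \<or> B = {})"

text \<open>Surjectivity is left out on purpose: pomsets occur as subsets of one ambient poset, and
  the same notion serves for restricting to subsets, for placing a factor inside a product and for
  moving between representatives.\<close>

definition emb :: "(nat \<Rightarrow> nat) \<Rightarrow> nat set \<Rightarrow> (nat \<times> nat) set \<Rightarrow> (nat \<Rightarrow> nat) \<Rightarrow>
    (nat \<times> nat) set \<Rightarrow> (nat \<Rightarrow> nat) \<Rightarrow> bool" where
  "emb f X R l R' l' \<longleftrightarrow> inj_on f X \<and> (\<forall>x\<in>X. \<forall>y\<in>X. (x, y) \<in> R \<longleftrightarrow> (f x, f y) \<in> R')
     \<and> (\<forall>x\<in>X. l' (f x) = l x)"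

lemma seqsep_empty [simp]: "seqsep R {} Y" "seqsep R X {}"
  by (auto simp: seqsep_def)

lemma parsep_empty [simp]: "parsep R {} Y" "parsep R X {}"
  by (auto simp: parsep_def)

lemma seqsep_Un [simp]:
  "seqsep R (X \<union> Y) Z \<longleftrightarrow> seqsep R X Z \<and> seqsep R Y Z"
  "seqsep R Z (X \<union> Y) \<longleftrightarrow> seqsep R Z X \<and> seqsep R Z Y"
  by (auto simp: seqsep_def)

lemma parsep_Un [simp]:
  "parsep R (X \<union> Y) Z \<longleftrightarrow> parsep R X Z \<and> parsep R Y Z"
  "parsep R Z (X \<union> Y) \<longleftrightarrow> parsep R Z X \<and> parsep R Z Y"
  by (auto simp: parsep_def)

lemma parsep_commute: "parsep R X Y \<longleftrightarrow> parsep R Y X"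
  by (auto simp: parsep_def)

lemma parsep_mono: "parsep R X Y \<Longrightarrow> A \<subseteq> X \<Longrightarrow> B \<subseteq> Y \<Longrightarrow> parsep R A B"
  unfolding parsep_def by blast

lemma seqsep_mono: "seqsep R X Y \<Longrightarrow> A \<subseteq> X \<Longrightarrow> B \<subseteq> Y \<Longrightarrow> seqsep R A B"
  unfolding seqsep_def by blast

lemma conn_nonempty: "conn R X \<Longrightarrow> X \<noteq> {}"
  by (simp add: conn_def)

lemma connD: "conn R X \<Longrightarrow> X = A \<union> B \<Longrightarrow> parsep R A B \<Longrightarrow> A = {} \<or> B = {}"
  by (simp add: conn_def)

lemma conn_single [simp]: "conn R {x}"
proof -
  have "A = {} \<or> B = {}" if "{x} = A \<union> B" "A \<inter> B = {}" for A B
  proof -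
    have "A \<subseteq> {x}" "B \<subseteq> {x}" using that(1) by simp_all
    then have "(A = {} \<or> A = {x}) \<and> (B = {} \<or> B = {x})" by (simp add: subset_singleton_iff)
    then show ?thesis using that(2) by auto
  qed
  then show ?thesis unfolding conn_def parsep_def by blast
qed

text \<open>A point of \<open>X\<close> and a point of \<open>Y\<close> are comparable, so they lie
  in the same part of a parallel splitting, and any point of the other part would be comparable with
  one of them. Hence a set that is not connected has trivial sequential cuts only.\<close>

lemma conn_seq:
  assumes "seqsep R X Y" "X \<noteq> {}" "Y \<noteq> {}" shows "conn R (X \<union> Y)"
  unfolding conn_def
proof (intro conjI allI impI)
  show "X \<union> Y \<noteq> {}" using assms by blast
  fix A B assume *: "X \<union> Y = A \<union> B \<and> parsep R A B"
  show "A = {} \<or> B = {}"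
  proof (rule ccontr)
    assume "\<not> (A = {} \<or> B = {})"
    then obtain a b where ab: "a \<in> A" "b \<in> B" by blast
    have 1: "\<not> (a \<in> X \<and> b \<in> Y)" "\<not> (a \<in> Y \<and> b \<in> X)" if "a \<in> A" "b \<in> B" for a b
      using that * assms(1) unfolding parsep_def seqsep_def by blast+
    obtain x y where xy: "x \<in> X" "y \<in> Y" using assms by blast
    then have "x \<in> A \<union> B" "y \<in> A \<union> B" "a \<in> X \<union> Y" "b \<in> X \<union> Y" using * ab by blast+
    then show False using 1 ab xy by blast
  qed
qed

lemma not_conn_par: "parsep R X Y \<Longrightarrow> X \<noteq> {} \<Longrightarrow> Y \<noteq> {} \<Longrightarrow> \<not> conn R (X \<union> Y)"
  using connD by blast

lemma conn_in_par:
  assumes "conn R X" "X \<subseteq> A \<union> B" "parsep R A B" shows "X \<subseteq> A \<or> X \<subseteq> B"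
proof -
  have "X = (X \<inter> A) \<union> (X \<inter> B)" using assms by blast
  moreover have "parsep R (X \<inter> A) (X \<inter> B)" using assms(3) by (rule parsep_mono) auto
  ultimately have "X \<inter> A = {} \<or> X \<inter> B = {}" by (rule connD[OF assms(1)])
  then show ?thesis using assms by blast
qed

text \<open>A point of \<open>A\<close> outside \<open>C\<close> and a point of \<open>C\<close>
  outside \<open>A\<close> would each have to precede the other, the first by the cut into
  \<open>A\<close> and \<open>B\<close>, the second by the cut into \<open>C\<close> and
  \<open>D\<close>.\<close>

lemma levi:
  assumes "A \<union> B = C \<union> D" "seqsep R A B" "seqsep R C D"
  shows "A \<subseteq> C \<or> C \<subseteq> A"
proof (rule ccontr)
  assume "\<not> (A \<subseteq> C \<or> C \<subseteq> A)"
  then obtain x y where "x \<in> A" "x \<notin> C" "y \<in> C" "y \<notin> A" by blast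
  moreover from this have "x \<in> D" "y \<in> B" using assms by blast+
  ultimately show False using assms unfolding seqsep_def by blast
qed

lemma emb_mono: "emb f X R l R' l' \<Longrightarrow> A \<subseteq> X \<Longrightarrow> emb f A R l R' l'"
  unfolding emb_def by (meson inj_on_subset subsetD)

lemma emb_inv:
  assumes "emb f X R l R' l'" shows "emb (inv_into X f) (f ` X) R' l' R l"
  using assms unfolding emb_def by (auto simp: inj_on_inv_into)

lemma emb_seqsep: "emb f (X \<union> Y) R l R' l' \<Longrightarrow> seqsep R X Y \<Longrightarrow> seqsep R' (f ` X) (f ` Y)"
  unfolding emb_def seqsep_def by auto

lemma emb_parsep:
  assumes "emb f (X \<union> Y) R l R' l'" "parsep R X Y" shows "parsep R' (f ` X) (f ` Y)"
proof -
  have "f x \<noteq> f y" if "x \<in> X" "y \<in> Y" for x y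
    using that assms unfolding emb_def parsep_def inj_on_def by blast
  then show ?thesis using assms unfolding emb_def parsep_def by auto
qed

lemma emb_conn:
  assumes f: "emb f X R l R' l'" and "conn R X" shows "conn R' (f ` X)"
  unfolding conn_def
proof (intro conjI allI impI)
  show "f ` X \<noteq> {}" using conn_nonempty[OF assms(2)] by simp
  fix A B assume *: "f ` X = A \<union> B \<and> parsep R' A B"
  let ?A = "{x \<in> X. f x \<in> A}" and ?B = "{x \<in> X. f x \<in> B}"
  have "f x \<in> A \<union> B" if "x \<in> X" for x using * that by auto
  then have "X = ?A \<union> ?B" by blast
  moreover have "parsep R ?A ?B"
    unfolding parsep_def
  proof (intro conjI ballI)
    show "?A \<inter> ?B = {}" using * unfolding parsep_def by auto
    fix x y assume "x \<in> ?A" "y \<in> ?B"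
    then have "(f x, f y) \<notin> R' \<and> (f y, f x) \<notin> R'" "x \<in> X" "y \<in> X" using * unfolding parsep_def
      by auto
    then show "(x, y) \<notin> R" "(y, x) \<notin> R" using f unfolding emb_def by auto
  qed
  ultimately have "?A = {} \<or> ?B = {}" by (rule connD[OF assms(2)])
  moreover have "A \<subseteq> f ` X" "B \<subseteq> f ` X" using * by simp_all
  ultimately show "A = {} \<or> B = {}" by blast
qed

section \<open>Runs, unfolded forks and runs on stacks\<close>

locale pa =
  fixes n :: nat and F :: "nat set" and \<delta> :: "nat \<Rightarrow> nat \<Rightarrow> nat set" and \<gamma> ::
    "nat \<Rightarrow> nat multiset \<Rightarrow> nat set"
  assumes F_n: "q \<in> F \<Longrightarrow> q < n"
    and \<delta>_n: "q' \<in> \<delta> q a \<Longrightarrow> q < n \<and> q' < n"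
    and \<gamma>_n: "q' \<in> \<gamma> q \<phi> \<Longrightarrow> q < n \<and> q' < n \<and> set_mset \<phi> \<subseteq> {..<n}"
begin

text \<open>The relation \<open>run\<close> glues representatives with disjoint carriers up to
  isomorphism. Here all parts of a run are subsets of one fixed poset, so they can be cut and
  recombined without renaming. \<open>spar\<close> adds the branches of a fork one by one, which
  allows induction over them.\<close>

inductive srun :: "(nat \<times> nat) set \<Rightarrow> (nat \<Rightarrow> nat) \<Rightarrow> nat \<Rightarrow> nat set \<Rightarrow> nat \<Rightarrow> bool"
  and spar :: "(nat \<times> nat) set \<Rightarrow> (nat \<Rightarrow> nat) \<Rightarrow> nat set \<Rightarrow> nat multiset \<Rightarrow> bool"
  for R l where
  srun_empty: "srun R l q {} q"
| srun_letter: "q' \<in> \<delta> q (l x) \<Longrightarrow> (x, x) \<in> R \<Longrightarrow> srun R l q {x} q'"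
| srun_seq: "srun R l q X m \<Longrightarrow> srun R l m Y q' \<Longrightarrow> seqsep R X Y \<Longrightarrow> srun R l q (X \<union> Y) q'"
| srun_fork: "spar R l X \<phi> \<Longrightarrow> q' \<in> \<gamma> q \<phi> \<Longrightarrow> srun R l q X q'"
| spar_empty: "spar R l {} {#}"
| spar_add: "srun R l q X f \<Longrightarrow> f \<in> F \<Longrightarrow> parsep R X Y \<Longrightarrow> spar R l Y \<phi> \<Longrightarrow>
    spar R l (X \<union> Y) (add_mset q \<phi>)"

text \<open>In \<open>expand q q' \<chi> \<psi>\<close> forks have been unfolded into the leaves \<open>\<psi>\<close>, while the
  forked states \<open>\<chi>\<close> are still to be processed.\<close>
inductive expand :: "nat \<Rightarrow> nat \<Rightarrow> nat multiset \<Rightarrow> nat multiset \<Rightarrow> bool" where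
  expand_refl: "q < n \<Longrightarrow> expand q q {#} {#}"
| expand_fork: "q' \<in> \<gamma> q \<phi> \<Longrightarrow> expand q q' \<phi> {#}"
| expand_leaf: "expand q q' (add_mset r \<chi>) \<psi> \<Longrightarrow> expand q q' \<chi> (add_mset r \<psi>)"
| expand_sub: "expand q q' (add_mset r \<chi>) \<psi> \<Longrightarrow> expand r f {#} \<psi>' \<Longrightarrow> f \<in> F \<Longrightarrow>
    expand q q' \<chi> (\<psi>' + \<psi>)"
| expand_comp: "expand q m {#} \<psi> \<Longrightarrow> expand m q' {#} \<psi>' \<Longrightarrow> \<psi> = {#} \<or> \<psi>' = {#} \<Longrightarrow>
    expand q q' {#} (\<psi> + \<psi>')"

lemma expand_n: "expand q q' \<chi> \<psi> \<Longrightarrow> q < n \<and> q' < n \<and> set_mset \<chi> \<subseteq> {..<n} \<and> set_mset \<psi> \<subseteq> {..<n}"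
  by (induction rule: expand.induct) (auto dest: \<gamma>_n)

text \<open>Branches of a fork may accept the empty pomset, and then the surviving branch carries a
  sequential pomset that crosses the boundary of the fork. Such a branch is entered by pushing it on
  a stack of states, and left by popping once it accepts.\<close>
inductive silent :: "nat list \<Rightarrow> nat list \<Rightarrow> bool" where
  silent_init: "q < n \<Longrightarrow> silent [q] [q]"
| silent_move: "silent \<kappa> (q # \<sigma>) \<Longrightarrow> expand q q' {#} {#} \<Longrightarrow> silent \<kappa> (q' # \<sigma>)"
| silent_push: "silent \<kappa> (q # \<sigma>) \<Longrightarrow> expand q q' {#} {#s#} \<Longrightarrow> silent \<kappa> (s # q' # \<sigma>)"
| silent_pop: "silent \<kappa> (f # q # \<sigma>) \<Longrightarrow> f \<in> F \<Longrightarrow> silent \<kappa> (q # \<sigma>)"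
| silent_refl: "silent \<kappa> \<kappa>' \<Longrightarrow> silent \<kappa>' \<kappa>'"
| silent_letter: "silent \<kappa> (q # \<sigma>) \<Longrightarrow> q' \<in> \<delta> q a \<Longrightarrow> silent (q' # \<sigma>) (q' # \<sigma>)"
| silent_fork: "silent \<kappa> (q # \<sigma>) \<Longrightarrow> expand q q' {#} \<psi> \<Longrightarrow> silent (q' # \<sigma>) (q' # \<sigma>)"

text \<open>\<open>silent \<kappa> \<kappa>\<close> doubles as the statement that the stack
  \<open>\<kappa>\<close> is reachable: the rules \<open>silent_init\<close>,
  \<open>silent_refl\<close>, \<open>silent_letter\<close> and \<open>silent_fork\<close> produce
  such diagonal facts. Restricting to reachable stacks is what makes the relation finite.\<close>

lemma silent_refl': "silent \<kappa> \<kappa>' \<Longrightarrow> silent \<kappa> \<kappa>"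
proof (induction rule: silent.induct)
  case (silent_init q)
  then show ?case by (rule silent.silent_init)
next
  case (silent_letter \<kappa> q \<sigma> q' a)
  then show ?case using silent.silent_letter by metis
next
  case (silent_fork \<kappa> q \<sigma> q' \<psi>)
  then show ?case using silent.silent_fork by metis
qed (assumption | erule silent.silent_refl)+

lemma silent_trans: "silent \<kappa>' \<kappa>'' \<Longrightarrow> silent \<kappa> \<kappa>' \<Longrightarrow> silent \<kappa> \<kappa>''"
proof (induction arbitrary: \<kappa> rule: silent.induct)
  case (silent_move \<kappa>' q \<sigma> q')
  then show ?case using silent.silent_move by metis
next
  case (silent_push \<kappa>' q \<sigma> q' s)
  then show ?case using silent.silent_push by metis
next
  case (silent_pop \<kappa>' f q \<sigma>)
  then show ?case using silent.silent_pop by metis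
qed

text \<open>A normal form of runs. Fork steps read only sets that are non-empty and not connected,
  so they are never cut by a sequential composition; a connected set is read through a pushed leaf
  instead. In \<open>ipar\<close> every leaf reads one connected component.\<close>

inductive crun :: "(nat \<times> nat) set \<Rightarrow> (nat \<Rightarrow> nat) \<Rightarrow> nat list \<Rightarrow> nat set \<Rightarrow> nat list \<Rightarrow> bool"
  and ipar :: "(nat \<times> nat) set \<Rightarrow> (nat \<Rightarrow> nat) \<Rightarrow> nat set \<Rightarrow> nat multiset \<Rightarrow> bool"
  for R l where
  crun_empty: "silent \<kappa> \<kappa>' \<Longrightarrow> crun R l \<kappa> {} \<kappa>'"
| crun_letter: "silent \<kappa> (q # \<sigma>) \<Longrightarrow> q' \<in> \<delta> q (l x) \<Longrightarrow> (x, x) \<in> R \<Longrightarrow> silent (q' # \<sigma>) \<kappa>' \<Longrightarrow>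
    crun R l \<kappa> {x} \<kappa>'"
| crun_fork: "silent \<kappa> (q # \<sigma>) \<Longrightarrow> ipar R l X \<psi> \<Longrightarrow> expand q q' {#} \<psi> \<Longrightarrow> X \<noteq> {} \<Longrightarrow> \<not> conn R X \<Longrightarrow>
    silent (q' # \<sigma>) \<kappa>' \<Longrightarrow> crun R l \<kappa> X \<kappa>'"
| crun_seq: "crun R l \<kappa> X \<kappa>' \<Longrightarrow> crun R l \<kappa>' Y \<kappa>'' \<Longrightarrow> seqsep R X Y \<Longrightarrow> X \<noteq> {} \<Longrightarrow> Y \<noteq> {} \<Longrightarrow>
    crun R l \<kappa> (X \<union> Y) \<kappa>''"
| ipar_empty: "ipar R l {} {#}"
| ipar_add: "crun R l [s] X [f] \<Longrightarrow> f \<in> F \<Longrightarrow> conn R X \<Longrightarrow> parsep R X Y \<Longrightarrow> ipar R l Y \<psi> \<Longrightarrow>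
    ipar R l (X \<union> Y) (add_mset s \<psi>)"

lemma srun_emb:
  "srun R l q X q' \<Longrightarrow> emb f X R l R' l' \<longrightarrow> srun R' l' q (f ` X) q'"
  "spar R l X \<phi> \<Longrightarrow> emb f X R l R' l' \<longrightarrow> spar R' l' (f ` X) \<phi>"
proof (induction rule: srun_spar.inducts)
  case (srun_letter q' q x)
  show ?case
  proof
    assume "emb f {x} R l R' l'"
    with srun_letter have "q' \<in> \<delta> q (l' (f x))" "(f x, f x) \<in> R'" by (auto simp: emb_def)
    then show "srun R' l' q (f ` {x}) q'" using srun_spar.srun_letter by simp
  qed
next
  case (srun_seq q X m Y q')
  show ?case unfolding image_Un
  proof
    assume e: "emb f (X \<union> Y) R l R' l'"
    then have "emb f X R l R' l'" "emb f Y R l R' l'" by (auto elim: emb_mono)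
    then show "srun R' l' q (f ` X \<union> f ` Y) q'"
      using srun_seq by (intro srun_spar.srun_seq[of _ _ q _ m] emb_seqsep[OF e]) auto
  qed
next
  case (spar_add q X f' Y \<phi>)
  show ?case unfolding image_Un
  proof
    assume e: "emb f (X \<union> Y) R l R' l'"
    then have "emb f X R l R' l'" "emb f Y R l R' l'" by (auto elim: emb_mono)
    then show "spar R' l' (f ` X \<union> f ` Y) (add_mset q \<phi>)"
      using spar_add by (intro srun_spar.spar_add[of _ _ q _ f'] emb_parsep[OF e]) auto
  qed
qed (auto intro: srun_spar.intros)

lemma crun_emb:
  "crun R l \<kappa> X \<kappa>' \<Longrightarrow> emb f X R l R' l' \<longrightarrow> crun R' l' \<kappa> (f ` X) \<kappa>'"
  "ipar R l X \<phi> \<Longrightarrow> emb f X R l R' l' \<longrightarrow> ipar R' l' (f ` X) \<phi>"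
proof (induction rule: crun_ipar.inducts)
  case (crun_letter \<kappa> q \<sigma> q' x \<kappa>')
  show ?case
  proof
    assume "emb f {x} R l R' l'"
    with crun_letter have "q' \<in> \<delta> q (l' (f x))" "(f x, f x) \<in> R'" by (auto simp: emb_def)
    then show "crun R' l' \<kappa> (f ` {x}) \<kappa>'" using crun_letter crun_ipar.crun_letter by simp
  qed
next
  case (crun_fork \<kappa> q \<sigma> X \<psi> q' \<kappa>')
  show ?case
  proof
    assume e: "emb f X R l R' l'"
    have "\<not> conn R' (f ` X)"
    proof
      assume "conn R' (f ` X)"
      then have "conn R (inv_into X f ` f ` X)" using emb_conn[OF emb_inv[OF e]] by blast
      then show False using crun_fork e by (simp add: emb_def)
    qed
    then show "crun R' l' \<kappa> (f ` X) \<kappa>'" using crun_fork e by (blast intro: crun_ipar.crun_fork)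
  qed
next
  case (crun_seq \<kappa> X \<kappa>' Y \<kappa>'')
  show ?case unfolding image_Un
  proof
    assume e: "emb f (X \<union> Y) R l R' l'"
    then have "emb f X R l R' l'" "emb f Y R l R' l'" by (auto elim: emb_mono)
    then show "crun R' l' \<kappa> (f ` X \<union> f ` Y) \<kappa>''"
      using crun_seq by (intro crun_ipar.crun_seq[of _ _ \<kappa> _ \<kappa>'] emb_seqsep[OF e]) auto
  qed
next
  case (ipar_add s X f' Y \<psi>)
  show ?case unfolding image_Un
  proof
    assume e: "emb f (X \<union> Y) R l R' l'"
    then have e': "emb f X R l R' l'" "emb f Y R l R' l'" by (auto elim: emb_mono)
    then show "ipar R' l' (f ` X \<union> f ` Y) (add_mset s \<psi>)"
      using ipar_add by (intro crun_ipar.ipar_add[of _ _ s _ f'] emb_parsep[OF e]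
        emb_conn[OF e'(1)]) auto
  qed
qed (auto intro: crun_ipar.intros)

section \<open>Soundness of unfoldings and of stack runs\<close>

lemma spar_split:
  "spar R l Z \<phi> \<Longrightarrow> \<phi> = \<phi>1 + \<phi>2 \<Longrightarrow>
    \<exists>Z1 Z2. Z = Z1 \<union> Z2 \<and> parsep R Z1 Z2 \<and> spar R l Z1 \<phi>1 \<and> spar R l Z2 \<phi>2"
proof (induction arbitrary: \<phi>1 \<phi>2 rule: srun_spar.inducts(2)[where ?P1.0="\<lambda>_ _ _. True"])
  case (spar_add q X f Y \<phi>)
  have "q \<in># \<phi>1 \<or> q \<in># \<phi>2" using spar_add.prems by (metis union_iff union_single_eq_member)
  then show ?case
  proof
    assume "q \<in># \<phi>1"
    then obtain \<phi>1' where \<phi>1: "\<phi>1 = add_mset q \<phi>1'" by (blast dest: multi_member_split)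
    with spar_add.prems have "\<phi> = \<phi>1' + \<phi>2" by simp
    from spar_add.IH[OF this] obtain Z1 Z2 where Z: "Y = Z1 \<union> Z2" "parsep R Z1 Z2"
      "spar R l Z1 \<phi>1'" "spar R l Z2 \<phi>2" by blast
    have "spar R l (X \<union> Z1) \<phi>1" unfolding \<phi>1
      using spar_add Z by (auto intro: srun_spar.spar_add)
    then show ?thesis using Z spar_add
      by (intro exI[of _ "X \<union> Z1"] exI[of _ Z2]) auto
  next
    assume "q \<in># \<phi>2"
    then obtain \<phi>2' where \<phi>2: "\<phi>2 = add_mset q \<phi>2'" by (blast dest: multi_member_split)
    with spar_add.prems have "\<phi> = \<phi>1 + \<phi>2'" by simp
    from spar_add.IH[OF this] obtain Z1 Z2 where Z: "Y = Z1 \<union> Z2" "parsep R Z1 Z2"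
      "spar R l Z1 \<phi>1" "spar R l Z2 \<phi>2'" by blast
    have "spar R l (X \<union> Z2) \<phi>2" unfolding \<phi>2
      using spar_add Z by (auto intro: srun_spar.spar_add)
    then show ?thesis using Z spar_add
      by (intro exI[of _ Z1] exI[of _ "X \<union> Z2"]) (auto simp: parsep_commute)
  qed
qed (auto intro: srun_spar.intros)

lemma spar_emptyD: "spar R l Z {#} \<Longrightarrow> Z = {}"
  by (erule spar.cases) auto

lemma spar_single: "f \<in> F \<Longrightarrow> srun R l s X f \<Longrightarrow> spar R l X {#s#}"
  using spar_add[OF _ _ parsep_empty(2) spar_empty] by fastforce

text \<open>Pending states and leaves are treated alike, as branches still to be read. In the case
  of \<open>expand_comp\<close> one of the two runs reads the empty set, so no order between the two
  parts is required.\<close>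

lemma expand_sound: "expand q q' \<chi> \<psi> \<Longrightarrow> spar R l Z (\<chi> + \<psi>) \<Longrightarrow> srun R l q Z q'"
proof (induction arbitrary: Z rule: expand.induct)
  case (expand_refl q)
  then show ?case using spar_emptyD srun_empty by fastforce
next
  case (expand_fork q' q \<phi>)
  then show ?case by (auto intro: srun_fork)
next
  case (expand_leaf q q' r \<chi> \<psi>)
  then show ?case by simp
next
  case (expand_sub q q' r \<chi> \<psi> f \<psi>')
  from expand_sub.prems have "spar R l Z (\<psi>' + (\<chi> + \<psi>))" by (simp add: ac_simps)
  from spar_split[OF this refl] obtain Z1 Z2 where Z: "Z = Z1 \<union> Z2" "parsep R Z1 Z2"
    "spar R l Z1 \<psi>'" "spar R l Z2 (\<chi> + \<psi>)" by blast
  have "srun R l r Z1 f" using expand_sub.IH(2) Z by simp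
  then have "spar R l Z (add_mset r (\<chi> + \<psi>))" unfolding Z(1)
    using Z expand_sub.hyps by (blast intro: srun_spar.spar_add)
  then show ?case using expand_sub.IH(1) by simp
next
  case (expand_comp q m \<psi> q' \<psi>')
  show ?case
  proof (cases "\<psi> = {#}")
    case True
    then have "srun R l q {} m" using expand_comp.IH(1) spar_empty by simp
    moreover have "srun R l m Z q'" using expand_comp True by simp
    ultimately show ?thesis using srun_seq[of R l q "{}" m Z q'] by simp
  next
    case False
    then have "\<psi>' = {#}" using expand_comp by simp
    then have "srun R l m {} q'" "srun R l q Z m" using expand_comp spar_empty by simp_all
    then show ?thesis using srun_seq[of R l q Z m "{}" q'] by simp
  qed
qed

text \<open>The stack semantics: all states but the last one must accept the part that they read.\<close>
fun brun :: "(nat \<times> nat) set \<Rightarrow> (nat \<Rightarrow> nat) \<Rightarrow> nat list \<Rightarrow> nat set \<Rightarrow> nat \<Rightarrow> bool" where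
  "brun R l [] X t \<longleftrightarrow> False"
| "brun R l [q] X t \<longleftrightarrow> srun R l q X t"
| "brun R l (q # p # \<sigma>) X t \<longleftrightarrow> (\<exists>X1 X2 f. X = X1 \<union> X2 \<and> seqsep R X1 X2 \<and> f \<in> F \<and>
     srun R l q X1 f \<and> brun R l (p # \<sigma>) X2 t)"

lemma brun_head:
  assumes "srun R l q X q'" "seqsep R X Z" "brun R l (q' # \<sigma>) Z t"
  shows "brun R l (q # \<sigma>) (X \<union> Z) t"
proof (cases \<sigma>)
  case Nil
  then show ?thesis using assms by (auto intro: srun_seq)
next
  case (Cons p \<sigma>')
  then obtain X1 X2 f where Z: "Z = X1 \<union> X2" "seqsep R X1 X2" "f \<in> F"
     "srun R l q' X1 f" "brun R l (p # \<sigma>') X2 t" using assms(3) by auto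
  then have "srun R l q (X \<union> X1) f" using assms by (auto intro: srun_seq)
  then show ?thesis unfolding Cons brun.simps using Z assms(2)
    by (intro exI[of _ "X \<union> X1"] exI[of _ X2] exI[of _ f]) auto
qed

lemma silent_sound: "silent \<kappa> \<kappa>' \<Longrightarrow> brun R l \<kappa>' Z t \<Longrightarrow> brun R l \<kappa> Z t"
proof (induction arbitrary: Z rule: silent.induct)
  case (silent_move \<kappa> q \<sigma> q')
  have "srun R l q {} q'" using expand_sound[OF silent_move.hyps(2)] spar_empty by simp
  from brun_head[OF this _ silent_move.prems] have "brun R l (q # \<sigma>) Z t" by simp
  then show ?case by (rule silent_move.IH)
next
  case (silent_push \<kappa> q \<sigma> q' s)
  from silent_push.prems obtain X1 X2 f where Z: "Z = X1 \<union> X2" "seqsep R X1 X2" "f \<in> F"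
     "srun R l s X1 f" "brun R l (q' # \<sigma>) X2 t" by auto
  \<comment> \<open>With \<open>s\<close> as its only leaf, the unfolded fork from \<open>q\<close>
    to \<open>q'\<close> reads whatever \<open>s\<close> accepts.\<close>
  then have "srun R l q X1 q'" using expand_sound[OF silent_push.hyps(2)] spar_single by simp
  from brun_head[OF this Z(2,5)] Z(1) have "brun R l (q # \<sigma>) Z t" by simp
  then show ?case by (rule silent_push.IH)
next
  case (silent_pop \<kappa> f q \<sigma>)
  have "brun R l (f # q # \<sigma>) Z t" unfolding brun.simps
    using silent_pop.prems silent_pop.hyps srun_empty[of R l f]
    by (intro exI[of _ "{}"] exI[of _ Z] exI[of _ f]) simp
  then show ?case by (rule silent_pop.IH)
qed assumption+

text \<open>A stack run may stop inside a branch, where it does not yet correspond to a run of the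
  automaton. It is therefore interpreted through its continuations: the part \<open>X\<close> is
  prefixed to any \<open>Z\<close> that the final stack can still read.\<close>

lemma crun_sound:
  "crun R l \<kappa> X \<kappa>' \<Longrightarrow> \<forall>Z t. seqsep R X Z \<longrightarrow> brun R l \<kappa>' Z t \<longrightarrow> brun R l \<kappa> (X \<union> Z) t"
  "ipar R l X \<psi> \<Longrightarrow> spar R l X \<psi>"
proof (induction rule: crun_ipar.inducts)
  case (crun_empty \<kappa> \<kappa>')
  then show ?case by (auto intro: silent_sound[OF crun_empty])
next
  case (crun_letter \<kappa> q \<sigma> q' x \<kappa>')
  show ?case
  proof (intro allI impI)
    fix Z t assume *: "seqsep R {x} Z" "brun R l \<kappa>' Z t"
    have "brun R l (q' # \<sigma>) Z t" by (rule silent_sound[OF \<open>silent (q' # \<sigma>) \<kappa>'\<close> *(2)])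
    then have "brun R l (q # \<sigma>) ({x} \<union> Z) t"
      by (rule brun_head[OF srun_letter[of q' q l x, OF crun_letter(2,3)] *(1)])
    then show "brun R l \<kappa> ({x} \<union> Z) t" by (rule silent_sound[OF crun_letter(1)])
  qed
next
  case (crun_fork \<kappa> q \<sigma> X \<psi> q' \<kappa>')
  show ?case
  proof (intro allI impI)
    fix Z t assume *: "seqsep R X Z" "brun R l \<kappa>' Z t"
    have 1: "brun R l (q' # \<sigma>) Z t" by (rule silent_sound[OF \<open>silent (q' # \<sigma>) \<kappa>'\<close> *(2)])
    have "srun R l q X q'" using expand_sound[OF \<open>expand q q' {#} \<psi>\<close>] \<open>spar R l X \<psi>\<close> by simp
    then have "brun R l (q # \<sigma>) (X \<union> Z) t" by (rule brun_head[OF _ *(1) 1])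
    then show "brun R l \<kappa> (X \<union> Z) t" by (rule silent_sound[OF \<open>silent \<kappa> (q # \<sigma>)\<close>])
  qed
next
  case (crun_seq \<kappa> X \<kappa>' Y \<kappa>'')
  show ?case
  proof (intro allI impI)
    fix Z t assume *: "seqsep R (X \<union> Y) Z" "brun R l \<kappa>'' Z t"
    then have "brun R l \<kappa>' (Y \<union> Z) t" using crun_seq.IH(4) by simp
    moreover have "seqsep R X (Y \<union> Z)" using * \<open>seqsep R X Y\<close> by simp
    ultimately have "brun R l \<kappa> (X \<union> (Y \<union> Z)) t" using crun_seq.IH(2) by blast
    then show "brun R l \<kappa> (X \<union> Y \<union> Z) t" by (simp only: Un_assoc)
  qed
next
  case ipar_empty
  show ?case by (rule spar_empty)
next
  case (ipar_add s X f Y \<psi>)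
  have "srun R l s X f"
  proof -
    from ipar_add.IH(2) have "seqsep R X {} \<longrightarrow> brun R l [f] {} f \<longrightarrow> brun R l [s] (X \<union> {}) f" by blast
    then show ?thesis by (simp add: srun_empty)
  qed
  then show ?case by (rule srun_spar.spar_add) (use ipar_add in auto)
qed

section \<open>Composing and cutting stack runs\<close>

lemma crun_silent_right: "crun R l \<kappa> X \<kappa>' \<Longrightarrow> silent \<kappa>' \<kappa>'' \<Longrightarrow> crun R l \<kappa> X \<kappa>''"
proof (induction arbitrary: \<kappa>'' rule: crun_ipar.inducts(1)[where ?P2.0="\<lambda>_ _. True"])
  case (crun_empty \<kappa> \<kappa>')
  show ?case by (rule crun_ipar.crun_empty[OF silent_trans[OF crun_empty(2,1)]])
next
  case (crun_letter \<kappa> q \<sigma> q' x \<kappa>')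
  show ?case by (rule crun_ipar.crun_letter[OF _ _ _ silent_trans[OF crun_letter.prems \<open>silent (q' # \<sigma>) \<kappa>'\<close>]]) (use crun_letter in auto)
next
  case (crun_fork \<kappa> q \<sigma> X \<psi> q' \<kappa>')
  show ?case by (rule crun_ipar.crun_fork[OF _ _ _ _ _ silent_trans[OF crun_fork.prems \<open>silent (q' # \<sigma>) \<kappa>'\<close>]]) (use crun_fork in auto)
next
  case (crun_seq \<kappa> X \<kappa>' Y \<kappa>1)
  show ?case by (rule crun_ipar.crun_seq[OF \<open>crun R l \<kappa> X \<kappa>'\<close>]) (use crun_seq in auto)
qed auto

lemma crun_silent_left: "crun R l \<kappa> X \<kappa>' \<Longrightarrow> silent \<kappa>0 \<kappa> \<Longrightarrow> crun R l \<kappa>0 X \<kappa>'"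
proof (induction arbitrary: \<kappa>0 rule: crun_ipar.inducts(1)[where ?P2.0="\<lambda>_ _. True"])
  case (crun_empty \<kappa> \<kappa>')
  show ?case by (rule crun_ipar.crun_empty[OF silent_trans[OF crun_empty]])
next
  case (crun_letter \<kappa> q \<sigma> q' x \<kappa>')
  show ?case by (rule crun_ipar.crun_letter[OF silent_trans[OF crun_letter.hyps(1) crun_letter.prems]]) (use crun_letter in auto)
next
  case (crun_fork \<kappa> q \<sigma> X \<psi> q' \<kappa>')
  show ?case by (rule crun_ipar.crun_fork[OF silent_trans[OF crun_fork.hyps(1) crun_fork.prems]])
    (use crun_fork in auto)
next
  case (crun_seq \<kappa> X \<kappa>' Y \<kappa>1)
  show ?case by (rule crun_ipar.crun_seq[OF _ \<open>crun R l \<kappa>' Y \<kappa>1\<close>]) (use crun_seq in auto)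
qed auto

lemma crun_refl: "crun R l \<kappa> X \<kappa>' \<Longrightarrow> silent \<kappa> \<kappa> \<and> silent \<kappa>' \<kappa>'"
  by (induction rule: crun_ipar.inducts(1)[where ?P2.0="\<lambda>_ _. True"])
    (meson TrueI silent_refl silent_refl')+

lemma crun_emptyD: "crun R l \<kappa> {} \<kappa>' \<Longrightarrow> silent \<kappa> \<kappa>'"
  by (erule crun.cases) auto

lemma crun_comp:
  assumes "crun R l \<kappa> X \<kappa>'" "crun R l \<kappa>' Y \<kappa>''" "seqsep R X Y"
  shows "crun R l \<kappa> (X \<union> Y) \<kappa>''"
proof (cases "X = {} \<or> Y = {}")
  case True
  then show ?thesis
  proof
    assume "X = {}"
    then show ?thesis using assms crun_silent_left[OF assms(2)] crun_emptyD by simp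
  next
    assume "Y = {}"
    then show ?thesis using assms crun_silent_right[OF assms(1)] crun_emptyD by simp
  qed
next
  case False
  then show ?thesis using crun_seq[OF assms] by simp
qed

text \<open>All moves act on the top of the stack, so further states can be placed underneath.
  Reachability of the extended initial stack is an assumption because the diagonal rules do not
  supply it.\<close>

lemma silent_lift: "silent \<kappa> \<kappa>' \<Longrightarrow> silent (\<kappa> @ \<sigma>) (\<kappa> @ \<sigma>) \<Longrightarrow> silent (\<kappa> @ \<sigma>) (\<kappa>' @ \<sigma>)"
proof (induction rule: silent.induct)
  case (silent_move \<kappa> q \<sigma>' q')
  then show ?case using silent.silent_move[of "\<kappa> @ \<sigma>" q "\<sigma>' @ \<sigma>"] by simp
next
  case (silent_push \<kappa> q \<sigma>' q' s)
  then show ?case using silent.silent_push[of "\<kappa> @ \<sigma>" q "\<sigma>' @ \<sigma>"] by simp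
next
  case (silent_pop \<kappa> f q \<sigma>')
  then show ?case using silent.silent_pop[of "\<kappa> @ \<sigma>" f q "\<sigma>' @ \<sigma>"] by simp
qed

lemma crun_lift: "crun R l \<kappa> X \<kappa>' \<Longrightarrow> silent (\<kappa> @ \<sigma>) (\<kappa> @ \<sigma>) \<Longrightarrow> crun R l (\<kappa> @ \<sigma>) X (\<kappa>' @ \<sigma>)"
proof (induction rule: crun_ipar.inducts(1)[where ?P2.0="\<lambda>_ _. True"])
  case (crun_empty \<kappa> \<kappa>')
  show ?case by (rule crun_ipar.crun_empty[OF silent_lift[OF crun_empty]])
next
  case (crun_letter \<kappa> q \<sigma>' q' x \<kappa>')
  have 1: "silent (\<kappa> @ \<sigma>) (q # \<sigma>' @ \<sigma>)" using silent_lift[OF crun_letter(1,5)] by simp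
  have 2: "silent (q' # \<sigma>' @ \<sigma>) (\<kappa>' @ \<sigma>)"
    using silent_lift[OF crun_letter(4)] silent_letter[OF 1 crun_letter(2)] by simp
  show ?case by (rule crun_ipar.crun_letter[of _ q _ q' l x, OF 1 crun_letter.hyps(2,3) 2])
next
  case (crun_fork \<kappa> q \<sigma>' X \<psi> q' \<kappa>')
  have 1: "silent (\<kappa> @ \<sigma>) (q # \<sigma>' @ \<sigma>)" using silent_lift[OF crun_fork.hyps(1) crun_fork.prems]
    by simp
  have 2: "silent (q' # \<sigma>' @ \<sigma>) (\<kappa>' @ \<sigma>)"
    using silent_lift[OF \<open>silent (q' # \<sigma>') \<kappa>'\<close>] silent_fork[OF 1] crun_fork.hyps by simp
  show ?case
    by (rule crun_ipar.crun_fork[OF 1 \<open>ipar R l X \<psi>\<close> \<open>expand q q' {#} \<psi>\<close> \<open>X \<noteq> {}\<close> \<open>\<not> conn R X\<close> 2])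
next
  case (crun_seq \<kappa> X \<kappa>' Y \<kappa>'')
  then have 1: "crun R l (\<kappa> @ \<sigma>) X (\<kappa>' @ \<sigma>)" by simp
  with crun_seq have 2: "crun R l (\<kappa>' @ \<sigma>) Y (\<kappa>'' @ \<sigma>)" using crun_refl[OF 1] by blast
  show ?case by (rule crun_ipar.crun_seq[OF 1 2]) (use crun_seq in auto)
qed (rule TrueI)+

lemma ipar_emptyD: "ipar R l X {#} \<Longrightarrow> X = {}"
  by (erule ipar.cases) auto

lemma ipar_empty_mset: "ipar R l X \<psi> \<Longrightarrow> X = {} \<Longrightarrow> \<psi> = {#}"
  by (erule ipar.cases) (auto dest: conn_nonempty)

lemma ipar_single: "f \<in> F \<Longrightarrow> crun R l [s] X [f] \<Longrightarrow> conn R X \<Longrightarrow> ipar R l X {#s#}"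
  using ipar_add[OF _ _ _ parsep_empty(2) ipar_empty] by fastforce

lemma ipar_union: "ipar R l X \<psi> \<Longrightarrow> ipar R l Y \<psi>' \<Longrightarrow> parsep R X Y \<Longrightarrow> ipar R l (X \<union> Y) (\<psi> + \<psi>')"
proof (induction rule: crun_ipar.inducts(2)[where ?P1.0="\<lambda>_ _ _. True"])
  case (ipar_add s X f Z \<psi>)
  then have "ipar R l (Z \<union> Y) (\<psi> + \<psi>')" "parsep R X (Z \<union> Y)" by auto
  then show ?case using crun_ipar.ipar_add ipar_add.hyps by (simp add: Un_assoc)
qed auto

text \<open>Each leaf reads a connected set, which cannot be shared between \<open>X\<close> and
  \<open>Y\<close> and therefore belongs entirely to one of them. This is the uniqueness of the
  decomposition into components.\<close>

lemma ipar_split: "ipar R l Z \<psi> \<Longrightarrow> Z = X \<union> Y \<Longrightarrow> parsep R X Y \<Longrightarrow>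
    \<exists>\<psi>1 \<psi>2. \<psi> = \<psi>1 + \<psi>2 \<and> ipar R l X \<psi>1 \<and> ipar R l Y \<psi>2"
proof (induction arbitrary: X Y rule: crun_ipar.inducts(2)[where ?P1.0="\<lambda>_ _ _. True"])
  case ipar_empty
  then show ?case by (auto intro: crun_ipar.ipar_empty)
next
  case (ipar_add s A f Z \<psi>)
  from \<open>conn R A\<close> have "A \<subseteq> X \<or> A \<subseteq> Y"
    by (rule conn_in_par[OF _ _ ipar_add.prems(2)]) (use ipar_add.prems in blast)
  moreover have disj: "A \<inter> Z = {}" using ipar_add.hyps by (auto simp: parsep_def)
  ultimately show ?case
  proof (elim disjE)
    assume A: "A \<subseteq> X"
    have "Z = (X - A) \<union> Y" using ipar_add.prems A disj by (auto simp: parsep_def)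
    moreover have "parsep R (X - A) Y" using ipar_add.prems by (blast intro: parsep_mono)
    ultimately obtain \<psi>1 \<psi>2 where \<psi>: "\<psi> = \<psi>1 + \<psi>2" "ipar R l (X - A) \<psi>1" "ipar R l Y \<psi>2"
      using ipar_add.IH by blast
    have "parsep R A (X - A)" using \<open>parsep R A Z\<close> \<open>Z = (X - A) \<union> Y\<close> by simp
    then have "ipar R l (A \<union> (X - A)) (add_mset s \<psi>1)"
      by (rule crun_ipar.ipar_add[OF \<open>crun R l [s] A [f]\<close> \<open>f \<in> F\<close> \<open>conn R A\<close> _ \<psi>(2)])
    then show ?thesis using \<psi> A by (intro exI[of _ "add_mset s \<psi>1"] exI[of _ \<psi>2])
      (simp add: Un_absorb1)
  next
    assume A: "A \<subseteq> Y"
    have "Z = X \<union> (Y - A)" using ipar_add.prems A disj by (auto simp: parsep_def)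
    moreover have "parsep R X (Y - A)" using ipar_add.prems by (blast intro: parsep_mono)
    ultimately obtain \<psi>1 \<psi>2 where \<psi>: "\<psi> = \<psi>1 + \<psi>2" "ipar R l X \<psi>1" "ipar R l (Y - A) \<psi>2"
      using ipar_add.IH by blast
    have "parsep R A (Y - A)" using \<open>parsep R A Z\<close> \<open>Z = X \<union> (Y - A)\<close> by simp
    then have "ipar R l (A \<union> (Y - A)) (add_mset s \<psi>2)"
      by (rule crun_ipar.ipar_add[OF \<open>crun R l [s] A [f]\<close> \<open>f \<in> F\<close> \<open>conn R A\<close> _ \<psi>(3)])
    then show ?thesis using \<psi> A by (intro exI[of _ \<psi>1] exI[of _ "add_mset s \<psi>2"])
      (simp add: Un_absorb1)
  qed
qed (rule TrueI)+

text \<open>The first leaf reads a non-empty part, so connectedness leaves the empty set for the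
  others, and only the empty multiset of leaves reads that.\<close>

lemma ipar_conn: "conn R X \<Longrightarrow> ipar R l X \<psi> \<longleftrightarrow> (\<exists>s f. \<psi> = {#s#} \<and> f \<in> F \<and> crun R l [s] X [f])"
proof
  assume c: "conn R X" and "ipar R l X \<psi>"
  from this(2) show "\<exists>s f. \<psi> = {#s#} \<and> f \<in> F \<and> crun R l [s] X [f]"
  proof (cases rule: ipar.cases)
    case ipar_empty
    then show ?thesis using c conn_nonempty by blast
  next
    case (ipar_add s A f B \<psi>')
    then have "B = {}" using connD[OF c, of A B] conn_nonempty[of R A] by simp
    then show ?thesis using ipar_add ipar_empty_mset by auto
  qed
qed (auto intro: ipar_single)

lemma crun_split_trivial:
  assumes "crun R l \<kappa> Z \<kappa>'" "X = {} \<and> Y = Z \<or> X = Z \<and> Y = {}"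
  shows "\<exists>\<kappa>1. crun R l \<kappa> X \<kappa>1 \<and> crun R l \<kappa>1 Y \<kappa>'"
proof -
  have "crun R l \<kappa> {} \<kappa>" "crun R l \<kappa>' {} \<kappa>'"
    using crun_refl[OF assms(1)] by (simp_all add: crun_empty)
  then show ?thesis using assms by auto
qed

text \<open>The sets read by a letter or by a fork step have trivial cuts only. At a sequential
  composition, Levi's lemma decides in which of the two runs the cut falls.\<close>

lemma crun_split:
  "crun R l \<kappa> Z \<kappa>' \<Longrightarrow> Z = X \<union> Y \<Longrightarrow> seqsep R X Y \<Longrightarrow>
    \<exists>\<kappa>1. crun R l \<kappa> X \<kappa>1 \<and> crun R l \<kappa>1 Y \<kappa>'"
proof (induction arbitrary: X Y rule: crun_ipar.inducts(1)[where ?P2.0="\<lambda>_ _. True"])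
  case (crun_empty \<kappa> \<kappa>')
  then show ?case by (auto intro: crun_ipar.crun_empty silent_refl)
next
  case (crun_letter \<kappa> q \<sigma> q' x \<kappa>')
  have run: "crun R l \<kappa> {x} \<kappa>'" by (rule crun_ipar.crun_letter[of _ q _ q' l x,
    OF crun_letter.hyps])
  have "X \<subseteq> {x}" "Y \<subseteq> {x}" using crun_letter.prems(1) by simp_all
  then have "(X = {} \<or> X = {x}) \<and> (Y = {} \<or> Y = {x})" by (simp add: subset_singleton_iff)
  then have "X = {} \<and> Y = {x} \<or> X = {x} \<and> Y = {}"
    using crun_letter.prems by (auto simp: seqsep_def)
  then show ?case by (rule crun_split_trivial[OF run])
next
  case (crun_fork \<kappa> q \<sigma> Z \<psi> q' \<kappa>')
  have run: "crun R l \<kappa> Z \<kappa>'"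
    by (rule crun_ipar.crun_fork[OF \<open>silent \<kappa> (q # \<sigma>)\<close> \<open>ipar R l Z \<psi>\<close> \<open>expand q q' {#} \<psi>\<close>])
      (use crun_fork.hyps in auto)
  have "X = {} \<or> Y = {}" using conn_seq[OF crun_fork.prems(2)] crun_fork.prems(1) \<open>\<not> conn R Z\<close>
    by blast
  then have "X = {} \<and> Y = Z \<or> X = Z \<and> Y = {}" using crun_fork.prems(1) by auto
  then show ?case by (rule crun_split_trivial[OF run])
next
  case (crun_seq \<kappa> A \<kappa>' B \<kappa>'')
  from levi[OF crun_seq.prems(1) \<open>seqsep R A B\<close> crun_seq.prems(2)] show ?case
  proof
    assume AX: "A \<subseteq> X"
    have "A \<inter> B = {}" "X \<inter> Y = {}"
      using \<open>seqsep R A B\<close> \<open>seqsep R X Y\<close> unfolding seqsep_def by blast+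
    then have B: "B = (X - A) \<union> Y" using AX crun_seq.prems by blast
    have "seqsep R (X - A) Y" using crun_seq.prems by (blast intro: seqsep_mono)
    from crun_seq.IH(2)[OF B this] obtain \<kappa>1 where
      k: "crun R l \<kappa>' (X - A) \<kappa>1" "crun R l \<kappa>1 Y \<kappa>''" by blast
    have "seqsep R A (X - A)" using \<open>seqsep R A B\<close> B by simp
    from crun_comp[OF \<open>crun R l \<kappa> A \<kappa>'\<close> k(1) this] have "crun R l \<kappa> X \<kappa>1"
      using AX by (simp add: Un_absorb1)
    then show ?thesis using k by blast
  next
    assume XA: "X \<subseteq> A"
    have "A \<inter> B = {}" "X \<inter> Y = {}"
      using \<open>seqsep R A B\<close> \<open>seqsep R X Y\<close> unfolding seqsep_def by blast+
    then have Y: "Y = (A - X) \<union> B" and A: "A = X \<union> (A - X)" using XA crun_seq.prems by blast+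
    have "seqsep R X (A - X)" using crun_seq.prems(2) Y by simp
    from crun_seq.IH(1)[OF A this] obtain \<kappa>1 where
      k: "crun R l \<kappa> X \<kappa>1" "crun R l \<kappa>1 (A - X) \<kappa>'" by blast
    have "seqsep R (A - X) B" using \<open>seqsep R A B\<close> by (blast intro: seqsep_mono)
    from crun_comp[OF k(2) \<open>crun R l \<kappa>' B \<kappa>''\<close> this] have "crun R l \<kappa>1 Y \<kappa>''" using Y by simp
    then show ?thesis using k by blast
  qed
qed (rule TrueI)+

text \<open>Every run becomes a stack run, and a run over a set that is not connected also becomes a
  single unfolding. The claim for \<open>spar\<close> works inside an arbitrary partial unfolding
  whose pending states contain the branches: a branch reading a connected set is turned into a leaf
  by \<open>expand_leaf\<close>, any other branch is replaced by its own leaves by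
  \<open>expand_sub\<close>.\<close>

lemma srun_complete:
  "srun R l q X q' \<Longrightarrow> q < n \<longrightarrow> (q' < n \<and> (\<forall>\<sigma>. silent (q # \<sigma>) (q # \<sigma>) \<longrightarrow> crun R l (q # \<sigma>) X (q' # \<sigma>))
     \<and> (\<not> conn R X \<longrightarrow> (\<exists>\<psi>. expand q q' {#} \<psi> \<and> ipar R l X \<psi>)))"
  "spar R l X \<phi> \<Longrightarrow> set_mset \<phi> \<subseteq> {..<n} \<longrightarrow> (\<forall>q q' \<chi> \<psi>0. expand q q' (\<phi> + \<chi>) \<psi>0 \<longrightarrow>
     (\<exists>\<psi>. expand q q' \<chi> (\<psi> + \<psi>0) \<and> ipar R l X \<psi>))"
proof (induction rule: srun_spar.inducts)
  case (srun_empty q)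
  then show ?case by (auto intro: crun_empty expand_refl ipar_empty)
next
  case (srun_letter q' q x)
  then show ?case using \<delta>_n by (auto intro: crun_letter silent_letter)
next
  case (srun_seq q X m Y q')
  show ?case
  proof (intro impI conjI allI)
    assume q: "q < n"
    with srun_seq have m: "m < n" by blast
    with srun_seq show "q' < n" by blast
    show "crun R l (q # \<sigma>) (X \<union> Y) (q' # \<sigma>)" if "silent (q # \<sigma>) (q # \<sigma>)" for \<sigma>
    proof -
      have 1: "crun R l (q # \<sigma>) X (m # \<sigma>)" using srun_seq.IH(2) q that by blast
      have 2: "crun R l (m # \<sigma>) Y (q' # \<sigma>)" using srun_seq.IH(4) m crun_refl[OF 1] by blast
      show ?thesis by (rule crun_comp[OF 1 2 \<open>seqsep R X Y\<close>])
    qed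
    assume nc: "\<not> conn R (X \<union> Y)"
    \<comment> \<open>One factor is empty, which is the situation that \<open>expand_comp\<close> is
      made for.\<close>
    then have XY: "X = {} \<or> Y = {}" using conn_seq \<open>seqsep R X Y\<close> by blast
    then have "\<not> conn R X" "\<not> conn R Y" using nc conn_nonempty by auto
    with srun_seq.IH q m obtain \<psi>1 \<psi>2 where \<psi>: "expand q m {#} \<psi>1" "ipar R l X \<psi>1"
      "expand m q' {#} \<psi>2" "ipar R l Y \<psi>2" by blast
    then have "\<psi>1 = {#} \<or> \<psi>2 = {#}" using XY ipar_empty_mset by blast
    with \<psi> have "expand q q' {#} (\<psi>1 + \<psi>2)" by (blast intro: expand_comp)
    moreover have "ipar R l (X \<union> Y) (\<psi>1 + \<psi>2)"
      using \<psi> XY by (auto intro: ipar_union)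
    ultimately show "\<exists>\<psi>. expand q q' {#} \<psi> \<and> ipar R l (X \<union> Y) \<psi>" by blast
  qed
next
  case (srun_fork X \<phi> q' q)
  have "expand q q' (\<phi> + {#}) {#}" using srun_fork by (simp add: expand_fork)
  with srun_fork \<gamma>_n[OF \<open>q' \<in> \<gamma> q \<phi>\<close>] obtain \<psi> where \<psi>: "expand q q' {#} \<psi>" "ipar R l X \<psi>"
    by fastforce
  have "crun R l (q # \<sigma>) X (q' # \<sigma>)" if s: "silent (q # \<sigma>) (q # \<sigma>)" for \<sigma>
  proof (cases "conn R X")
    case True
    \<comment> \<open>A connected set leaves a single leaf \<open>u\<close>. It is pushed, run on
      top of the remaining stack, and popped once it accepts.\<close>
    with \<psi> obtain u f where u: "\<psi> = {#u#}" "f \<in> F" "crun R l [u] X [f]" using ipar_conn by blast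
    have push: "silent (q # \<sigma>) (u # q' # \<sigma>)" using silent_push[OF s] \<psi> u by simp
    then have "silent (u # q' # \<sigma>) (u # q' # \<sigma>)" by (rule silent_refl)
    with crun_lift[OF u(3), of "q' # \<sigma>"] have run: "crun R l (u # q' # \<sigma>) X (f # q' # \<sigma>)" by simp
    have "silent (f # q' # \<sigma>) (f # q' # \<sigma>)" using crun_refl[OF run] by blast
    then have pop: "silent (f # q' # \<sigma>) (q' # \<sigma>)" using u(2) by (rule silent_pop)
    show ?thesis by (rule crun_silent_right[OF crun_silent_left[OF run push] pop])
  next
    case False
    show ?thesis
    proof (cases "X = {}")
      case True
      then have "\<psi> = {#}" using \<psi> ipar_empty_mset by blast
      then have "silent (q # \<sigma>) (q' # \<sigma>)" using silent_move[OF s] \<psi> by simp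
      then show ?thesis using True by (simp add: crun_empty)
    next
      case nonempty: False
      show ?thesis
        using crun_fork[OF s \<psi>(2,1) nonempty False silent_fork[OF s \<psi>(1)]] .
    qed
  qed
  then show ?case using \<psi> \<gamma>_n[OF \<open>q' \<in> \<gamma> q \<phi>\<close>] by blast
next
  case spar_empty
  show ?case
  proof (intro impI allI)
    fix q q' \<chi> \<psi>0 assume "expand q q' ({#} + \<chi>) \<psi>0"
    then show "\<exists>\<psi>. expand q q' \<chi> (\<psi> + \<psi>0) \<and> ipar R l {} \<psi>"
      by (intro exI[of _ "{#}"]) (simp add: ipar_empty)
  qed
next
  case (spar_add q X f Y \<phi>)
  show ?case
  proof (intro impI allI)
    fix p p' \<chi> \<psi>0
    assume sub: "set_mset (add_mset q \<phi>) \<subseteq> {..<n}" and ex: "expand p p' (add_mset q \<phi> + \<chi>) \<psi>0"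
    then have ex: "expand p p' (add_mset q (\<phi> + \<chi>)) \<psi>0" and q: "q < n" by simp_all
    from sub have "set_mset \<phi> \<subseteq> {..<n}" by simp
    with spar_add have P2: "\<exists>\<psi>. expand p p' \<chi> (\<psi> + \<psi>0) \<and> ipar R l Y \<psi>"
      if "expand p p' (\<phi> + \<chi>) \<psi>0" for p p' \<chi> \<psi>0 using that by blast
    show "\<exists>\<psi>. expand p p' \<chi> (\<psi> + \<psi>0) \<and> ipar R l (X \<union> Y) \<psi>"
    proof (cases "conn R X")
      case True
      have "crun R l [q] X [f]" using spar_add.IH(2) q silent_init by blast
      moreover from expand_leaf[OF ex] obtain \<psi> where
        "expand p p' \<chi> (\<psi> + add_mset q \<psi>0)" "ipar R l Y \<psi>" using P2 by blast
      ultimately show ?thesis using spar_add True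
        by (intro exI[of _ "add_mset q \<psi>"]) (auto intro: ipar_add)
    next
      case False
      \<comment> \<open>This covers the empty set as well: then \<open>\<psi>1\<close> is empty and
        the branch is erased.\<close>
      then obtain \<psi>1 where \<psi>1: "expand q f {#} \<psi>1" "ipar R l X \<psi>1"
        using spar_add.IH(2) q by blast
      from expand_sub[OF ex \<psi>1(1) \<open>f \<in> F\<close>] obtain \<psi> where
        "expand p p' \<chi> (\<psi> + (\<psi>1 + \<psi>0))" "ipar R l Y \<psi>"
        using P2 by blast
      then show ?thesis using \<psi>1 \<open>parsep R X Y\<close>
        by (intro exI[of _ "\<psi>1 + \<psi>"]) (auto intro: ipar_union simp: ac_simps)
    qed
  qed
qed

lemma accept_iff: "q < n \<Longrightarrow> f \<in> F \<Longrightarrow> srun R l q X f \<longleftrightarrow> crun R l [q] X [f]"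
proof
  assume "q < n" "srun R l q X f"
  then show "crun R l [q] X [f]" using srun_complete(1) silent_init by blast
next
  assume "crun R l [q] X [f]"
  \<comment> \<open>The continuation is instantiated with the empty run in \<open>f\<close>.\<close>
  from crun_sound(1)[OF this] have "seqsep R X {} \<longrightarrow> brun R l [f] {} f \<longrightarrow> brun R l [q] (X \<union> {}) f"
    by blast
  then show "srun R l q X f" by (simp add: srun_empty)
qed

lemma silent_accept_iff: "q < n \<Longrightarrow> srun R l q {} f \<longleftrightarrow> expand q f {#} {#}"
proof
  assume q: "q < n" "srun R l q {} f"
  have "\<not> conn R {}" using conn_nonempty by blast
  with srun_complete(1)[OF q(2)] q(1) obtain \<psi> where "expand q f {#} \<psi>" "ipar R l {} \<psi>" by blast
  then show "expand q f {#} {#}" using ipar_empty_mset by blast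
next
  assume "expand q f {#} {#}"
  from expand_sound[OF this] show "srun R l q {} f" using spar_empty by simp
qed

section \<open>Compositionality: the equations behind the type operations\<close>

lemma crun_letter_iff: "crun R l \<kappa> {x} \<kappa>' \<longleftrightarrow> (\<exists>q \<sigma> q'. silent \<kappa> (q # \<sigma>) \<and> q' \<in> \<delta> q (l x) \<and>
    (x, x) \<in> R \<and> silent (q' # \<sigma>) \<kappa>')"
proof
  assume "crun R l \<kappa> {x} \<kappa>'"
  then show "\<exists>q \<sigma> q'. silent \<kappa> (q # \<sigma>) \<and> q' \<in> \<delta> q (l x) \<and> (x, x) \<in> R \<and> silent (q' # \<sigma>) \<kappa>'"
  proof (cases rule: crun.cases)
    case (crun_seq X \<kappa>1 Y)
    then have "X \<subseteq> {x}" "Y \<subseteq> {x}" by simp_all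
    then have "X = {x}" "Y = {x}" using \<open>X \<noteq> {}\<close> \<open>Y \<noteq> {}\<close> by (simp_all add: subset_singleton_iff)
    then have False using \<open>seqsep R X Y\<close> by (auto simp: seqsep_def)
    then show ?thesis ..
  next
    case (crun_fork q \<sigma> \<psi> q')
    then show ?thesis using conn_single by blast
  qed auto
next
  assume "\<exists>q \<sigma> q'. silent \<kappa> (q # \<sigma>) \<and> q' \<in> \<delta> q (l x) \<and> (x, x) \<in> R \<and> silent (q' # \<sigma>) \<kappa>'"
  then obtain q \<sigma> q' where "silent \<kappa> (q # \<sigma>)" "q' \<in> \<delta> q (l x)" "(x, x) \<in> R" "silent (q' # \<sigma>) \<kappa>'"
    by blast
  then show "crun R l \<kappa> {x} \<kappa>'" by (rule crun_letter[of _ q _ q' l x])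
qed

lemma crun_seq_iff: "seqsep R X Y \<Longrightarrow> X \<noteq> {} \<Longrightarrow> Y \<noteq> {} \<Longrightarrow>
    crun R l \<kappa> (X \<union> Y) \<kappa>' \<longleftrightarrow> (\<exists>\<kappa>1. crun R l \<kappa> X \<kappa>1 \<and> crun R l \<kappa>1 Y \<kappa>')"
  using crun_split[OF _ refl] crun_comp by metis

text \<open>Among the rules of \<open>crun\<close>, only \<open>crun_fork\<close> reads a non-empty
  set that is not connected.\<close>

lemma crun_par_iff: "parsep R X Y \<Longrightarrow> X \<noteq> {} \<Longrightarrow> Y \<noteq> {} \<Longrightarrow>
    crun R l \<kappa> (X \<union> Y) \<kappa>' \<longleftrightarrow> (\<exists>q \<sigma> q' \<psi>. silent \<kappa> (q # \<sigma>) \<and> ipar R l (X \<union> Y) \<psi> \<and>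
      expand q q' {#} \<psi> \<and> silent (q' # \<sigma>) \<kappa>')"
proof
  assume *: "parsep R X Y" "X \<noteq> {}" "Y \<noteq> {}" "crun R l \<kappa> (X \<union> Y) \<kappa>'"
  then have nc: "\<not> conn R (X \<union> Y)" using not_conn_par by simp
  from *(4) show "\<exists>q \<sigma> q' \<psi>. silent \<kappa> (q # \<sigma>) \<and> ipar R l (X \<union> Y) \<psi> \<and>
      expand q q' {#} \<psi> \<and> silent (q' # \<sigma>) \<kappa>'"
  proof (cases rule: crun.cases)
    case (crun_letter q \<sigma> q' x)
    then show ?thesis using nc conn_single by auto
  next
    case (crun_seq A \<kappa>1 B)
    then show ?thesis using nc conn_seq[OF \<open>seqsep R A B\<close>] by simp
  qed (use * in auto)
next
  assume *: "parsep R X Y" "X \<noteq> {}" "Y \<noteq> {}" "\<exists>q \<sigma> q' \<psi>. silent \<kappa> (q # \<sigma>) \<and>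
      ipar R l (X \<union> Y) \<psi> \<and> expand q q' {#} \<psi> \<and> silent (q' # \<sigma>) \<kappa>'"
  from *(4) obtain q \<sigma> q' \<psi> where k: "silent \<kappa> (q # \<sigma>)" "ipar R l (X \<union> Y) \<psi>" "expand q q' {#} \<psi>"
    "silent (q' # \<sigma>) \<kappa>'" by blast
  show "crun R l \<kappa> (X \<union> Y) \<kappa>'"
    by (rule crun_fork[OF k(1-3) _ _ k(4)]) (use * not_conn_par in auto)
qed

lemma ipar_par_iff: "parsep R X Y \<Longrightarrow> ipar R l (X \<union> Y) \<psi> \<longleftrightarrow>
    (\<exists>\<psi>1 \<psi>2. \<psi> = \<psi>1 + \<psi>2 \<and> ipar R l X \<psi>1 \<and> ipar R l Y \<psi>2)"
  using ipar_split[OF _ refl] ipar_union by metis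

end

section \<open>Runs on representatives of pomsets\<close>

lemma lpo_iso_emb:
  assumes "lpo_iso (S, R, l) (S', R', l')"
  obtains g where "emb g S' R' l' R l" "g ` S' = S" "R \<subseteq> S \<times> S"
proof -
  obtain f where f: "bij_betw f S S'" "\<forall>x\<in>S. \<forall>y\<in>S. (x, y) \<in> R \<longleftrightarrow> (f x, f y) \<in> R'"
    "\<forall>x\<in>S. l' (f x) = l x" and "R \<subseteq> S \<times> S"
    using assms unfolding lpo_iso_def by auto
  then have "emb f S R l R' l'" by (simp add: emb_def bij_betw_def)
  from emb_inv[OF this] have "emb (inv_into S f) S' R' l' R l"
    using f(1) by (simp add: bij_betw_def)
  moreover have "inv_into S f ` S' = S" using f(1) by (auto simp: bij_betw_def)
  ultimately show ?thesis using that \<open>R \<subseteq> S \<times> S\<close> by blast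
qed

lemma lpo_isoI:
  assumes "emb f S R l R' l'" "f ` S = S'" "R \<subseteq> S \<times> S" "R' \<subseteq> S' \<times> S'"
  shows "lpo_iso (S, R, l) (S', R', l')"
  unfolding lpo_iso_def using assms by (auto simp: emb_def bij_betw_def intro!: exI[of _ f])

lemma lpo_iso_sym: "lpo_iso U V \<Longrightarrow> lpo_iso V U"
proof -
  obtain S R l S' R' l' where UV: "U = (S, R, l)" "V = (S', R', l')" by (cases U, cases V) auto
  assume "lpo_iso U V"
  moreover from this have "R' \<subseteq> S' \<times> S'" unfolding UV lpo_iso_def by auto
  ultimately show ?thesis unfolding UV by (blast elim: lpo_iso_emb intro: lpo_isoI)
qed

lemma lpo_iso_trans:
  assumes "lpo_iso U V" "lpo_iso V W" shows "lpo_iso U W"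
proof -
  obtain S R l S' R' l' S'' R'' l'' where UV: "U = (S, R, l)" "V = (S', R', l')" "W = (S'', R'',
    l'')"
    by (cases U, cases V, cases W) auto
  obtain f g where f: "bij_betw f S S'" "\<forall>x\<in>S. \<forall>y\<in>S. (x, y) \<in> R \<longleftrightarrow> (f x, f y) \<in> R'"
    "\<forall>x\<in>S. l' (f x) = l x" and g: "bij_betw g S' S''"
    "\<forall>x\<in>S'. \<forall>y\<in>S'. (x, y) \<in> R' \<longleftrightarrow> (g x, g y) \<in> R''" "\<forall>x\<in>S'. l'' (g x) = l' x"
    and R: "R \<subseteq> S \<times> S" "R'' \<subseteq> S'' \<times> S''"
    using assms unfolding UV lpo_iso_def by auto
  have "f x \<in> S'" if "x \<in> S" for x using f(1) that by (auto simp: bij_betw_def)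
  then show ?thesis unfolding UV lpo_iso_def
    using f g R bij_betw_trans[OF f(1) g(1)] by (auto intro!: exI[of _ "g \<circ> f"])
qed

lemma sp_wf: "sp k U \<Longrightarrow> fst (snd U) \<subseteq> fst U \<times> fst U"
  by (erule sp.cases) (auto simp: lpo_iso_def)

lemma sp_iso:
  assumes "sp k V" "lpo_iso U V" shows "sp k U"
  using assms(1)
proof (cases rule: sp.cases)
  case sp_empty
  then show ?thesis by (rule sp.sp_empty[OF lpo_iso_trans[OF assms(2)]])
next
  case (sp_single a x)
  then show ?thesis by (intro sp.sp_single[OF _ lpo_iso_trans[OF assms(2)]])
next
  case (sp_seq V1 V2)
  then show ?thesis by (intro sp.sp_seq[OF _ _ _ lpo_iso_trans[OF assms(2)]])
next
  case (sp_par V1 V2)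
  then show ?thesis by (intro sp.sp_par[OF _ _ _ lpo_iso_trans[OF assms(2)]])
qed

text \<open>The carrier of the copy is prescribed, so that two pomsets can be moved to disjoint
  carriers before they are composed.\<close>

lemma sp_copy:
  assumes "sp k (S, R, l)" "inj f"
  obtains R' l' where "sp k (f ` S, R', l')" "emb f S R l R' l'"
proof -
  let ?R = "(\<lambda>(x, y). (f x, f y)) ` R" and ?l = "\<lambda>y. l (inv f y)"
  have R: "R \<subseteq> S \<times> S" using sp_wf[OF assms(1)] by simp
  have e: "emb f S R l ?R ?l"
    unfolding emb_def
  proof (intro conjI ballI)
    show "inj_on f S" using assms(2) by (rule inj_on_subset) simp
    show "(x, y) \<in> R \<longleftrightarrow> (f x, f y) \<in> ?R" for x y using assms(2) by (auto simp: inj_eq)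
    show "?l (f x) = l x" for x using assms(2) by simp
  qed
  have "lpo_iso (S, R, l) (f ` S, ?R, ?l)" by (rule lpo_isoI[OF e refl R]) (use R in auto)
  then have "sp k (f ` S, ?R, ?l)" by (rule sp_iso[OF assms(1) lpo_iso_sym])
  then show ?thesis using that e by blast
qed

lemma emb_seq_parts:
  assumes "R1 \<subseteq> S1 \<times> S1" "R2 \<subseteq> S2 \<times> S2" "S1 \<inter> S2 = {}"
  shows "emb id S1 R1 l1 (R1 \<union> R2 \<union> S1 \<times> S2) (\<lambda>x. if x \<in> S1 then l1 x else l2 x)"
    and "emb id S2 R2 l2 (R1 \<union> R2 \<union> S1 \<times> S2) (\<lambda>x. if x \<in> S1 then l1 x else l2 x)"
    and "seqsep (R1 \<union> R2 \<union> S1 \<times> S2) S1 S2"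
  using assms by (auto simp: emb_def seqsep_def)

lemma emb_par_parts:
  assumes "R1 \<subseteq> S1 \<times> S1" "R2 \<subseteq> S2 \<times> S2" "S1 \<inter> S2 = {}"
  shows "emb id S1 R1 l1 (R1 \<union> R2) (\<lambda>x. if x \<in> S1 then l1 x else l2 x)"
    and "emb id S2 R2 l2 (R1 \<union> R2) (\<lambda>x. if x \<in> S1 then l1 x else l2 x)"
    and "parsep (R1 \<union> R2) S1 S2"
  using assms by (auto simp: emb_def parsep_def)

lemma carrier_par_list: "fst (lpo_par_list Us) = (\<Union>U\<in>set Us. lpo_carrier U)"
  by (induction Us) (auto simp: lpo_par_list_def lpo_par_def lpo_empty_def lpo_carrier_def
      split: prod.splits)

lemma pairwise_disjoint_Cons:
  "pairwise_disjoint_lpos (U # Us) \<longleftrightarrow>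
    (\<forall>V\<in>set Us. lpo_carrier U \<inter> lpo_carrier V = {}) \<and> pairwise_disjoint_lpos Us"
proof
  assume *: "pairwise_disjoint_lpos (U # Us)"
  have "lpo_carrier U \<inter> lpo_carrier (Us ! j) = {}" if "j < length Us" for j
    using *[unfolded pairwise_disjoint_lpos_def, rule_format, of 0 "Suc j"] that by simp
  moreover have "pairwise_disjoint_lpos Us" unfolding pairwise_disjoint_lpos_def
    using *[unfolded pairwise_disjoint_lpos_def, rule_format, of "Suc i" "Suc j" for i j] by auto
  ultimately show "(\<forall>V\<in>set Us. lpo_carrier U \<inter> lpo_carrier V = {}) \<and> pairwise_disjoint_lpos Us"
    by (metis in_set_conv_nth)
next
  assume *: "(\<forall>V\<in>set Us. lpo_carrier U \<inter> lpo_carrier V = {}) \<and> pairwise_disjoint_lpos Us"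
  show "pairwise_disjoint_lpos (U # Us)" unfolding pairwise_disjoint_lpos_def
  proof (intro allI impI)
    fix i j assume ij: "i < j \<and> j < length (U # Us)"
    then obtain j' where j: "j = Suc j'" by (cases j) auto
    show "lpo_carrier ((U # Us) ! i) \<inter> lpo_carrier ((U # Us) ! j) = {}"
    proof (cases i)
      case 0
      then show ?thesis using * ij j by simp
    next
      case (Suc i')
      then show ?thesis using conjunct2[OF *, unfolded pairwise_disjoint_lpos_def, rule_format,
        of i' j'] ij j
        by simp
    qed
  qed
qed

lemma run_wf: "run F \<delta> \<gamma> q U q' \<Longrightarrow> fst (snd U) \<subseteq> fst U \<times> fst U"
  by (erule run.cases) (auto simp: lpo_iso_def)

context pa
begin

abbreviation "lsrun q U q' \<equiv> srun (fst (snd U)) (snd (snd U)) q (fst U) q'"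

lemma srun_emb_id: "srun R l q X q' \<Longrightarrow> emb id X R l R' l' \<Longrightarrow> srun R' l' q X q'"
  and spar_emb_id: "spar R l X \<phi> \<Longrightarrow> emb id X R l R' l' \<Longrightarrow> spar R' l' X \<phi>"
  using srun_emb[where f = id] by simp_all

lemma spar_par_list:
  assumes "list_all2 (\<lambda>q U. \<exists>f\<in>F. lsrun q U f \<and> fst (snd U) \<subseteq> fst U \<times> fst U) qs Us"
    "pairwise_disjoint_lpos Us"
  shows "fst (snd (lpo_par_list Us)) \<subseteq> fst (lpo_par_list Us) \<times> fst (lpo_par_list Us) \<and>
    spar (fst (snd (lpo_par_list Us))) (snd (snd (lpo_par_list Us))) (fst (lpo_par_list Us))
      (mset qs)"
  using assms
proof (induction rule: list_all2_induct)
  case Nil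
  then show ?case by (simp add: lpo_par_list_def lpo_empty_def spar_empty)
next
  case (Cons q qs U Us)
  obtain S1 R1 l1 where U: "U = (S1, R1, l1)" by (cases U) auto
  obtain S2 R2 l2 where P: "lpo_par_list Us = (S2, R2, l2)" by (cases "lpo_par_list Us") auto
  let ?l = "\<lambda>x. if x \<in> S1 then l1 x else l2 x"
  have P': "lpo_par_list (U # Us) = (S1 \<union> S2, R1 \<union> R2, ?l)"
    using P U by (simp add: lpo_par_list_def lpo_par_def)
  have disj: "S1 \<inter> S2 = {}" using carrier_par_list[of Us] Cons.prems U P
    by (auto simp: pairwise_disjoint_Cons lpo_carrier_def)
  obtain f where f: "f \<in> F" "srun R1 l1 q S1 f" and R1: "R1 \<subseteq> S1 \<times> S1"
    using Cons.hyps U by auto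
  have IH: "R2 \<subseteq> S2 \<times> S2" "spar R2 l2 S2 (mset qs)"
    using Cons.IH Cons.prems P by (auto simp: pairwise_disjoint_Cons)
  note e = emb_par_parts[OF R1 IH(1) disj]
  have "spar (R1 \<union> R2) ?l (S1 \<union> S2) (add_mset q (mset qs))"
    by (rule spar_add[OF srun_emb_id[OF f(2) e(1)] f(1) e(3) spar_emb_id[OF IH(2) e(2)]])
  then show ?case using R1 IH(1) by (auto simp: P')
qed

lemma lsrun_iso:
  assumes "lpo_iso U V" "lsrun q V q'" shows "lsrun q U q'"
proof -
  obtain S R l S' R' l' where UV: "U = (S, R, l)" "V = (S', R', l')" by (cases U, cases V) auto
  from assms(1)[unfolded UV] obtain g where "emb g S' R' l' R l" "g ` S' = S" by (rule lpo_iso_emb)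
  then show ?thesis using srun_emb(1)[of R' l' q S' q' g R l] assms(2) UV by simp
qed

lemma run_srun: "run F \<delta> \<gamma> q U q' \<Longrightarrow> lsrun q U q'"
proof (induction rule: run.induct)
  case (run_empty U q)
  then show ?case by (rule lsrun_iso) (simp add: lpo_empty_def srun_empty)
next
  case (run_letter q' q a U x)
  then show ?case
    by (intro lsrun_iso[OF run_letter(2)]) (auto simp: lpo_single_def intro: srun_letter)
next
  case (run_seq q V q'' W q' U)
  obtain S1 R1 l1 where V: "V = (S1, R1, l1)" by (cases V) auto
  obtain S2 R2 l2 where W: "W = (S2, R2, l2)" by (cases W) auto
  let ?R = "R1 \<union> R2 \<union> S1 \<times> S2" and ?l = "\<lambda>x. if x \<in> S1 then l1 x else l2 x"
  have "R1 \<subseteq> S1 \<times> S1" "R2 \<subseteq> S2 \<times> S2" "S1 \<inter> S2 = {}"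
    using run_wf[OF run_seq.hyps(1)] run_wf[OF run_seq.hyps(2)] run_seq.hyps(3) V W
    by (simp_all add: lpo_carrier_def)
  note e = emb_seq_parts[OF this]
  have "srun ?R ?l q S1 q''" by (rule srun_emb_id[OF _ e(1)]) (use run_seq.IH(1) V in simp)
  moreover have "srun ?R ?l q'' S2 q'" by (rule srun_emb_id[OF _ e(2)])
    (use run_seq.IH(2) W in simp)
  ultimately have "srun ?R ?l q (S1 \<union> S2) q'" using e(3) by (rule srun_seq)
  then show ?case by (intro lsrun_iso[OF run_seq.hyps(4)]) (simp add: V W lpo_seq_def)
next
  case (run_par q' q qs Us U)
  have "list_all2 (\<lambda>q U. \<exists>f\<in>F. lsrun q U f \<and> fst (snd U) \<subseteq> fst U \<times> fst U) qs Us"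
    unfolding list_all2_conv_all_nth
  proof (intro conjI allI impI)
    fix i assume "i < length qs"
    then obtain f where "f \<in> F" "run F \<delta> \<gamma> (qs ! i) (Us ! i) f" "lsrun (qs ! i) (Us ! i) f"
      using run_par.IH by blast
    then show "\<exists>f\<in>F. lsrun (qs ! i) (Us ! i) f \<and> fst (snd (Us ! i)) \<subseteq> fst (Us ! i) \<times> fst (Us ! i)"
      using run_wf[OF \<open>run F \<delta> \<gamma> (qs ! i) (Us ! i) f\<close>] by (intro bexI[of _ f]) auto
  qed (use run_par in simp)
  then show ?case using spar_par_list[of qs Us] \<open>pairwise_disjoint_lpos Us\<close>
    by (intro lsrun_iso[OF \<open>lpo_iso U (lpo_par_list Us)\<close>] srun_fork[OF _ \<open>q' \<in> \<gamma> q (mset qs)\<close>]) simp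
qed

text \<open>A subset of the ambient poset becomes a representative by restricting \<open>R\<close>
  to it. Labels of the parallel list are compared on \<open>X\<close> only, since their values off
  the carrier depend on how the list was assembled.\<close>

lemma srun_run:
  "srun R l q X q' \<Longrightarrow> run F \<delta> \<gamma> q (X, R \<inter> X \<times> X, l) q'"
  "spar R l X \<phi> \<Longrightarrow> \<exists>qs Us. mset qs = \<phi> \<and> list_all2 (\<lambda>q U. \<exists>f\<in>F. run F \<delta> \<gamma> q U f) qs Us \<and>
     pairwise_disjoint_lpos Us \<and> fst (lpo_par_list Us) = X \<and>
     fst (snd (lpo_par_list Us)) = R \<inter> X \<times> X \<and> (\<forall>x\<in>X. snd (snd (lpo_par_list Us)) x = l x)"
proof (induction rule: srun_spar.inducts)
  case (srun_empty q)
  have "lpo_iso ({}, {}, l) lpo_empty" by (simp add: lpo_iso_def lpo_empty_def bij_betw_def)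
  then show ?case by (auto intro: run.run_empty)
next
  case (srun_letter q' q x)
  have "lpo_iso ({x}, R \<inter> {x} \<times> {x}, l) (lpo_single x (l x))"
    unfolding lpo_single_def using srun_letter(2) by (intro lpo_isoI[of id]) (auto simp: emb_def)
  then show ?case using srun_letter(1) by (blast intro: run.run_letter)
next
  case (srun_seq q X m Y q')
  have disj: "X \<inter> Y = {}" using \<open>seqsep R X Y\<close> unfolding seqsep_def by blast
  have "lpo_iso (X \<union> Y, R \<inter> (X \<union> Y) \<times> (X \<union> Y), l) (lpo_seq (X, R \<inter> X \<times> X, l) (Y, R \<inter> Y \<times> Y, l))"
    unfolding lpo_seq_def prod.case
    by (rule lpo_isoI[of id]) (use \<open>seqsep R X Y\<close> in \<open>auto simp: emb_def seqsep_def\<close>)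
  then show ?case using disj
    by (intro run.run_seq[OF srun_seq.IH(2) srun_seq.IH(4)]) (simp_all add: lpo_carrier_def)
next
  case (srun_fork X \<phi> q' q)
  then obtain qs Us where *: "mset qs = \<phi>" "list_all2 (\<lambda>q U. \<exists>f\<in>F. run F \<delta> \<gamma> q U f) qs Us"
     "pairwise_disjoint_lpos Us" "fst (lpo_par_list Us) = X"
     "fst (snd (lpo_par_list Us)) = R \<inter> X \<times> X" "\<forall>x\<in>X. snd (snd (lpo_par_list Us)) x = l x"
    by blast
  obtain l' where P: "lpo_par_list Us = (X, R \<inter> X \<times> X, l')" using *(4,5) by (cases
    "lpo_par_list Us") auto
  have "lpo_iso (X, R \<inter> X \<times> X, l) (lpo_par_list Us)"
    unfolding P by (rule lpo_isoI[of id]) (use * P in \<open>auto simp: emb_def\<close>)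
  then show ?case using * \<open>q' \<in> \<gamma> q \<phi>\<close>
    by (intro run.run_par[of q' \<gamma> q qs Us F \<delta>]) (simp_all add: list_all2_conv_all_nth)
next
  case spar_empty
  show ?case by (intro exI[of _ "[]"])
    (simp add: lpo_par_list_def lpo_empty_def pairwise_disjoint_lpos_def)
next
  case (spar_add q X f Y \<phi>)
  then obtain qs Us where *: "mset qs = \<phi>" "list_all2 (\<lambda>q U. \<exists>f\<in>F. run F \<delta> \<gamma> q U f) qs Us"
     "pairwise_disjoint_lpos Us" "fst (lpo_par_list Us) = Y"
     "fst (snd (lpo_par_list Us)) = R \<inter> Y \<times> Y" "\<forall>x\<in>Y. snd (snd (lpo_par_list Us)) x = l x"
    by blast
  obtain l' where P: "lpo_par_list Us = (Y, R \<inter> Y \<times> Y, l')" using *(4,5) by (cases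
    "lpo_par_list Us") auto
  let ?U = "(X, R \<inter> X \<times> X, l)"
  have P': "lpo_par_list (?U # Us) = (X \<union> Y, R \<inter> X \<times> X \<union> R \<inter> Y \<times> Y,
    \<lambda>x. if x \<in> X then l x else l' x)"
    using P by (simp add: lpo_par_list_def lpo_par_def)
  have "\<forall>V\<in>set Us. lpo_carrier V \<subseteq> Y" using carrier_par_list[of Us] P by auto
  moreover have "X \<inter> Y = {}" using \<open>parsep R X Y\<close> by (simp add: parsep_def)
  ultimately have "\<forall>V\<in>set Us. lpo_carrier ?U \<inter> lpo_carrier V = {}"
    by (auto simp: lpo_carrier_def)
  then have "pairwise_disjoint_lpos (?U # Us)" using *(3) by (simp only: pairwise_disjoint_Cons)
  moreover have "R \<inter> X \<times> X \<union> R \<inter> Y \<times> Y = R \<inter> (X \<union> Y) \<times> (X \<union> Y)"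
    using \<open>parsep R X Y\<close> by (auto simp: parsep_def)
  moreover have "list_all2 (\<lambda>q U. \<exists>f\<in>F. run F \<delta> \<gamma> q U f) (q # qs) (?U # Us)"
    using *(2) \<open>f \<in> F\<close> \<open>run F \<delta> \<gamma> q ?U f\<close> by (simp only: list.rel_inject) blast
  moreover have "\<forall>x\<in>X \<union> Y. (if x \<in> X then l x else l' x) = l x" using *(6) P by auto
  ultimately show ?case using *(1) P'
    by (intro exI[of _ "q # qs"] exI[of _ "?U # Us"]) simp
qed

lemma pa_lang_iff:
  assumes "q < n"
  shows "U \<in> pa_lang k F \<delta> \<gamma> q \<longleftrightarrow> sp k U \<and> (\<exists>f\<in>F. crun (fst (snd U)) (snd (snd U)) [q] (fst U) [f])"
proof -
  have "run F \<delta> \<gamma> q U f \<longleftrightarrow> lsrun q U f" if "sp k U" for f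
  proof
    assume "lsrun q U f"
    from srun_run(1)[OF this] show "run F \<delta> \<gamma> q U f"
      using Int_absorb2[OF sp_wf[OF that]] by simp
  qed (rule run_srun)
  then show ?thesis unfolding pa_lang_def using accept_iff[OF assms] by auto
qed

end

section \<open>Fork-acyclicity bounds unfoldings and stacks\<close>

locale fa_pa = pa +
  fixes k K :: nat
  assumes acyclic: "fork_acyclic k \<delta> \<gamma>"
    and fork_size: "\<gamma> q \<phi> \<noteq> {} \<Longrightarrow> size \<phi> \<le> K"
    and \<delta>_k: "q' \<in> \<delta> q a \<Longrightarrow> a < k"
begin

definition rank :: "nat \<Rightarrow> nat" where "rank q = card {r. r < n \<and> support k \<delta> \<gamma> r q}"

text \<open>The base is at least the size \<open>K\<close> of the largest fork, so all branches of a
  fork, having smaller rank, together weigh no more than the forking state. It is positive even for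
  \<open>K = 0\<close>, so every state weighs at least 1.\<close>

definition weight :: "nat \<Rightarrow> nat" where "weight q = (K + 2) ^ rank q"

definition mweight :: "nat multiset \<Rightarrow> nat" where "mweight \<phi> = sum_mset (image_mset weight \<phi>)"

lemma mweight_simps [simp]: "mweight {#} = 0" "mweight (add_mset q \<phi>) = weight q + mweight \<phi>"
  "mweight (\<phi> + \<psi>) = mweight \<phi> + mweight \<psi>"
  by (simp_all add: mweight_def)

lemma rank_mono: "support k \<delta> \<gamma> q' q \<Longrightarrow> rank q' \<le> rank q"
  unfolding rank_def support_def by (intro card_mono) auto

lemma rank_le: "rank q \<le> n"
  unfolding rank_def using card_mono[of "{..<n}" "{r. r < n \<and> support k \<delta> \<gamma> r q}"] by auto

lemma weight_mono: "rank q' \<le> rank q \<Longrightarrow> weight q' \<le> weight q"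
  unfolding weight_def by (intro power_increasing) auto

lemma rank_\<gamma>: "q' \<in> \<gamma> q \<phi> \<Longrightarrow> rank q' \<le> rank q"
  by (rule rank_mono, unfold support_def, rule r_into_rtranclp) (auto simp: support_step_def)

lemma rank_\<delta>: "q' \<in> \<delta> q a \<Longrightarrow> rank q' \<le> rank q"
  by (rule rank_mono, unfold support_def, rule r_into_rtranclp)
    (auto simp: support_step_def dest: \<delta>_k)

text \<open>The states below \<open>r\<close> are also below \<open>q\<close>, while fork-acyclicity
  keeps \<open>q\<close> itself from being below \<open>r\<close>; the sets counted by
  \<open>rank\<close> are strictly nested.\<close>

lemma rank_fork:
  assumes "r \<in># \<phi>" "\<gamma> q \<phi> \<noteq> {}" shows "rank r < rank q"
  unfolding rank_def
proof (rule psubset_card_mono)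
  have "support k \<delta> \<gamma> r q" using assms unfolding support_def support_step_def by blast
  then have "{p. p < n \<and> support k \<delta> \<gamma> p r} \<subseteq> {p. p < n \<and> support k \<delta> \<gamma> p q}"
    by (auto simp: support_def)
  moreover have "q \<in> {p. p < n \<and> support k \<delta> \<gamma> p q}" using assms \<gamma>_n by (auto simp: support_def)
  moreover have "q \<notin> {p. p < n \<and> support k \<delta> \<gamma> p r}"
    using acyclic assms unfolding fork_acyclic_def by blast
  ultimately show "{p. p < n \<and> support k \<delta> \<gamma> p r} \<subset> {p. p < n \<and> support k \<delta> \<gamma> p q}" by blast
qed simp

lemma mweight_fork:
  assumes "\<gamma> q \<phi> \<noteq> {}" shows "mweight \<phi> \<le> weight q"
proof (cases "\<phi> = {#}")
  case False
  then obtain r where "r \<in># \<phi>" by blast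
  then obtain m where m: "rank q = Suc m" using rank_fork[OF _ assms] by (cases "rank q") auto
  have "mweight \<psi> \<le> size \<psi> * (K + 2) ^ m" if "\<forall>r\<in>#\<psi>. rank r < rank q" for \<psi>
    using that
  proof (induction \<psi>)
    case (add r \<psi>)
    have "weight r \<le> (K + 2) ^ m" unfolding weight_def using add.prems m
      by (intro power_increasing) auto
    then show ?case using add by simp
  qed simp
  then have "mweight \<phi> \<le> size \<phi> * (K + 2) ^ m" using rank_fork[OF _ assms] by blast
  also have "\<dots> \<le> (K + 2) * (K + 2) ^ m" using fork_size[OF assms] by (intro mult_right_mono) auto
  finally show ?thesis by (simp add: weight_def m)
qed simp

text \<open>Replacing a forked state by its own leaves does not increase the total weight, and
  \<open>expand_comp\<close> has leaves on one side only, possibly from an intermediate state of no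
  larger rank. The weights bound the unfoldings, the ranks of the leaves bound the stacks.\<close>

lemma expand_bounds: "expand q q' \<chi> \<psi> \<Longrightarrow>
    rank q' \<le> rank q \<and> mweight \<chi> + mweight \<psi> \<le> weight q \<and> (\<forall>s\<in>#\<chi> + \<psi>. rank s < rank q)"
proof (induction rule: expand.induct)
  case (expand_fork q' q \<phi>)
  then have "\<gamma> q \<phi> \<noteq> {}" by blast
  then show ?case using expand_fork rank_\<gamma> mweight_fork rank_fork by auto
next
  case (expand_sub q q' r \<chi> \<psi> f \<psi>')
  then show ?case by (auto dest: less_trans)
next
  case (expand_comp q m \<psi> q' \<psi>')
  then show ?case using weight_mono[of m q] by auto
qed auto

lemma size_le_mweight: "size \<phi> \<le> mweight \<phi>"
proof (induction \<phi>)
  case (add q \<phi>)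
  have "1 \<le> weight q" by (simp add: weight_def)
  then show ?case using add by simp
qed simp

text \<open>The length bound is the largest weight of a state of rank at most \<open>n\<close>; as
  every state weighs at least 1, it also bounds the number of leaves.\<close>

definition small_msets :: "nat multiset set" where
  "small_msets = mset ` {xs. set xs \<subseteq> {..<n} \<and> length xs \<le> (K + 2) ^ n}"

lemma finite_small_msets: "finite small_msets"
  unfolding small_msets_def by (intro finite_imageI finite_lists_length_le) simp

lemma expand_small: assumes "expand q q' \<chi> \<psi>" shows "\<chi> \<in> small_msets" "\<psi> \<in> small_msets"
proof -
  have "weight q \<le> (K + 2) ^ n" unfolding weight_def using rank_le by (intro power_increasing) auto
  then have "size \<chi> \<le> (K + 2) ^ n" "size \<psi> \<le> (K + 2) ^ n"
    using expand_bounds[OF assms] size_le_mweight[of \<chi>] size_le_mweight[of \<psi>] by linarith+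
  moreover have "\<phi> \<in> small_msets" if "set_mset \<phi> \<subseteq> {..<n}" "size \<phi> \<le> (K + 2) ^ n" for \<phi>
  proof -
    obtain xs where "mset xs = \<phi>" using ex_mset by blast
    then show ?thesis using that unfolding small_msets_def by (intro image_eqI[of _ _ xs]) auto
  qed
  ultimately show "\<chi> \<in> small_msets" "\<psi> \<in> small_msets" using expand_n[OF assms] by auto
qed

lemma finite_expand: "finite {(q, q', \<chi>, \<psi>). expand q q' \<chi> \<psi>}"
  by (rule finite_subset[of _ "{..<n} \<times> {..<n} \<times> small_msets \<times> small_msets"])
    (use expand_small expand_n finite_small_msets in auto)

text \<open>The invariant survives a push because the pushed leaf has smaller rank than the former
  top, which pays for the additional entry below it.\<close>

fun bounded_stack :: "nat list \<Rightarrow> bool" where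
  "bounded_stack [] \<longleftrightarrow> True"
| "bounded_stack (q # \<sigma>) \<longleftrightarrow> q < n \<and> rank q + length \<sigma> \<le> n \<and> bounded_stack \<sigma>"

lemma bounded_stack_D: "bounded_stack \<kappa> \<Longrightarrow> set \<kappa> \<subseteq> {..<n} \<and> length \<kappa> \<le> Suc n"
  by (induction \<kappa>) auto

lemma silent_bounded: "silent \<kappa> \<kappa>' \<Longrightarrow> bounded_stack \<kappa> \<and> bounded_stack \<kappa>'"
proof (induction rule: silent.induct)
  case (silent_init q)
  then show ?case using rank_le by simp
next
  case (silent_move \<kappa> q \<sigma> q')
  then show ?case using expand_bounds[OF silent_move.hyps(2)] expand_n[OF silent_move.hyps(2)]
    by auto
next
  case (silent_push \<kappa> q \<sigma> q' s)
  then show ?case using expand_bounds[OF silent_push.hyps(2)] expand_n[OF silent_push.hyps(2)]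
    by auto
next
  case (silent_letter \<kappa> q \<sigma> q' a)
  then show ?case using rank_\<delta>[OF silent_letter.hyps(2)] \<delta>_n[OF silent_letter.hyps(2)] by auto
next
  case (silent_fork \<kappa> q \<sigma> q' \<psi>)
  then show ?case using expand_bounds[OF silent_fork.hyps(2)] expand_n[OF silent_fork.hyps(2)]
    by auto
qed auto

lemma finite_silent: "finite {(\<kappa>, \<kappa>'). silent \<kappa> \<kappa>'}"
proof (rule finite_subset)
  let ?S = "{xs. set xs \<subseteq> {..<n} \<and> length xs \<le> Suc n}"
  show "{(\<kappa>, \<kappa>'). silent \<kappa> \<kappa>'} \<subseteq> ?S \<times> ?S" using silent_bounded bounded_stack_D by blast
  show "finite (?S \<times> ?S)" by (intro finite_cartesian_product finite_lists_length_le) simp_all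
qed

end

section \<open>Tables of unfoldings and of types\<close>

lemma member_less_encode: "y \<in> set xs \<Longrightarrow> y < list_encode xs"
proof (induction xs)
  case (Cons x xs)
  then show ?case using le_prod_encode_1[of x "list_encode xs"] le_prod_encode_2[of
    "list_encode xs" x]
    by fastforce
qed simp

lemma lmem_iff: "lmem y c \<longleftrightarrow> y \<in> set (list_decode c)"
  using lmem_encode[of y "list_decode c"] by simp

lemma lmem_less: "lmem y c \<Longrightarrow> y < c"
  using member_less_encode[of y "list_decode c"] by (simp add: lmem_iff)

lemma prod_encode_mono: "b \<le> b' \<Longrightarrow> prod_encode (a, b) \<le> prod_encode (a, b')"
  unfolding prod_encode_def triangle_def by (auto intro!: div_le_mono add_mono mult_le_mono)

lemma list_encode_filter_le: "list_encode (filter P xs) \<le> list_encode xs"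
proof (induction xs)
  case (Cons x xs)
  then show ?case using prod_encode_mono[OF Cons, of x] le_prod_encode_2[of "list_encode xs" x]
    by auto
qed simp

text \<open>Filtering cannot increase the code and minimality forbids a decrease. The codes are
  therefore equal, and injectivity of list coding shows that the filter removes nothing.\<close>

lemma Least_list_filter:
  assumes "Q (LEAST c. Q c)" "Q (list_encode (filter P (list_decode (LEAST c. Q c))))"
    "lmem y (LEAST c. Q c)"
  shows "P y"
proof -
  let ?c = "LEAST c. Q c"
  have "?c \<le> list_encode (filter P (list_decode ?c))" using assms(2) by (rule Least_le)
  moreover have "list_encode (filter P (list_decode ?c)) \<le> ?c"
    using list_encode_filter_le[of P "list_decode ?c"] by simp
  ultimately have "list_encode (filter P (list_decode ?c)) = ?c" by simp
  then have "filter P (list_decode ?c) = list_decode ?c" by (metis list_encode_inverse)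
  then show ?thesis using assms(3) unfolding lmem_iff by (metis filter_id_conv)
qed

definition setcode :: "nat set \<Rightarrow> nat" where "setcode S = list_encode (sorted_list_of_set S)"

lemma lmem_setcode [simp]: "finite S \<Longrightarrow> lmem y (setcode S) \<longleftrightarrow> y \<in> S"
  by (simp add: setcode_def)

text \<open>This is pattern matching on codes: the closure rules recognise an occurrence of
  \<open>r\<close> by a factor \<open>nth_prime r\<close>.\<close>

lemma mcode_cancel:
  assumes "nth_prime r * u = mcode \<chi>" shows "\<exists>\<chi>'. \<chi> = add_mset r \<chi>' \<and> u = mcode \<chi>'"
proof -
  have "nth_prime r dvd mcode \<chi>" using assms by (metis dvd_triv_left)
  then obtain s where "s \<in># \<chi>" "nth_prime r dvd nth_prime s"
    unfolding mcode_def using prime_dvd_prod_mset_iff[OF prime_nth_prime] by auto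
  then have "r \<in># \<chi>" using primes_dvd_imp_eq[OF prime_nth_prime prime_nth_prime] inj_nth_prime
    by (auto dest: injD)
  then obtain \<chi>' where "\<chi> = add_mset r \<chi>'" by (blast dest: multi_member_split)
  moreover have "nth_prime r > 0" using prime_nth_prime prime_gt_0_nat by blast
  ultimately show ?thesis using assms by auto
qed

section \<open>Closed tables of unfoldings and silent moves\<close>

abbreviation lcons :: "nat \<Rightarrow> nat \<Rightarrow> nat" where "lcons q s \<equiv> Suc (prod_encode (q, s))"

abbreviation "in_n x \<equiv> lnth (lnth x 0) 0"
abbreviation "in_F x \<equiv> lnth (lnth x 0) (Suc 0)"
abbreviation "in_\<delta> x \<equiv> lnth (lnth x 0) 2"
abbreviation "in_\<gamma> x \<equiv> lnth (lnth x 0) 3"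

text \<open>Unfoldings and silent moves share one table, so that a single minimisation handles both.
  Their entries are lists of length four and two and cannot be confused.\<close>

definition silent_entry :: "nat \<Rightarrow> nat \<Rightarrow> nat \<Rightarrow> bool" where
  "silent_entry c a b \<longleftrightarrow> lmem (list_encode [a, b]) c"

definition expand_entry :: "nat \<Rightarrow> nat \<Rightarrow> nat \<Rightarrow> nat \<Rightarrow> nat \<Rightarrow> bool" where
  "expand_entry c q q' u y \<longleftrightarrow> lmem (list_encode [q, q', u, y]) c"

lemma decidable_silent_entry [computable_intro]: "computable n f \<Longrightarrow> computable n g \<Longrightarrow> computable n h \<Longrightarrow>
  decidable n (\<lambda>e. silent_entry (f e) (g e) (h e))"
  unfolding silent_entry_def by (intro computable_intro)

lemma decidable_expand_entry [computable_intro]: "computable n f \<Longrightarrow> computable n g \<Longrightarrow> computable n h \<Longrightarrow>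
  computable n i \<Longrightarrow> computable n j \<Longrightarrow>
    decidable n (\<lambda>e. expand_entry (f e) (g e) (h e) (i e) (j e))"
  unfolding expand_entry_def by (intro computable_intro)

lemma silent_entry_less: assumes "silent_entry c a b" shows "a < c" "b < c"
  using lmem_less[OF assms[unfolded silent_entry_def]] member_less_encode[of _ "[a, b]"]
  by (meson less_trans list.set_intros)+

lemma expand_entry_less: assumes "expand_entry c q q' u y" shows "q < c" "q' < c" "u < c" "y < c"
  using lmem_less[OF assms[unfolded expand_entry_def]] member_less_encode[of _ "[q, q', u, y]"]
  by (meson less_trans list.set_intros)+

lemma lcons_less: "lcons q s < c \<Longrightarrow> q < c \<and> s < c"
  using le_prod_encode_1[of q s] le_prod_encode_2[of s q] by linarith

text \<open>This and the following predicates are the introduction rules of \<open>expand\<close>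
  and \<open>silent\<close> on codes, with 1 standing for the empty multiset. Bounding the
  quantifiers by \<open>c\<close> is harmless because the components of an entry of \<open>c\<close>
  are smaller than \<open>c\<close>.\<close>

definition closed_init where
  "closed_init x c \<longleftrightarrow> (\<forall>q<in_n x. expand_entry c q q 1 1 \<and> silent_entry c (list_encode [q])
    (list_encode [q]))"
definition closed_fork where
  "closed_fork x c \<longleftrightarrow> (\<forall>q<in_\<gamma> x. \<forall>p<in_\<gamma> x. \<forall>q'<in_\<gamma> x.
     lmem (list_encode [q, p, q']) (in_\<gamma> x) \<longrightarrow> expand_entry c q q' (lcode p) 1)"
definition closed_leaf where
  "closed_leaf x c \<longleftrightarrow> (\<forall>q<c. \<forall>q'<c. \<forall>r<in_n x. \<forall>u<c. \<forall>y<c. expand_entry c q q' (nth_prime r * u) y \<longrightarrow>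
     expand_entry c q q' u (nth_prime r * y))"
definition closed_sub where
  "closed_sub x c \<longleftrightarrow>
    (\<forall>q<c. \<forall>q'<c. \<forall>r<c. \<forall>u<c. \<forall>y<c. \<forall>f<c. \<forall>z<c. expand_entry c q q' (nth_prime r * u) y \<and>
     expand_entry c r f 1 z \<and> lmem f (in_F x) \<longrightarrow> expand_entry c q q' u (z * y))"
definition closed_comp where
  "closed_comp c \<longleftrightarrow> (\<forall>q<c. \<forall>m<c. \<forall>q'<c. \<forall>y<c. \<forall>z<c. expand_entry c q m 1 y \<and>
     expand_entry c m q' 1 z \<and> (y = 1 \<or> z = 1) \<longrightarrow> expand_entry c q q' 1 (y * z))"
definition closed_move where
  "closed_move c \<longleftrightarrow> (\<forall>a<c. \<forall>q<c. \<forall>s<c. \<forall>q'<c. silent_entry c a (lcons q s) \<and>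
    expand_entry c q q' 1 1 \<longrightarrow>
     silent_entry c a (lcons q' s))"
definition closed_push where
  "closed_push x c \<longleftrightarrow> (\<forall>a<c. \<forall>q<c. \<forall>s<c. \<forall>q'<c. \<forall>r<in_n x. silent_entry c a (lcons q s) \<and>
    expand_entry c q q' 1 (nth_prime r) \<longrightarrow>
     silent_entry c a (lcons r (lcons q' s)))"
definition closed_pop where
  "closed_pop x c \<longleftrightarrow> (\<forall>a<c. \<forall>f<c. \<forall>q<c. \<forall>s<c. silent_entry c a (lcons f (lcons q s)) \<and>
    lmem f (in_F x) \<longrightarrow>
     silent_entry c a (lcons q s))"
definition closed_refl where
  "closed_refl c \<longleftrightarrow> (\<forall>a<c. \<forall>b<c. silent_entry c a b \<longrightarrow> silent_entry c b b)"
definition closed_letter where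
  "closed_letter x c \<longleftrightarrow> (\<forall>a<c. \<forall>q<c. \<forall>s<c. \<forall>l<in_\<delta> x. \<forall>q'<in_\<delta> x. silent_entry c a (lcons q s) \<and>
     lmem (list_encode [q, l, q']) (in_\<delta> x) \<longrightarrow> silent_entry c (lcons q' s) (lcons q' s))"
definition closed_result where
  "closed_result c \<longleftrightarrow> (\<forall>a<c. \<forall>q<c. \<forall>s<c. \<forall>q'<c. \<forall>y<c. silent_entry c a (lcons q s) \<and>
    expand_entry c q q' 1 y \<longrightarrow>
     silent_entry c (lcons q' s) (lcons q' s))"

definition fact_table :: "nat \<Rightarrow> nat \<Rightarrow> bool" where
  "fact_table x c \<longleftrightarrow> closed_init x c \<and> closed_fork x c \<and> closed_leaf x c \<and> closed_sub x c \<and>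
     closed_comp c \<and> closed_move c \<and> closed_push x c \<and> closed_pop x c \<and> closed_refl c \<and>
     closed_letter x c \<and> closed_result c"

lemma decidable_fact_table: "decidable 2 (\<lambda>e. fact_table (hd (tl e)) (hd e))"
  unfolding fact_table_def closed_init_def closed_fork_def closed_leaf_def closed_sub_def
    closed_comp_def closed_move_def closed_push_def closed_pop_def closed_refl_def
    closed_letter_def closed_result_def numeral_2_eq_2
  by (intro computable_intro; simp)

section \<open>Types as codes, and tables closed under composition\<close>

definition run_entry :: "nat \<Rightarrow> nat \<Rightarrow> nat \<Rightarrow> bool" where
  "run_entry e a b \<longleftrightarrow> lmem (prod_encode (a, b)) (lnth e 0)"
text \<open>A type is a list with two entries: a list of pairs of stacks joined by the pomset, and a
  list of leaf multisets that can read its components.\<close>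

definition par_entry :: "nat \<Rightarrow> nat \<Rightarrow> bool" where
  "par_entry e y \<longleftrightarrow> lmem y (lnth e 1)"

lemma decidable_run_entry [computable_intro]: "computable n f \<Longrightarrow> computable n g \<Longrightarrow> computable n h \<Longrightarrow>
  decidable n (\<lambda>e. run_entry (f e) (g e) (h e))"
  unfolding run_entry_def by (intro computable_intro)

lemma decidable_par_entry [computable_intro]: "computable n f \<Longrightarrow> computable n g \<Longrightarrow>
  decidable n (\<lambda>e. par_entry (f e) (g e))"
  unfolding par_entry_def by (intro computable_intro)

text \<open>Letters and sequential products of non-empty pomsets are connected, so by
  \<open>ipar_conn\<close> their leaf part consists of single states and is determined by the run
  part. \<open>C\<close> is the fact table and at the same time the bound for codes of stacks and
  multisets.\<close>

definition typ_conn where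
  "typ_conn x C e \<longleftrightarrow> (\<forall>y<C. par_entry e y \<longleftrightarrow> (\<exists>s<in_n x. \<exists>f<in_n x. y = nth_prime s \<and>
    lmem f (in_F x) \<and>
     run_entry e (list_encode [s]) (list_encode [f])))"
definition typ_letter where
  "typ_letter x C l e \<longleftrightarrow> (\<forall>a<C. \<forall>b<C. run_entry e a b \<longleftrightarrow>
    (\<exists>q<C. \<exists>q'<C. \<exists>s<C. silent_entry C a (lcons q s) \<and>
     lmem (list_encode [q, l, q']) (in_\<delta> x) \<and> silent_entry C (lcons q' s) b)) \<and> typ_conn x C e"
definition typ_seq where
  "typ_seq x C e1 e2 e \<longleftrightarrow> (\<forall>a<C. \<forall>b<C. run_entry e a b \<longleftrightarrow> (\<exists>m<C. run_entry e1 a m \<and>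
    run_entry e2 m b)) \<and>
     typ_conn x C e"
text \<open>The dependence between the two parts is reversed here: the leaf multisets are sums of
  those of the factors, and the runs are obtained from them by one fork step.\<close>

definition typ_par where
  "typ_par C e1 e2 e \<longleftrightarrow> (\<forall>y<C. par_entry e y \<longleftrightarrow> (\<exists>u<C. \<exists>v<C. par_entry e1 u \<and> par_entry e2 v \<and>
    y = u * v)) \<and>
     (\<forall>a<C. \<forall>b<C. run_entry e a b \<longleftrightarrow> (\<exists>q<C. \<exists>q'<C. \<exists>s<C. \<exists>y<C. silent_entry C a (lcons q s) \<and>
       par_entry e y \<and>
       expand_entry C q q' 1 y \<and> silent_entry C (lcons q' s) b))"

lemma decidable_typ_conn [computable_intro]: "computable n f \<Longrightarrow> computable n g \<Longrightarrow> computable n h \<Longrightarrow>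
  decidable n (\<lambda>e. typ_conn (f e) (g e) (h e))"
  by (rule decidable_compose3[where P = typ_conn]) (unfold typ_conn_def numeral_3_eq_3,
    (intro computable_intro; simp))

lemma decidable_typ_letter [computable_intro]: "computable n f \<Longrightarrow> computable n g \<Longrightarrow> computable n h \<Longrightarrow>
  computable n i \<Longrightarrow>
    decidable n (\<lambda>e. typ_letter (f e) (g e) (h e) (i e))"
  by (rule decidable_compose4[where P = typ_letter]) (unfold typ_letter_def numeral_eq_Suc,
    (intro computable_intro; simp))

lemma decidable_typ_seq [computable_intro]: "computable n f \<Longrightarrow> computable n g \<Longrightarrow> computable n h \<Longrightarrow>
  computable n i \<Longrightarrow> computable n j \<Longrightarrow>
    decidable n (\<lambda>e. typ_seq (f e) (g e) (h e) (i e) (j e))"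
  by (rule decidable_compose5[where P = typ_seq]) (unfold typ_seq_def numeral_eq_Suc,
    (intro computable_intro; simp))

lemma decidable_typ_par [computable_intro]: "computable n f \<Longrightarrow> computable n g \<Longrightarrow> computable n h \<Longrightarrow>
  computable n i \<Longrightarrow>
    decidable n (\<lambda>e. typ_par (f e) (g e) (h e) (i e))"
  by (rule decidable_compose4[where P = typ_par]) (unfold typ_par_def numeral_eq_Suc,
    (intro computable_intro; simp))

text \<open>One code per composition is enough: entries at or above \<open>C\<close> are
  unconstrained and the order inside the lists is free, so a type has many codes.\<close>

definition type_table :: "nat \<Rightarrow> nat \<Rightarrow> nat \<Rightarrow> nat \<Rightarrow> bool" where
  "type_table k x C c \<longleftrightarrow> (\<forall>l<k. \<exists>e<c. lmem e c \<and> typ_letter x C l e) \<and>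
     (\<forall>e1<c. \<forall>e2<c. lmem e1 c \<and> lmem e2 c \<longrightarrow>
       (\<exists>e<c. lmem e c \<and> typ_seq x C e1 e2 e) \<and> (\<exists>e<c. lmem e c \<and> typ_par C e1 e2 e))"

lemma decidable_type_table: "decidable 3 (\<lambda>e. type_table k (hd (tl e)) (hd (tl (tl e))) (hd e))"
  unfolding type_table_def numeral_3_eq_3 by (intro computable_intro; simp)

definition agree :: "nat \<Rightarrow> nat \<Rightarrow> nat \<Rightarrow> bool" where
  "agree x C c \<longleftrightarrow>
    ((\<exists>f<in_n x. lmem f (in_F x) \<and> expand_entry C (lnth x (Suc 0)) f 1 1) \<longleftrightarrow>
     (\<exists>f<in_n x. lmem f (in_F x) \<and> expand_entry C (lnth x 2) f 1 1)) \<and>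
    (\<forall>e<c. lmem e c \<longrightarrow>
      ((\<exists>f<in_n x. lmem f (in_F x) \<and> run_entry e (list_encode [lnth x (Suc 0)]) (list_encode [f])) \<longleftrightarrow>
       (\<exists>f<in_n x. lmem f (in_F x) \<and> run_entry e (list_encode [lnth x 2]) (list_encode [f]))))"

lemma decidable_agree: "decidable 3 (\<lambda>e. agree (hd e) (hd (tl e)) (hd (tl (tl e))))"
  unfolding agree_def numeral_3_eq_3 by (intro computable_intro; simp)

text \<open>The program depends on \<open>k\<close> alone. Termination of its two searches appears
  as hypotheses, to be discharged for valid inputs.\<close>

lemma decision_program:
  "\<exists>prog. \<forall>x. (\<exists>c. fact_table x c) \<longrightarrow> (\<exists>c. type_table k x (LEAST c. fact_table x c) c) \<longrightarrow>
     eval prog [x] (of_bool (agree x (LEAST c. fact_table x c)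
       (LEAST c. type_table k x (LEAST c. fact_table x c) c)))"
proof -
  obtain p1 where p1: "\<And>xs. length xs = 1 \<Longrightarrow> \<exists>c. fact_table (hd xs) c \<Longrightarrow>
      eval p1 xs (LEAST c. fact_table (hd xs) c)"
    using computable_Least[of 1 "\<lambda>c xs. fact_table (hd xs) c"] decidable_fact_table
      by (auto simp: numeral_2_eq_2)
  obtain p2 where p2: "\<And>xs. length xs = 2 \<Longrightarrow> \<exists>c. type_table k (hd xs) (hd (tl xs)) c \<Longrightarrow>
      eval p2 xs (LEAST c. type_table k (hd xs) (hd (tl xs)) c)"
    using computable_Least[of 2 "\<lambda>c xs. type_table k (hd xs) (hd (tl xs)) c"]
      decidable_type_table[of k]
    by (auto simp: eval_nat_numeral)
  obtain p3 where p3: "\<And>xs. length xs = 3 \<Longrightarrow>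
      eval p3 xs (of_bool (agree (hd xs) (hd (tl xs)) (hd (tl (tl xs)))))"
    using decidable_agree unfolding decidable_def computable_def by blast
  show ?thesis
  proof (intro exI[of _ "Comp p3 [Proj 0, p1, Comp p2 [Proj 0, p1]]"] allI impI)
    fix x assume ex: "\<exists>c. fact_table x c" "\<exists>c. type_table k x (LEAST c. fact_table x c) c"
    let ?C = "LEAST c. fact_table x c"
    let ?D = "LEAST c. type_table k x ?C c"
    have e0: "eval (Proj 0) [x] x" using eval_Proj[of 0 "[x]"] by simp
    have e1: "eval p1 [x] ?C" using p1[of "[x]"] ex by simp
    have "eval p2 [x, ?C] ?D" using p2[of "[x, ?C]"] ex by simp
    then have e2: "eval (Comp p2 [Proj 0, p1]) [x] ?D"
      by (rule eval_Comp[where ys = "[x, ?C]", rotated 2])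
        (use e0 e1 in \<open>auto simp: nth_Cons' less_Suc_eq\<close>)
    have "eval p3 [x, ?C, ?D] (of_bool (agree x ?C ?D))" using p3[of "[x, ?C, ?D]"] by simp
    then show "eval (Comp p3 [Proj 0, p1, Comp p2 [Proj 0, p1]]) [x] (of_bool (agree x ?C ?D))"
      by (rule eval_Comp[where ys = "[x, ?C, ?D]", rotated 2])
        (use e0 e1 e2 in \<open>auto simp: nth_Cons' less_Suc_eq\<close>)
  qed
qed

context pa
begin

lemma crun_emb_iff:
  assumes "emb f X R l R' l'"
  shows "crun R' l' \<kappa> (f ` X) \<kappa>' \<longleftrightarrow> crun R l \<kappa> X \<kappa>'" "ipar R' l' (f ` X) \<psi> \<longleftrightarrow> ipar R l X \<psi>"
proof -
  have i: "inv_into X f ` f ` X = X" using assms by (simp add: emb_def)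
  show "crun R' l' \<kappa> (f ` X) \<kappa>' \<longleftrightarrow> crun R l \<kappa> X \<kappa>'"
  proof
    assume "crun R' l' \<kappa> (f ` X) \<kappa>'"
    from crun_emb(1)[OF this] emb_inv[OF assms] have "crun R l \<kappa> (inv_into X f ` f ` X) \<kappa>'" by blast
    then show "crun R l \<kappa> X \<kappa>'" by (simp only: i)
  next
    assume "crun R l \<kappa> X \<kappa>'"
    from crun_emb(1)[OF this] assms show "crun R' l' \<kappa> (f ` X) \<kappa>'" by blast
  qed
  show "ipar R' l' (f ` X) \<psi> \<longleftrightarrow> ipar R l X \<psi>"
  proof
    assume "ipar R' l' (f ` X) \<psi>"
    from crun_emb(2)[OF this] emb_inv[OF assms] have "ipar R l (inv_into X f ` f ` X) \<psi>" by blast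
    then show "ipar R l X \<psi>" by (simp only: i)
  next
    assume "ipar R l X \<psi>"
    from crun_emb(2)[OF this] assms show "ipar R' l' (f ` X) \<psi>" by blast
  qed
qed

end

section \<open>The least fact table of a description is exact\<close>

locale desc_pa =
  fixes k :: nat and d :: pa_desc and q1 q2 :: nat
  assumes valid: "valid_desc k d" and facyclic: "fork_acyclic k (desc_delta d) (desc_gamma d)"
    and q1: "q1 < desc_states d" and q2: "q2 < desc_states d"
begin

text \<open>The total length of all listed forks is a crude bound for the size of each of
  them.\<close>

sublocale fa_pa "desc_states d" "desc_F d" "desc_delta d" "desc_gamma d" k
  "sum_list (map (\<lambda>(q, ps, q'). length ps) (snd (snd (snd d))))"
proof
  obtain n Fs dl gl where d: "d = (n, Fs, dl, gl)" by (cases d) auto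
  note defs = d desc_states_def desc_F_def desc_delta_def desc_gamma_def
  from valid have v: "\<forall>q\<in>set Fs. q < n" "\<forall>(q, a, q')\<in>set dl. q < n \<and> a < k \<and> q' < n"
     "\<forall>(q, ps, q')\<in>set gl. q < n \<and> (\<forall>p\<in>set ps. p < n) \<and> q' < n"
    unfolding valid_desc_def d by auto
  show "q \<in> desc_F d \<Longrightarrow> q < desc_states d" for q using v by (auto simp: defs)
  show "q' \<in> desc_delta d q a \<Longrightarrow> q < desc_states d \<and> q' < desc_states d" for q q' a
    using v by (auto simp: defs)
  show "q' \<in> desc_delta d q a \<Longrightarrow> a < k" for q q' a using v by (auto simp: defs)
  show "q' \<in> desc_gamma d q \<phi> \<Longrightarrow>
      q < desc_states d \<and> q' < desc_states d \<and> set_mset \<phi> \<subseteq> {..<desc_states d}" for q q' \<phi>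
    using v(3) by (fastforce simp: defs)
  show "fork_acyclic k (desc_delta d) (desc_gamma d)" by (rule facyclic)
  show "size \<phi> \<le> sum_list (map (\<lambda>(q, ps, q'). length ps) (snd (snd (snd d))))"
    if "desc_gamma d q \<phi> \<noteq> {}" for q \<phi>
  proof -
    from that obtain ps q' where "(q, ps, q') \<in> set gl" "mset ps = \<phi>" by (auto simp: defs)
    then have "size \<phi> \<in> set (map (\<lambda>(q, ps, q'). length ps) gl)"
      by (force simp flip: size_mset)
    from member_le_sum_list[OF this] show ?thesis by (simp add: d)
  qed
qed

abbreviation "input \<equiv> encode_input d q1 q2"

lemma input_simps [simp]: "in_n input = desc_states d" "lnth input (Suc 0) = q1" "lnth input 2 = q2"
  "lmem f (in_F input) \<longleftrightarrow> f \<in> desc_F d"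
  "lmem (list_encode [q, a, q']) (in_\<delta> input) \<longleftrightarrow> q' \<in> desc_delta d q a"
  "lmem (list_encode [q, p, q']) (in_\<gamma> input) \<longleftrightarrow>
    (\<exists>ps. p = list_encode ps \<and> (q, ps, q') \<in> set (snd (snd (snd d))))"
proof -
  obtain n Fs dl gl where d: "d = (n, Fs, dl, gl)" by (cases d) auto
  have x: "lnth input 0 = encode_desc d" "lnth input (Suc 0) = q1" "lnth input 2 = q2"
    unfolding encode_input_def by (simp_all del: list_encode.simps)
  then show "lnth input (Suc 0) = q1" "lnth input 2 = q2" by simp_all
  have e: "lnth (encode_desc d) 0 = n" "lnth (encode_desc d) (Suc 0) = list_encode Fs"
    "lnth (encode_desc d) 2 = list_encode (map (\<lambda>(q, a, q'). list_encode [q, a, q']) dl)"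
    "lnth (encode_desc d) 3 = list_encode (map (\<lambda>(q, ps, q'). list_encode [q, list_encode ps,
      q']) gl)"
    unfolding encode_desc_def d by (simp_all del: list_encode.simps)
  show "in_n input = desc_states d" "lmem f (in_F input) \<longleftrightarrow> f \<in> desc_F d"
    unfolding x e by (simp_all add: d desc_states_def desc_F_def)
  show "lmem (list_encode [q, a, q']) (in_\<delta> input) \<longleftrightarrow> q' \<in> desc_delta d q a"
    unfolding x e lmem_encode
    by (force simp: d desc_delta_def list_encode_eq simp del: list_encode.simps)
  show "lmem (list_encode [q, p, q']) (in_\<gamma> input) \<longleftrightarrow>
    (\<exists>ps. p = list_encode ps \<and> (q, ps, q') \<in> set (snd (snd (snd d))))"
    unfolding x e lmem_encode
    by (force simp: d list_encode_eq simp del: list_encode.simps)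
qed

lemma silent_n: "silent \<kappa> \<kappa>' \<Longrightarrow> set \<kappa> \<subseteq> {..<desc_states d} \<and> set \<kappa>' \<subseteq> {..<desc_states d}"
  using silent_bounded bounded_stack_D by blast

definition facts :: "nat set" where
  "facts = {list_encode [q, q', mcode \<chi>, mcode \<psi>] |q q' \<chi> \<psi>. expand q q' \<chi> \<psi>} \<union>
     {list_encode [list_encode \<kappa>, list_encode \<kappa>'] |\<kappa> \<kappa>'. silent \<kappa> \<kappa>'}"

lemma finite_facts: "finite facts"
proof -
  have "facts = (\<lambda>(q, q', \<chi>, \<psi>). list_encode [q, q', mcode \<chi>, mcode \<psi>]) `
      {(q, q', \<chi>, \<psi>). expand q q' \<chi> \<psi>} \<union>
     (\<lambda>(\<kappa>, \<kappa>'). list_encode [list_encode \<kappa>, list_encode \<kappa>']) ` {(\<kappa>, \<kappa>'). silent \<kappa> \<kappa>'}"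
    unfolding facts_def by (auto simp: image_def)
  then show ?thesis using finite_expand finite_silent by simp
qed

lemma facts_iff:
  "list_encode [q, q', u, y] \<in> facts \<longleftrightarrow> (\<exists>\<chi> \<psi>. u = mcode \<chi> \<and> y = mcode \<psi> \<and> expand q q' \<chi> \<psi>)"
  "list_encode [a, b] \<in> facts \<longleftrightarrow> silent (list_decode a) (list_decode b)"
proof -
  show "list_encode [q, q', u, y] \<in> facts \<longleftrightarrow> (\<exists>\<chi> \<psi>. u = mcode \<chi> \<and> y = mcode \<psi> \<and> expand q q' \<chi> \<psi>)"
    unfolding facts_def by (auto simp only: list_encode_eq Un_iff mem_Collect_eq list.inject)
  show "list_encode [a, b] \<in> facts \<longleftrightarrow> silent (list_decode a) (list_decode b)"
    unfolding facts_def by (auto simp only: list_encode_eq Un_iff mem_Collect_eq list.inject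
      list_encode_inverse) (metis list_decode_inverse)
qed

lemma fact_table_expand:
  assumes "fact_table input c" "expand q q' \<chi> \<psi>" shows "expand_entry c q q' (mcode \<chi>) (mcode \<psi>)"
  using assms(2)
proof (induction rule: expand.induct)
  case (expand_refl q)
  have "closed_init input c" using assms(1) unfolding fact_table_def by blast
  from this[unfolded closed_init_def, rule_format, of q] expand_refl show ?case by simp
next
  case (expand_fork q' q \<phi>)
  then obtain ps where ps: "(q, ps, q') \<in> set (snd (snd (snd d)))" "mset ps = \<phi>"
    unfolding desc_gamma_def by auto
  then have m: "lmem (list_encode [q, list_encode ps, q']) (in_\<gamma> input)" unfolding input_simps
    by blast
  have l: "q < in_\<gamma> input" "list_encode ps < in_\<gamma> input" "q' < in_\<gamma> input"
    by (rule less_trans[OF member_less_encode lmem_less[OF m]]; simp)+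
  have "closed_fork input c" using assms(1) unfolding fact_table_def by blast
  from this[unfolded closed_fork_def, rule_format, OF l m] show ?case by (simp add: ps(2))
next
  case (expand_leaf q q' r \<chi> \<psi>)
  have r: "r < in_n input" using expand_n[OF expand_leaf.hyps] by simp
  have t: "expand_entry c q q' (nth_prime r * mcode \<chi>) (mcode \<psi>)" using expand_leaf.IH by simp
  note l = expand_entry_less[OF t]
  \<comment> \<open>The rule quantifies over cofactors below \<open>c\<close>; a cofactor is bounded
    by the entry that it divides.\<close>
  have "mcode \<chi> \<le> nth_prime r * mcode \<chi>" using prime_gt_0_nat[OF prime_nth_prime[of r]] by simp
  then have u: "mcode \<chi> < c" using l(3) by linarith
  have "closed_leaf input c" using assms(1) unfolding fact_table_def by blast
  from this[unfolded closed_leaf_def, rule_format, OF l(1,2) r u l(4) t] show ?case by simp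
next
  case (expand_sub q q' r \<chi> \<psi> f \<psi>')
  have t: "expand_entry c q q' (nth_prime r * mcode \<chi>) (mcode \<psi>)" "expand_entry c r f 1 (mcode \<psi>')"
    using expand_sub.IH by simp_all
  note l = expand_entry_less[OF t(1)] expand_entry_less[OF t(2)]
  have "mcode \<chi> \<le> nth_prime r * mcode \<chi>" using prime_gt_0_nat[OF prime_nth_prime[of r]] by simp
  then have u: "mcode \<chi> < c" using l(3) by linarith
  have "closed_sub input c" using assms(1) unfolding fact_table_def by blast
  from this[unfolded closed_sub_def input_simps, rule_format, OF l(1,2,5) u l(4,6,8)]
    t expand_sub.hyps(3)
  show ?case by simp
next
  case (expand_comp q m \<psi> q' \<psi>')
  have t: "expand_entry c q m 1 (mcode \<psi>)" "expand_entry c m q' 1 (mcode \<psi>')" using expand_comp.IH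
    by simp_all
  note l = expand_entry_less[OF t(1)] expand_entry_less[OF t(2)]
  have e: "mcode \<psi> = 1 \<or> mcode \<psi>' = 1" using expand_comp.hyps(3) by auto
  have "closed_comp c" using assms(1) unfolding fact_table_def by blast
  from this[unfolded closed_comp_def, rule_format, OF l(1,2,6,4,8)] t e show ?case by simp
qed

lemma fact_table_silent:
  assumes c: "fact_table input c" and "silent \<kappa> \<kappa>'" shows "silent_entry c (list_encode \<kappa>)
    (list_encode \<kappa>')"
  using assms(2)
proof (induction rule: silent.induct)
  case (silent_init q)
  have "closed_init input c" using c unfolding fact_table_def by blast
  from this[unfolded closed_init_def, rule_format, of q] silent_init show ?case
    by (simp del: list_encode.simps)
next
  case (silent_move \<kappa> q \<sigma> q')
  have t: "silent_entry c (list_encode \<kappa>) (lcons q (list_encode \<sigma>))" using silent_move.IH by simp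
  have y: "expand_entry c q q' 1 1" using fact_table_expand[OF c silent_move.hyps(2)] by simp
  note l = silent_entry_less(1)[OF t] lcons_less[OF silent_entry_less(2)[OF t]]
  have "closed_move c" using c unfolding fact_table_def by blast
  from this[unfolded closed_move_def, rule_format, OF l(1) conjunct1[OF l(2)] conjunct2[OF l(2)]
    expand_entry_less(2)[OF y] conjI[OF t y]] show ?case by simp
next
  case (silent_push \<kappa> q \<sigma> q' s)
  have t: "silent_entry c (list_encode \<kappa>) (lcons q (list_encode \<sigma>))" using silent_push.IH by simp
  have y: "expand_entry c q q' 1 (nth_prime s)" using fact_table_expand[OF c silent_push.hyps(2)]
    by simp
  have s: "s < in_n input" using expand_n[OF silent_push.hyps(2)] by simp
  note l = silent_entry_less(1)[OF t] lcons_less[OF silent_entry_less(2)[OF t]]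
  have "closed_push input c" using c unfolding fact_table_def by blast
  from this[unfolded closed_push_def, rule_format, OF l(1) conjunct1[OF l(2)] conjunct2[OF l(2)]
    expand_entry_less(2)[OF y] s conjI[OF t y]] show ?case by simp
next
  case (silent_pop \<kappa> f q \<sigma>)
  have t: "silent_entry c (list_encode \<kappa>) (lcons f (lcons q (list_encode \<sigma>)))" using silent_pop.IH
    by simp
  note l = lcons_less[OF silent_entry_less(2)[OF t]]
  note l' = lcons_less[OF conjunct2[OF l]]
  have "closed_pop input c" using c unfolding fact_table_def by blast
  from this[unfolded closed_pop_def input_simps, rule_format, OF silent_entry_less(1)[OF t]
    conjunct1[OF l]
    conjunct1[OF l'] conjunct2[OF l'] conjI[OF t silent_pop.hyps(2)]] show ?case by simp
next
  case (silent_refl \<kappa> \<kappa>')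
  have "closed_refl c" using c unfolding fact_table_def by blast
  from this[unfolded closed_refl_def, rule_format, OF silent_entry_less[OF silent_refl.IH]
    silent_refl.IH]
  show ?case .
next
  case (silent_letter \<kappa> q \<sigma> q' a)
  have t: "silent_entry c (list_encode \<kappa>) (lcons q (list_encode \<sigma>))" using silent_letter.IH by simp
  have m: "lmem (list_encode [q, a, q']) (in_\<delta> input)" using silent_letter.hyps(2)
    by (simp only: input_simps)
  have l: "a < in_\<delta> input" "q' < in_\<delta> input"
    by (rule less_trans[OF member_less_encode lmem_less[OF m]]; simp)+
  note l' = lcons_less[OF silent_entry_less(2)[OF t]]
  have "closed_letter input c" using c unfolding fact_table_def by blast
  from this[unfolded closed_letter_def, rule_format, OF silent_entry_less(1)[OF t] conjunct1[OF l']
    conjunct2[OF l'] l conjI[OF t m]] show ?case by simp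
next
  case (silent_fork \<kappa> q \<sigma> q' \<psi>)
  have t: "silent_entry c (list_encode \<kappa>) (lcons q (list_encode \<sigma>))" using silent_fork.IH by simp
  have y: "expand_entry c q q' 1 (mcode \<psi>)" using fact_table_expand[OF c silent_fork.hyps(2)]
    by simp
  note l' = lcons_less[OF silent_entry_less(2)[OF t]]
  have "closed_result c" using c unfolding fact_table_def by blast
  from this[unfolded closed_result_def, rule_format, OF silent_entry_less(1)[OF t] conjunct1[OF l']
    conjunct2[OF l'] expand_entry_less(2,4)[OF y] conjI[OF t y]] show ?case by simp
qed

lemma fact_table_facts: "fact_table input c \<Longrightarrow> y \<in> facts \<Longrightarrow> lmem y c"
  using fact_table_expand fact_table_silent unfolding facts_def expand_entry_def silent_entry_def
    by blast

text \<open>Applied to a code of \<open>facts\<close> this yields existence of a closed table;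
  applied to the filtered least table it yields exactness.\<close>

lemma facts_fact_table:
  assumes "\<And>y. lmem y c \<longleftrightarrow> y \<in> facts" shows "fact_table input c"
proof -
  have Y: "expand_entry c q q' u y \<longleftrightarrow> (\<exists>\<chi> \<psi>. u = mcode \<chi> \<and> y = mcode \<psi> \<and>
    expand q q' \<chi> \<psi>)" for q q' u y
    by (simp only: expand_entry_def assms facts_iff)
  have Y1: "expand_entry c q q' 1 y \<longleftrightarrow> (\<exists>\<psi>. y = mcode \<psi> \<and> expand q q' {#} \<psi>)" for q q' y
  proof -
    have "1 = mcode \<chi> \<longleftrightarrow> \<chi> = {#}" for \<chi> using inj_mcode[of "{#}" \<chi>] by auto
    then show ?thesis unfolding Y by simp
  qed
  have E: "silent_entry c a b \<longleftrightarrow> silent (list_decode a) (list_decode b)" for a b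
    by (simp only: silent_entry_def assms facts_iff)
  have "closed_init input c" unfolding closed_init_def
  proof (intro allI impI conjI)
    fix q assume q: "q < in_n input"
    have "expand q q {#} {#}" using q expand_refl by simp
    then show "expand_entry c q q 1 1" unfolding Y1 by (intro exI[of _ "{#}"]) simp
    show "silent_entry c (list_encode [q]) (list_encode [q])" unfolding E list_encode_inverse
      using q silent_init by simp
  qed
  moreover have "closed_fork input c" unfolding closed_fork_def input_simps
  proof (intro allI impI)
    fix q p q' assume "\<exists>ps. p = list_encode ps \<and> (q, ps, q') \<in> set (snd (snd (snd d)))"
    then obtain ps where ps: "p = list_encode ps" "(q, ps, q') \<in> set (snd (snd (snd d)))" by blast
    then have "q' \<in> desc_gamma d q (mset ps)" unfolding desc_gamma_def by auto
    then have "expand q q' (mset ps) {#}" by (rule expand_fork)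
    then show "expand_entry c q q' (lcode p) 1" unfolding Y ps(1) lcode_encode
      by (intro exI[of _ "mset ps"] exI[of _ "{#}"]) simp
  qed
  moreover have "closed_leaf input c" unfolding closed_leaf_def
  proof (intro allI impI)
    fix q q' r u y assume "expand_entry c q q' (nth_prime r * u) y"
    then obtain \<chi> \<psi> where 1: "nth_prime r * u = mcode \<chi>" "y = mcode \<psi>" "expand q q' \<chi> \<psi>" unfolding Y
      by blast
    then obtain \<chi>' where "\<chi> = add_mset r \<chi>'" "u = mcode \<chi>'" using mcode_cancel by blast
    then show "expand_entry c q q' u (nth_prime r * y)" unfolding Y
      using 1 expand_leaf[of q q' r \<chi>' \<psi>] by (intro exI[of _ \<chi>'] exI[of _ "add_mset r \<psi>"]) simp
  qed
  moreover have "closed_sub input c" unfolding closed_sub_def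
  proof (intro allI impI)
    fix q q' r u y f z assume *: "expand_entry c q q' (nth_prime r * u) y \<and> expand_entry c r f 1 z \<and>
      lmem f (in_F input)"
    then obtain \<chi> \<psi> where 1: "nth_prime r * u = mcode \<chi>" "y = mcode \<psi>" "expand q q' \<chi> \<psi>" unfolding Y
      by blast
    then obtain \<chi>' where 2: "\<chi> = add_mset r \<chi>'" "u = mcode \<chi>'" using mcode_cancel by blast
    obtain \<psi>' where 3: "z = mcode \<psi>'" "expand r f {#} \<psi>'" using * Y1 by blast
    have "f \<in> desc_F d" using * by (simp only: input_simps)
    with 1 2 3 have "expand q q' \<chi>' (\<psi>' + \<psi>)" by (blast intro: expand_sub)
    then show "expand_entry c q q' u (z * y)" unfolding Y
      using 1 2 3 by (intro exI[of _ \<chi>'] exI[of _ "\<psi>' + \<psi>"]) simp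
  qed
  moreover have "closed_comp c" unfolding closed_comp_def
  proof (intro allI impI)
    fix q m q' y z assume *: "expand_entry c q m 1 y \<and> expand_entry c m q' 1 z \<and> (y = 1 \<or> z = 1)"
    then obtain \<psi> \<psi>' where 1: "y = mcode \<psi>" "expand q m {#} \<psi>" "z = mcode \<psi>'" "expand m q' {#} \<psi>'"
      unfolding Y1 by blast
    have "\<psi> = {#} \<or> \<psi>' = {#}" using * 1 inj_mcode[of _ "{#}"] by simp
    with 1 have "expand q q' {#} (\<psi> + \<psi>')" by (blast intro: expand_comp)
    then show "expand_entry c q q' 1 (y * z)" unfolding Y1 using 1 by (intro exI[of _
      "\<psi> + \<psi>'"]) simp
  qed
  moreover have "closed_move c" unfolding closed_move_def
  proof (intro allI impI)
    fix a q s q' assume *: "silent_entry c a (lcons q s) \<and> expand_entry c q q' 1 1"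
    then obtain \<psi> where "1 = mcode \<psi>" "expand q q' {#} \<psi>" unfolding Y1 by blast
    then have "expand q q' {#} {#}" using inj_mcode[of \<psi> "{#}"] by simp
    moreover have "silent (list_decode a) (q # list_decode s)" using * unfolding E by simp
    ultimately have "silent (list_decode a) (q' # list_decode s)" by (blast intro: silent_move)
    then show "silent_entry c a (lcons q' s)" unfolding E by simp
  qed
  moreover have "closed_push input c" unfolding closed_push_def
  proof (intro allI impI)
    fix a q s q' r assume *: "silent_entry c a (lcons q s) \<and> expand_entry c q q' 1 (nth_prime r)"
    then obtain \<psi> where "nth_prime r = mcode \<psi>" "expand q q' {#} \<psi>" unfolding Y1 by blast
    then have "expand q q' {#} {#r#}" using inj_mcode[of \<psi> "{#r#}"] by simp
    moreover have "silent (list_decode a) (q # list_decode s)" using * unfolding E by simp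
    ultimately have "silent (list_decode a) (r # q' # list_decode s)" by (blast intro: silent_push)
    then show "silent_entry c a (lcons r (lcons q' s))" unfolding E by simp
  qed
  moreover have "closed_pop input c" unfolding closed_pop_def E input_simps
  proof (intro allI impI)
    fix a f q s assume "silent (list_decode a) (list_decode (lcons f (lcons q s))) \<and> f \<in> desc_F d"
    then show "silent (list_decode a) (list_decode (lcons q s))"
      using silent_pop[of "list_decode a" f q "list_decode s"] by simp
  qed
  moreover have "closed_refl c" unfolding closed_refl_def E using silent_refl by blast
  moreover have "closed_letter input c" unfolding closed_letter_def E input_simps
  proof (intro allI impI)
    fix a q s l q' assume "silent (list_decode a) (list_decode (lcons q s)) \<and> q' \<in> desc_delta d q l"
    then show "silent (list_decode (lcons q' s)) (list_decode (lcons q' s))"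
      using silent_letter[of "list_decode a" q "list_decode s" q' l] by simp
  qed
  moreover have "closed_result c" unfolding closed_result_def E Y1
  proof (intro allI impI)
    fix a q s q' y assume "silent (list_decode a) (list_decode (lcons q s)) \<and>
      (\<exists>\<psi>. y = mcode \<psi> \<and> expand q q' {#} \<psi>)"
    then show "silent (list_decode (lcons q' s)) (list_decode (lcons q' s))"
      using silent_fork[of "list_decode a" q "list_decode s" q'] by auto
  qed
  ultimately show ?thesis unfolding fact_table_def by blast
qed

lemma ex_fact_table: "\<exists>c. fact_table input c"
  using facts_fact_table lmem_setcode[OF finite_facts] by blast

abbreviation "fact_code \<equiv> LEAST c. fact_table input c"

lemma fact_code_facts: "lmem y fact_code \<longleftrightarrow> y \<in> facts"
proof
  have cl: "fact_table input fact_code" using ex_fact_table by (rule LeastI_ex)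
  then show "y \<in> facts \<Longrightarrow> lmem y fact_code" by (rule fact_table_facts)
  have "lmem z (list_encode (filter (\<lambda>y. y \<in> facts) (list_decode fact_code))) \<longleftrightarrow> z \<in> facts" for z
    using fact_table_facts[OF cl, of z] by (auto simp: lmem_iff[of z fact_code])
  then have "fact_table input (list_encode (filter (\<lambda>y. y \<in> facts) (list_decode fact_code)))"
    by (rule facts_fact_table)
  then show "lmem y fact_code \<Longrightarrow> y \<in> facts" using Least_list_filter[of "fact_table input"] cl
    by blast
qed

lemma expand_entry_fact_code: "expand_entry fact_code q q' 1 y \<longleftrightarrow> (\<exists>\<psi>. y = mcode \<psi> \<and>
  expand q q' {#} \<psi>)"
proof -
  have "1 = mcode \<chi> \<longleftrightarrow> \<chi> = {#}" for \<chi> using inj_mcode[of "{#}" \<chi>] by auto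
  then show ?thesis unfolding expand_entry_def fact_code_facts facts_iff by simp
qed

lemma silent_entry_fact_code: "silent_entry fact_code a b \<longleftrightarrow> silent (list_decode a) (list_decode b)"
  by (simp only: silent_entry_def fact_code_facts facts_iff)

end

section \<open>Types of pomsets and their composition\<close>

definition typecode :: "(nat \<times> nat) set \<Rightarrow> nat set \<Rightarrow> nat" where
  "typecode A P = list_encode [setcode (prod_encode ` A), setcode P]"

lemma typecode [simp]:
  "finite A \<Longrightarrow> run_entry (typecode A P) a b \<longleftrightarrow> (a, b) \<in> A"
  "finite P \<Longrightarrow> par_entry (typecode A P) y \<longleftrightarrow> y \<in> P"
  unfolding run_entry_def par_entry_def typecode_def
  by (auto simp: image_iff prod_encode_eq simp del: list_encode.simps)

lemma ex_list_decode: "(\<exists>s. Q (list_decode s)) \<longleftrightarrow> (\<exists>\<sigma>. Q \<sigma>)"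
  by (metis list_encode_inverse)

context desc_pa
begin

lemma silent_less_fact_code: "silent \<kappa> \<kappa>' \<Longrightarrow> list_encode \<kappa> < fact_code \<and> list_encode \<kappa>' < fact_code"
  using silent_entry_less[of fact_code "list_encode \<kappa>" "list_encode \<kappa>'"]
    by (simp add: silent_entry_fact_code)

lemma single_less_fact_code: "s < desc_states d \<Longrightarrow> list_encode [s] < fact_code"
  using silent_less_fact_code[OF silent_init] by blast

text \<open>One-state stacks have codes below \<open>fact_code\<close>, where the run part agrees
  with \<open>A\<close>. So the leaf part may be prescribed in terms of \<open>A\<close> before any
  \<open>e\<close> is at hand.\<close>

lemma typ_connI:
  assumes "\<And>a b. a < fact_code \<Longrightarrow> b < fact_code \<Longrightarrow> run_entry e a b \<longleftrightarrow> A a b"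
    and "\<And>y. y < fact_code \<Longrightarrow> par_entry e y \<longleftrightarrow> (\<exists>s<in_n input. \<exists>f<in_n input. y = nth_prime s \<and>
      lmem f (in_F input) \<and>
      A (list_encode [s]) (list_encode [f]))"
  shows "typ_conn input fact_code e"
  unfolding typ_conn_def
proof (intro allI impI)
  fix y assume "y < fact_code"
  have "run_entry e (list_encode [s]) (list_encode [f]) \<longleftrightarrow> A (list_encode [s]) (list_encode [f])"
    if "s < in_n input" "f < in_n input" for s f
    using that by (intro assms(1) single_less_fact_code) simp_all
  then show "par_entry e y \<longleftrightarrow> (\<exists>s<in_n input. \<exists>f<in_n input. y = nth_prime s \<and> lmem f (in_F input) \<and>
      run_entry e (list_encode [s]) (list_encode [f]))"
    unfolding assms(2)[OF \<open>y < fact_code\<close>] by blast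
qed

text \<open>A type matters only below \<open>fact_code\<close>, so listing all pairs of subsets of
  that range gives every conceivable type. This crude list is closed under all compositions and
  shows that the search terminates.\<close>

lemma ex_typecodes: "\<exists>c. \<forall>A P. \<exists>e<c. lmem e c \<and> (\<forall>a<fact_code. \<forall>b<fact_code. run_entry e a b \<longleftrightarrow>
  A a b) \<and>
    (\<forall>y<fact_code. par_entry e y \<longleftrightarrow> P y)"
proof -
  let ?T = "(\<lambda>(A, P). typecode A P) ` (Pow ({..<fact_code} \<times> {..<fact_code}) \<times> Pow {..<fact_code})"
  have "\<exists>e<setcode ?T. lmem e (setcode ?T) \<and> (\<forall>a<fact_code. \<forall>b<fact_code. run_entry e a b \<longleftrightarrow> A a b) \<and>
    (\<forall>y<fact_code. par_entry e y \<longleftrightarrow> P y)" for A P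
  proof -
  define A' P' where "A' = {(a, b). a < fact_code \<and> b < fact_code \<and> A a b}" and
    "P' = {y. y < fact_code \<and> P y}"
  have sub: "A' \<subseteq> {..<fact_code} \<times> {..<fact_code}" "P' \<subseteq> {..<fact_code}" unfolding A'_def P'_def
    by auto
  then have fin: "finite A'" "finite P'" by (blast intro: finite_subset)+
  have "typecode A' P' \<in> ?T" by (rule image_eqI[of _ _ "(A', P')"]) (use sub in auto)
  moreover have "finite ?T" by simp
  ultimately have l: "lmem (typecode A' P') (setcode ?T)" by (simp only: lmem_setcode)
  have "\<forall>a<fact_code. \<forall>b<fact_code. run_entry (typecode A' P') a b \<longleftrightarrow> A a b" using fin
    by (simp add: A'_def)
  moreover have "\<forall>y<fact_code. par_entry (typecode A' P') y \<longleftrightarrow> P y" using fin by (simp add: P'_def)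
  ultimately show "\<exists>e<setcode ?T. lmem e (setcode ?T) \<and>
    (\<forall>a<fact_code. \<forall>b<fact_code. run_entry e a b \<longleftrightarrow> A a b) \<and>
    (\<forall>y<fact_code. par_entry e y \<longleftrightarrow> P y)" using l lmem_less[OF l] by blast
  qed
  then show ?thesis by blast
qed

lemma ex_type_table: "\<exists>c. type_table k input fact_code c"
proof -
  obtain c where ex: "\<And>A P. \<exists>e<c. lmem e c \<and> (\<forall>a<fact_code. \<forall>b<fact_code. run_entry e a b \<longleftrightarrow> A a b) \<and>
    (\<forall>y<fact_code. par_entry e y \<longleftrightarrow> P y)" using ex_typecodes by blast
  have conn: "\<exists>e<c. lmem e c \<and> (\<forall>a<fact_code. \<forall>b<fact_code. run_entry e a b \<longleftrightarrow> A a b) \<and>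
    typ_conn input fact_code e" for A
  proof -
    obtain e where e: "e < c" "lmem e c" "\<forall>a<fact_code. \<forall>b<fact_code. run_entry e a b \<longleftrightarrow> A a b"
      "\<forall>y<fact_code. par_entry e y \<longleftrightarrow> (\<exists>s<in_n input. \<exists>f<in_n input. y = nth_prime s \<and>
        lmem f (in_F input) \<and>
        A (list_encode [s]) (list_encode [f]))"
      using ex[of A "\<lambda>y. \<exists>s<in_n input. \<exists>f<in_n input. y = nth_prime s \<and> lmem f (in_F input) \<and>
        A (list_encode [s]) (list_encode [f])"] by blast
    have "typ_conn input fact_code e"
      by (rule typ_connI[where A = A, OF e(3)[rule_format] e(4)[rule_format]])
    then show ?thesis using e(1-3) by blast
  qed
  have "type_table k input fact_code c"
    unfolding type_table_def
  proof (intro conjI allI impI)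
    fix l assume "l < k"
    show "\<exists>e<c. lmem e c \<and> typ_letter input fact_code l e"
      unfolding typ_letter_def by (rule conn)
  next
    fix e1 e2
    show "\<exists>e<c. lmem e c \<and> typ_seq input fact_code e1 e2 e"
      unfolding typ_seq_def by (rule conn)
    \<comment> \<open>The run part of \<open>typ_par\<close> mentions the leaf part of the very
      \<open>e\<close> that is sought, so the leaf part is fixed as \<open>P\<close> first.\<close>
    define P where "P = (\<lambda>y. \<exists>u<fact_code. \<exists>v<fact_code. par_entry e1 u \<and> par_entry e2 v \<and>
      y = u * v)"
    obtain e where e: "e < c" "lmem e c"
      "\<forall>a<fact_code. \<forall>b<fact_code. run_entry e a b \<longleftrightarrow>
        (\<exists>q<fact_code. \<exists>q'<fact_code. \<exists>s<fact_code. \<exists>y<fact_code. silent_entry fact_code a (lcons q s) \<and> P y \<and>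
       expand_entry fact_code q q' 1 y \<and> silent_entry fact_code (lcons q' s) b)"
         "\<forall>y<fact_code. par_entry e y \<longleftrightarrow> P y"
      using ex[of "\<lambda>a b. \<exists>q<fact_code. \<exists>q'<fact_code. \<exists>s<fact_code. \<exists>y<fact_code. silent_entry fact_code a (lcons q s) \<and> P y \<and>
       expand_entry fact_code q q' 1 y \<and> silent_entry fact_code (lcons q' s) b" P] by blast
    have "(\<exists>q<fact_code. \<exists>q'<fact_code. \<exists>s<fact_code. \<exists>y<fact_code. silent_entry fact_code a (lcons q s) \<and> P y \<and> expand_entry fact_code q q' 1 y \<and> silent_entry fact_code (lcons q' s) b)
      \<longleftrightarrow>
        (\<exists>q<fact_code. \<exists>q'<fact_code. \<exists>s<fact_code. \<exists>y<fact_code. silent_entry fact_code a (lcons q s) \<and> par_entry e y \<and> expand_entry fact_code q q' 1 y \<and> silent_entry fact_code (lcons q' s) b)"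
      for a b using e(4) by blast
    with e(3) have "\<forall>a<fact_code. \<forall>b<fact_code. run_entry e a b \<longleftrightarrow>
      (\<exists>q<fact_code. \<exists>q'<fact_code. \<exists>s<fact_code. \<exists>y<fact_code. silent_entry fact_code a (lcons q s) \<and>
      par_entry e y \<and> expand_entry fact_code q q' 1 y \<and>
        silent_entry fact_code (lcons q' s) b)" by (simp only:)
    with e(4) have "typ_par fact_code e1 e2 e" unfolding typ_par_def P_def by (simp only:)
    then show "\<exists>e<c. lmem e c \<and> typ_par fact_code e1 e2 e" using e(1,2) by blast
  qed
  then show ?thesis by blast
qed

text \<open>Restricting to codes below \<open>fact_code\<close> loses nothing: reachable stacks and
  the leaf multisets of unfoldings occur in the fact table and are therefore smaller than its
  code.\<close>

definition represents :: "nat \<Rightarrow> lpo \<Rightarrow> bool" where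
  "represents e U \<longleftrightarrow> (case U of (S, R, l) \<Rightarrow>
     (\<forall>a<fact_code. \<forall>b<fact_code. run_entry e a b \<longleftrightarrow> crun R l (list_decode a) S (list_decode b)) \<and>
     (\<forall>y<fact_code. par_entry e y \<longleftrightarrow> (\<exists>\<psi>. y = mcode \<psi> \<and> ipar R l S \<psi>)))"

lemma represents_emb:
  assumes "emb f S R l R' l'" shows "represents e (f ` S, R', l') \<longleftrightarrow> represents e (S, R, l)"
  unfolding represents_def by (simp add: crun_emb_iff[OF assms])

lemma represents_iso:
  assumes "lpo_iso U V" shows "represents e U \<longleftrightarrow> represents e V"
proof -
  obtain S R l S' R' l' where UV: "U = (S, R, l)" "V = (S', R', l')" by (cases U, cases V) auto
  from assms[unfolded UV] obtain g where "emb g S' R' l' R l" "g ` S' = S" by (rule lpo_iso_emb)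
  then show ?thesis using represents_emb[of g S' R' l' R l e] UV by simp
qed

lemma crun_less_fact_code: "crun R l \<kappa> X \<kappa>' \<Longrightarrow> list_encode \<kappa> < fact_code \<and>
  list_encode \<kappa>' < fact_code"
  using crun_refl silent_less_fact_code by blast

text \<open>By \<open>ipar_conn\<close> the leaf part of a connected set follows from the runs
  between one-state stacks, so only the run part has to be verified.\<close>

lemma represents_conn:
  assumes R: "\<And>a b. a < fact_code \<Longrightarrow> b < fact_code \<Longrightarrow> run_entry e a b \<longleftrightarrow>
    crun R l (list_decode a) S (list_decode b)"
    and "typ_conn input fact_code e" "conn R S"
  shows "represents e (S, R, l)"
proof -
  have "par_entry e y \<longleftrightarrow> (\<exists>\<psi>. y = mcode \<psi> \<and> ipar R l S \<psi>)" if "y < fact_code" for y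
  proof -
    have R': "run_entry e (list_encode [s]) (list_encode [f]) \<longleftrightarrow> crun R l [s] S [f]"
      if "s < in_n input" "f < in_n input" for s f
      using R[OF single_less_fact_code single_less_fact_code, of s f] that by simp
    have "par_entry e y \<longleftrightarrow> (\<exists>s<in_n input. \<exists>f<in_n input. y = nth_prime s \<and> lmem f (in_F input) \<and>
        run_entry e (list_encode [s]) (list_encode [f]))"
      using assms(2) that unfolding typ_conn_def by blast
    also have "\<dots> \<longleftrightarrow> (\<exists>s f. s < in_n input \<and> f < in_n input \<and> y = nth_prime s \<and> f \<in> desc_F d \<and>
      crun R l [s] S [f])"
      using R' by (auto simp del: list_encode.simps)
    also have "\<dots> \<longleftrightarrow> (\<exists>s f. y = nth_prime s \<and> f \<in> desc_F d \<and> crun R l [s] S [f])"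
    proof -
      have "s < in_n input \<and> f < in_n input" if "crun R l [s] S [f]" for s f
        using crun_refl[OF that] silent_n[of "[s]" "[s]"] silent_n[of "[f]" "[f]"] by simp
      then show ?thesis by blast
    qed
    also have "\<dots> \<longleftrightarrow> (\<exists>\<psi>. y = mcode \<psi> \<and> ipar R l S \<psi>)"
    proof -
      have "nth_prime s = mcode {#s#}" for s by simp
      then show ?thesis unfolding ipar_conn[OF assms(3)] by (simp only:) blast
    qed
    finally show ?thesis .
  qed
  then show ?thesis unfolding represents_def using R by simp
qed

lemma represents_letter:
  assumes "typ_letter input fact_code (l z) e" "(z, z) \<in> R" shows "represents e ({z}, R, l)"
proof (rule represents_conn)
  fix a b assume ab: "a < fact_code" "b < fact_code"
  have "run_entry e a b \<longleftrightarrow>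
    (\<exists>q<fact_code. \<exists>q'<fact_code. \<exists>s<fact_code. silent_entry fact_code a (lcons q s) \<and>
     lmem (list_encode [q, l z, q']) (in_\<delta> input) \<and> silent_entry fact_code (lcons q' s) b)"
    using assms(1) ab unfolding typ_letter_def by blast
  also have "\<dots> \<longleftrightarrow> (\<exists>q q' s. silent_entry fact_code a (lcons q s) \<and> q' \<in> desc_delta d q (l z) \<and>
    silent_entry fact_code (lcons q' s) b)"
    unfolding input_simps using silent_entry_less lcons_less by meson
  also have "\<dots> \<longleftrightarrow> (\<exists>q q' \<sigma>. silent (list_decode a) (q # \<sigma>) \<and> q' \<in> desc_delta d q (l z) \<and>
      silent (q' # \<sigma>) (list_decode b))"
  proof -
    from ex_list_decode[of "\<lambda>\<sigma>. \<exists>q q'. silent (list_decode a) (q # \<sigma>) \<and> q' \<in> desc_delta d q (l z) \<and>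
      silent (q' # \<sigma>) (list_decode b)"]
    show ?thesis unfolding silent_entry_fact_code list_decode.simps prod_encode_inverse prod.case
      by blast
  qed
  also have "\<dots> \<longleftrightarrow> crun R l (list_decode a) {z} (list_decode b)"
    unfolding crun_letter_iff using assms(2) by blast
  finally show "run_entry e a b \<longleftrightarrow> crun R l (list_decode a) {z} (list_decode b)" .
qed (use assms in \<open>auto simp: typ_letter_def\<close>)

lemma represents_seq:
  assumes e: "typ_seq input fact_code e1 e2 e" and e1: "represents e1 (X, R, l)" and e2:
    "represents e2 (Y, R, l)"
    and sep: "seqsep R X Y" "X \<noteq> {}" "Y \<noteq> {}"
  shows "represents e (X \<union> Y, R, l)"
proof (rule represents_conn)
  fix a b assume ab: "a < fact_code" "b < fact_code"
  have "run_entry e a b \<longleftrightarrow> (\<exists>m<fact_code. run_entry e1 a m \<and> run_entry e2 m b)"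
    using e ab unfolding typ_seq_def by blast
  also have "\<dots> \<longleftrightarrow> (\<exists>m<fact_code. crun R l (list_decode a) X (list_decode m) \<and>
      crun R l (list_decode m) Y (list_decode b))"
    using e1 e2 ab unfolding represents_def by auto
  also have "\<dots> \<longleftrightarrow> (\<exists>\<kappa>. crun R l (list_decode a) X \<kappa> \<and> crun R l \<kappa> Y (list_decode b))"
  proof
    assume "\<exists>\<kappa>. crun R l (list_decode a) X \<kappa> \<and> crun R l \<kappa> Y (list_decode b)"
    then obtain \<kappa> where "crun R l (list_decode a) X \<kappa>" "crun R l \<kappa> Y (list_decode b)" by blast
    \<comment> \<open>A stack inside a run is reachable, hence listed in the fact table and below
      the bound.\<close>
    then show "\<exists>m<fact_code. crun R l (list_decode a) X (list_decode m) \<and>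
      crun R l (list_decode m) Y (list_decode b)"
      using crun_less_fact_code by (intro exI[of _ "list_encode \<kappa>"]) auto
  qed blast
  also have "\<dots> \<longleftrightarrow> crun R l (list_decode a) (X \<union> Y) (list_decode b)"
    by (rule crun_seq_iff[OF sep, symmetric])
  finally show "run_entry e a b \<longleftrightarrow> crun R l (list_decode a) (X \<union> Y) (list_decode b)" .
qed (use assms conn_seq in \<open>auto simp: typ_seq_def\<close>)

lemma represents_par:
  assumes e: "typ_par fact_code e1 e2 e" and e1: "represents e1 (X, R, l)" and e2:
    "represents e2 (Y, R, l)"
    and sep: "parsep R X Y" "X \<noteq> {}" "Y \<noteq> {}"
  shows "represents e (X \<union> Y, R, l)"
proof -
  have P1: "par_entry e1 u \<longleftrightarrow> (\<exists>\<psi>. u = mcode \<psi> \<and> ipar R l X \<psi>)"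
    and P2: "par_entry e2 u \<longleftrightarrow> (\<exists>\<psi>. u = mcode \<psi> \<and> ipar R l Y \<psi>)" if "u < fact_code" for u
    using e1 e2 that unfolding represents_def by simp_all
  have P: "par_entry e y \<longleftrightarrow> (\<exists>\<psi>. y = mcode \<psi> \<and> ipar R l (X \<union> Y) \<psi>)" if y: "y < fact_code" for y
  proof -
    have "par_entry e y \<longleftrightarrow> (\<exists>u<fact_code. \<exists>v<fact_code. par_entry e1 u \<and> par_entry e2 v \<and>
      y = u * v)" (is "_ \<longleftrightarrow> ?rhs")
      using e y unfolding typ_par_def by simp
    also have "?rhs \<longleftrightarrow> (\<exists>\<psi>. y = mcode \<psi> \<and> ipar R l (X \<union> Y) \<psi>)"
    proof
      assume ?rhs
      then obtain u v where *: "u < fact_code" "v < fact_code" "par_entry e1 u" "par_entry e2 v"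
        "y = u * v" by blast
      obtain \<psi>1 where 1: "u = mcode \<psi>1" "ipar R l X \<psi>1" using P1[OF *(1)] *(3) by blast
      obtain \<psi>2 where 2: "v = mcode \<psi>2" "ipar R l Y \<psi>2" using P2[OF *(2)] *(4) by blast
      show "\<exists>\<psi>. y = mcode \<psi> \<and> ipar R l (X \<union> Y) \<psi>"
        using ipar_union[OF 1(2) 2(2) sep(1)] *(5) 1(1) 2(1) by (intro exI[of _ "\<psi>1 + \<psi>2"]) simp
    next
      assume "\<exists>\<psi>. y = mcode \<psi> \<and> ipar R l (X \<union> Y) \<psi>"
      then obtain \<psi>1 \<psi>2 where *: "y = mcode (\<psi>1 + \<psi>2)" "ipar R l X \<psi>1" "ipar R l Y \<psi>2"
        unfolding ipar_par_iff[OF sep(1)] by blast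
      \<comment> \<open>Codes are positive, so each factor is at most the product and inherits its
        bound.\<close>
      have "mcode \<psi>1 \<le> y" "mcode \<psi>2 \<le> y" using *(1) mcode_pos[of \<psi>1] mcode_pos[of \<psi>2] by simp_all
      then have l: "mcode \<psi>1 < fact_code" "mcode \<psi>2 < fact_code" using y by linarith+
      have "par_entry e1 (mcode \<psi>1)" "par_entry e2 (mcode \<psi>2)" using P1[OF l(1)] P2[OF l(2)] *(2,3)
        by blast+
      moreover have "y = mcode \<psi>1 * mcode \<psi>2" using *(1) by simp
      ultimately show ?rhs using l by blast
    qed
    finally show ?thesis .
  qed
  have "run_entry e a b \<longleftrightarrow> crun R l (list_decode a) (X \<union> Y) (list_decode b)" if ab: "a < fact_code"
    "b < fact_code" for a b
  proof -
    have "run_entry e a b \<longleftrightarrow>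
      (\<exists>q<fact_code. \<exists>q'<fact_code. \<exists>s<fact_code. \<exists>y<fact_code. silent_entry fact_code a (lcons q s) \<and> par_entry e y \<and>
       expand_entry fact_code q q' 1 y \<and> silent_entry fact_code (lcons q' s) b)" (is "_ \<longleftrightarrow> ?rhs")
      by (rule conjunct2[OF e[unfolded typ_par_def], rule_format, OF ab])
    also have "?rhs \<longleftrightarrow> crun R l (list_decode a) (X \<union> Y) (list_decode b)"
    proof
      assume ?rhs
      then obtain q q' s y where *: "y < fact_code" "silent_entry fact_code a (lcons q s)"
        "par_entry e y" "expand_entry fact_code q q' 1 y"
        "silent_entry fact_code (lcons q' s) b" by blast
      obtain \<psi> where \<psi>: "y = mcode \<psi>" "ipar R l (X \<union> Y) \<psi>" using P[OF *(1)] *(3) by blast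
      obtain \<psi>' where "y = mcode \<psi>'" "expand q q' {#} \<psi>'" using *(4)
        unfolding expand_entry_fact_code by blast
      then have "expand q q' {#} \<psi>" using \<psi>(1) inj_mcode[of \<psi> \<psi>'] by simp
      moreover have "silent (list_decode a) (q # list_decode s)" "silent (q' # list_decode s)
        (list_decode b)"
        using *(2,5) unfolding silent_entry_fact_code by simp_all
      ultimately show "crun R l (list_decode a) (X \<union> Y) (list_decode b)"
        unfolding crun_par_iff[OF sep] using \<psi>(2) by blast
    next
      assume "crun R l (list_decode a) (X \<union> Y) (list_decode b)"
      then obtain q \<sigma> q' \<psi> where *: "silent (list_decode a) (q # \<sigma>)" "ipar R l (X \<union> Y) \<psi>"
        "expand q q' {#} \<psi>" "silent (q' # \<sigma>) (list_decode b)" unfolding crun_par_iff[OF sep]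
          by blast
      have t: "silent_entry fact_code a (lcons q (list_encode \<sigma>))"
        "silent_entry fact_code (lcons q' (list_encode \<sigma>)) b"
        using *(1,4) unfolding silent_entry_fact_code by simp_all
      have y: "expand_entry fact_code q q' 1 (mcode \<psi>)" using *(3) unfolding expand_entry_fact_code
        by blast
      \<comment> \<open>The multiset belongs to an unfolding in the fact table, which puts its code
        into the range covered by \<open>P\<close>.\<close>
      have "par_entry e (mcode \<psi>)" using P[OF expand_entry_less(4)[OF y]] *(2) by blast
      then show ?rhs using t y expand_entry_less[OF y] lcons_less[OF silent_entry_less(2)[OF t(1)]]
        by blast
    qed
    finally show ?thesis .
  qed
  then show ?thesis unfolding represents_def using P by simp
qed

end

context desc_pa
begin

lemma represents_lpo_seq:
  assumes e: "typ_seq input fact_code e1 e2 e" "represents e1 (S1, R1, l1)" "represents e2 (S2, R2,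
    l2)"
    and S: "R1 \<subseteq> S1 \<times> S1" "R2 \<subseteq> S2 \<times> S2" "S1 \<inter> S2 = {}" "S1 \<noteq> {}" "S2 \<noteq> {}"
  shows "represents e (lpo_seq (S1, R1, l1) (S2, R2, l2))"
proof -
  note p = emb_seq_parts[OF S(1-3)]
  show ?thesis unfolding lpo_seq_def prod.case
    by (rule represents_seq[OF e(1) _ _ p(3) S(4,5)])
      (use represents_emb[OF p(1)[where ?l1.0 = l1 and ?l2.0 = l2]]
        represents_emb[OF p(2)[where ?l1.0 = l1 and ?l2.0 = l2]] e(2,3) in simp_all)
qed

lemma represents_lpo_par:
  assumes e: "typ_par fact_code e1 e2 e" "represents e1 (S1, R1, l1)" "represents e2 (S2, R2, l2)"
    and S: "R1 \<subseteq> S1 \<times> S1" "R2 \<subseteq> S2 \<times> S2" "S1 \<inter> S2 = {}" "S1 \<noteq> {}" "S2 \<noteq> {}"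
  shows "represents e (lpo_par (S1, R1, l1) (S2, R2, l2))"
proof -
  note p = emb_par_parts[OF S(1-3)]
  show ?thesis unfolding lpo_par_def prod.case
    by (rule represents_par[OF e(1) _ _ p(3) S(4,5)])
      (use represents_emb[OF p(1)[where ?l1.0 = l1 and ?l2.0 = l2]]
        represents_emb[OF p(2)[where ?l1.0 = l1 and ?l2.0 = l2]] e(2,3) in simp_all)
qed

lemma represents_lpo_single:
  "typ_letter input fact_code a e \<Longrightarrow> represents e (lpo_single z a)"
  unfolding lpo_single_def by (rule represents_letter) auto

lemma lpo_iso_carrier_empty: "lpo_iso U V \<Longrightarrow> fst U = {} \<longleftrightarrow> fst V = {}"
  by (cases U, cases V) (auto simp: lpo_iso_def bij_betw_def)

text \<open>Since only non-empty pomsets have types, a product with one empty factor takes the type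
  of the other one. If the second factor is empty, the labelling may still change off the carrier,
  so the identity is used as an embedding and not as an equality.\<close>

lemma ex_represents_lpo_seq_empty:
  assumes "R1 \<subseteq> S1 \<times> S1" "R2 \<subseteq> S2 \<times> S2" "S1 = {} \<or> S2 = {}" "S1 \<union> S2 \<noteq> {}"
    and "S1 \<noteq> {} \<Longrightarrow> \<exists>e. Q e \<and> represents e (S1, R1, l1)"
    and "S2 \<noteq> {} \<Longrightarrow> \<exists>e. Q e \<and> represents e (S2, R2, l2)"
  shows "\<exists>e. Q e \<and> represents e (lpo_seq (S1, R1, l1) (S2, R2, l2))"
proof (cases "S1 = {}")
  case True
  then have "lpo_seq (S1, R1, l1) (S2, R2, l2) = (S2, R2, l2)" using assms(1)
    by (auto simp: lpo_seq_def)
  then show ?thesis using assms(4,6) True by simp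
next
  case False
  then have "S2 = {}" "R2 = {}" using assms by auto
  have "emb id S1 R1 l1 R1 (\<lambda>x. if x \<in> S1 then l1 x else l2 x)" by (auto simp: emb_def)
  from represents_emb[OF this] have
    "represents e (lpo_seq (S1, R1, l1) (S2, R2, l2)) \<longleftrightarrow> represents e (S1, R1, l1)" for e
    using \<open>S2 = {}\<close> \<open>R2 = {}\<close> by (simp add: lpo_seq_def)
  then show ?thesis using assms(5)[OF False] by simp
qed

lemma lpo_par_eq_seq: "fst U = {} \<or> fst V = {} \<Longrightarrow> lpo_par U V = lpo_seq U V"
  by (cases U, cases V) (auto simp: lpo_par_def lpo_seq_def)

lemma ex_represents:
  assumes c: "type_table k input fact_code c" and "sp k U"
  shows "fst U \<noteq> {} \<Longrightarrow> \<exists>e. lmem e c \<and> represents e U"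
  using assms(2)
proof (induction rule: sp.induct)
  case (sp_empty U)
  then show ?case using lpo_iso_carrier_empty[OF sp_empty(1)] by (simp add: lpo_empty_def)
next
  case (sp_single a U z)
  then obtain e where "lmem e c" "typ_letter input fact_code a e" using c unfolding type_table_def
    by blast
  then show ?case using represents_lpo_single represents_iso[OF sp_single.hyps(2)] by blast
next
  case (sp_seq V W U)
  obtain S1 R1 l1 where V: "V = (S1, R1, l1)" by (cases V) auto
  obtain S2 R2 l2 where W: "W = (S2, R2, l2)" by (cases W) auto
  have S: "R1 \<subseteq> S1 \<times> S1" "R2 \<subseteq> S2 \<times> S2" "S1 \<inter> S2 = {}"
    using sp_wf[OF sp_seq.hyps(1)] sp_wf[OF sp_seq.hyps(2)] sp_seq.hyps(3) V W
    by (simp_all add: lpo_carrier_def)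
  have ne: "S1 \<union> S2 \<noteq> {}"
    using sp_seq.prems lpo_iso_carrier_empty[OF sp_seq.hyps(4)] V W by (simp add: lpo_seq_def)
  have "\<exists>e. lmem e c \<and> represents e (lpo_seq V W)"
  proof (cases "S1 = {} \<or> S2 = {}")
    case True
    show ?thesis unfolding V W
      by (rule ex_represents_lpo_seq_empty[OF S(1,2) True ne]) (use sp_seq.IH V W in simp_all)
  next
    case False
    then obtain e1 e2 where e: "lmem e1 c" "represents e1 V" "lmem e2 c" "represents e2 W"
      using sp_seq.IH V W by auto
    moreover from e have "e1 < c" "e2 < c" by (simp_all add: lmem_less)
    ultimately obtain e' where "lmem e' c" "typ_seq input fact_code e1 e2 e'"
      using c unfolding type_table_def by blast
    then show ?thesis using represents_lpo_seq[of e1 e2 e'] e S False V W by blast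
  qed
  then show ?case using represents_iso[OF sp_seq.hyps(4)] by blast
next
  case (sp_par V W U)
  obtain S1 R1 l1 where V: "V = (S1, R1, l1)" by (cases V) auto
  obtain S2 R2 l2 where W: "W = (S2, R2, l2)" by (cases W) auto
  have S: "R1 \<subseteq> S1 \<times> S1" "R2 \<subseteq> S2 \<times> S2" "S1 \<inter> S2 = {}"
    using sp_wf[OF sp_par.hyps(1)] sp_wf[OF sp_par.hyps(2)] sp_par.hyps(3) V W
    by (simp_all add: lpo_carrier_def)
  have ne: "S1 \<union> S2 \<noteq> {}"
    using sp_par.prems lpo_iso_carrier_empty[OF sp_par.hyps(4)] V W by (simp add: lpo_par_def)
  have "\<exists>e. lmem e c \<and> represents e (lpo_par V W)"
  proof (cases "S1 = {} \<or> S2 = {}")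
    case True
    then have "lpo_par V W = lpo_seq V W" using V W by (intro lpo_par_eq_seq) simp
    then show ?thesis unfolding V W
      by (simp only:, intro ex_represents_lpo_seq_empty[OF S(1,2) True ne])
        (use sp_par.IH V W in simp_all)
  next
    case False
    then obtain e1 e2 where e: "lmem e1 c" "represents e1 V" "lmem e2 c" "represents e2 W"
      using sp_par.IH V W by auto
    moreover from e have "e1 < c" "e2 < c" by (simp_all add: lmem_less)
    ultimately obtain e' where "lmem e' c" "typ_par fact_code e1 e2 e'"
      using c unfolding type_table_def by blast
    then show ?thesis using represents_lpo_par[of e1 e2 e'] e S False V W by blast
  qed
  then show ?case using represents_iso[OF sp_par.hyps(4)] by blast
qed

section \<open>Every type in the least table is realized\<close>

lemma lpo_iso_refl: "R \<subseteq> S \<times> S \<Longrightarrow> lpo_iso (S, R, l) (S, R, l)"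
  by (rule lpo_isoI[of id]) (auto simp: emb_def)

definition realized :: "nat \<Rightarrow> bool" where
  "realized e \<longleftrightarrow> (\<exists>U. sp k U \<and> fst U \<noteq> {} \<and> represents e U)"

lemma realized_copies:
  assumes "realized e1" "realized e2"
  obtains S1 R1 l1 S2 R2 l2 where "sp k (S1, R1, l1)" "sp k (S2, R2, l2)" "represents e1 (S1, R1,
    l1)"
    "represents e2 (S2, R2, l2)" "R1 \<subseteq> S1 \<times> S1" "R2 \<subseteq> S2 \<times> S2" "S1 \<inter> S2 = {}" "S1 \<noteq> {}" "S2 \<noteq> {}"
proof -
  obtain S R l where 1: "sp k (S, R, l)" "S \<noteq> {}" "represents e1 (S, R, l)"
    using assms(1) unfolding realized_def by auto
  obtain S' R' l' where 2: "sp k (S', R', l')" "S' \<noteq> {}" "represents e2 (S', R', l')"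
    using assms(2) unfolding realized_def by auto
  \<comment> \<open>Even and odd numbers keep the two copies disjoint.\<close>
  let ?f = "\<lambda>n::nat. 2 * n" and ?g = "\<lambda>n::nat. 2 * n + 1"
  have "inj ?f" "inj ?g" by (auto intro: injI)
  obtain R1 l1 where V: "sp k (?f ` S, R1, l1)" "emb ?f S R l R1 l1"
    by (rule sp_copy[OF 1(1) \<open>inj ?f\<close>])
  obtain R2 l2 where W: "sp k (?g ` S', R2, l2)" "emb ?g S' R' l' R2 l2"
    by (rule sp_copy[OF 2(1) \<open>inj ?g\<close>])
  have "2 * a \<noteq> 2 * b + 1" for a b :: nat by presburger
  then have "?f ` S \<inter> ?g ` S' = {}" by auto
  then show ?thesis
    using that[OF V(1) W(1)] represents_emb[OF V(2)] represents_emb[OF W(2)] 1 2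
      sp_wf[OF V(1)] sp_wf[OF W(1)] by simp
qed

abbreviation "type_code \<equiv> LEAST c. type_table k input fact_code c"

lemma type_table_type_code: "type_table k input fact_code type_code"
  using ex_type_table by (rule LeastI_ex)

text \<open>The realized types of the table are closed under composition on their own: disjoint
  copies of realizing pomsets are composed, and the product has the type that the table supplies.
  Minimality then leaves no room for other types.\<close>

lemma type_code_realized: assumes "lmem e type_code" shows "realized e"
proof -
  let ?c = "list_encode (filter realized (list_decode type_code))"
  have m: "lmem e ?c \<longleftrightarrow> lmem e type_code \<and> realized e" for e by (auto simp: lmem_iff[of e type_code])
  have "type_table k input fact_code ?c" unfolding type_table_def[of k input fact_code ?c]
  proof (intro conjI allI impI)
    fix a assume "a < k"
    then obtain e where e: "lmem e type_code" "typ_letter input fact_code a e"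
      using type_table_type_code unfolding type_table_def[of k input fact_code type_code] by blast
    have "represents e (lpo_single 0 a)" using e(2) by (rule represents_lpo_single)
    moreover have "lpo_iso (lpo_single 0 a) (lpo_single 0 a)"
      by (simp add: lpo_single_def lpo_iso_refl)
    with \<open>a < k\<close> have "sp k (lpo_single 0 a)" by (rule sp.sp_single)
    ultimately have "realized e" unfolding realized_def
      by (intro exI[of _ "lpo_single 0 a"]) (simp add: lpo_single_def)
    with e have "lmem e ?c" using m by blast
    then show "\<exists>e<?c. lmem e ?c \<and> typ_letter input fact_code a e" using e(2) lmem_less by blast
  next
    fix e1 e2 assume "lmem e1 ?c \<and> lmem e2 ?c"
    then have e: "lmem e1 type_code" "lmem e2 type_code" "realized e1" "realized e2" unfolding m
      by blast+
    have l: "e1 < type_code" "e2 < type_code" using e lmem_less by blast+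
    obtain S1 R1 l1 S2 R2 l2 where S: "sp k (S1, R1, l1)" "sp k (S2, R2, l2)" "represents e1 (S1,
      R1, l1)"
      "represents e2 (S2, R2, l2)" "R1 \<subseteq> S1 \<times> S1" "R2 \<subseteq> S2 \<times> S2" "S1 \<inter> S2 = {}" "S1 \<noteq> {}" "S2 \<noteq> {}"
      by (rule realized_copies[OF e(3,4)])
    obtain e' where e': "lmem e' type_code" "typ_seq input fact_code e1 e2 e'"
      using type_table_type_code l e(1,2) unfolding type_table_def[of k input fact_code type_code]
        by blast
    let ?U = "lpo_seq (S1, R1, l1) (S2, R2, l2)"
    have "sp k ?U" using S
      by (intro sp.sp_seq[OF S(1,2)]) (auto simp: lpo_carrier_def lpo_seq_def intro!: lpo_iso_refl)
    moreover have "represents e' ?U" by (rule represents_lpo_seq[OF e'(2) S(3-9)])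
    moreover have "fst ?U \<noteq> {}" using S(8) by (simp add: lpo_seq_def)
    ultimately have "lmem e' ?c" unfolding m realized_def using e'(1) by blast
    then show "\<exists>e<?c. lmem e ?c \<and> typ_seq input fact_code e1 e2 e" using e'(2) lmem_less by blast
    obtain e' where e': "lmem e' type_code" "typ_par fact_code e1 e2 e'"
      using type_table_type_code l e(1,2) unfolding type_table_def[of k input fact_code type_code]
        by blast
    let ?U = "lpo_par (S1, R1, l1) (S2, R2, l2)"
    have "sp k ?U" using S
      by (intro sp.sp_par[OF S(1,2)]) (auto simp: lpo_carrier_def lpo_par_def intro!: lpo_iso_refl)
    moreover have "represents e' ?U" by (rule represents_lpo_par[OF e'(2) S(3-9)])
    moreover have "fst ?U \<noteq> {}" using S(8) by (simp add: lpo_par_def)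
    ultimately have "lmem e' ?c" unfolding m realized_def using e'(1) by blast
    then show "\<exists>e<?c. lmem e ?c \<and> typ_par fact_code e1 e2 e" using e'(2) lmem_less by blast
  qed
  then show ?thesis
    by (rule Least_list_filter[where Q = "type_table k input fact_code" and P = realized,
      OF type_table_type_code _ assms])
qed

section \<open>Language equality as agreement on types\<close>

abbreviation "lang \<equiv> pa_lang k (desc_F d) (desc_delta d) (desc_gamma d)"

lemma lang_empty:
  assumes "q < desc_states d" "sp k U" "fst U = {}"
  shows "U \<in> lang q \<longleftrightarrow> (\<exists>f<in_n input. lmem f (in_F input) \<and> expand_entry fact_code q f 1 1)"
proof -
  have "expand_entry fact_code q f 1 1 \<longleftrightarrow> crun (fst (snd U)) (snd (snd U)) [q] {} [f]" if
    "f \<in> desc_F d" for f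
  proof -
    have "1 = mcode \<psi> \<longleftrightarrow> \<psi> = {#}" for \<psi> using inj_mcode[of "{#}" \<psi>] by auto
    then have "expand_entry fact_code q f 1 1 \<longleftrightarrow> expand q f {#} {#}" unfolding expand_entry_fact_code
      by simp
    then show ?thesis
      using silent_accept_iff[OF assms(1)] accept_iff[OF assms(1) that] by blast
  qed
  then show ?thesis unfolding pa_lang_iff[OF assms(1)] input_simps using assms F_n by auto
qed

lemma lang_represents:
  assumes "q < desc_states d" "sp k U" "represents e U"
  shows "U \<in> lang q \<longleftrightarrow> (\<exists>f<in_n input. lmem f (in_F input) \<and> run_entry e (list_encode [q])
    (list_encode [f]))"
proof -
  have "run_entry e (list_encode [q]) (list_encode [f]) \<longleftrightarrow> crun (fst (snd U)) (snd (snd U)) [q]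
    (fst U) [f]"
    if "f < desc_states d" for f
    using assms(3) single_less_fact_code[OF assms(1)] single_less_fact_code[OF that]
      unfolding represents_def
    by (cases U) (simp del: list_encode.simps)
  then show ?thesis unfolding pa_lang_iff[OF assms(1)] input_simps using assms F_n by blast
qed

text \<open>From left to right every non-empty pomset has a type in the table, by closedness. From
  right to left every type in the table stems from a pomset on which the two languages can be
  compared, by realizability.\<close>

lemma agree_iff: "agree input fact_code type_code \<longleftrightarrow> lang q1 = lang q2"
proof
  assume a: "agree input fact_code type_code"
  have "U \<in> lang q1 \<longleftrightarrow> U \<in> lang q2" if U: "sp k U" for U
  proof (cases "fst U = {}")
    case True
    then show ?thesis using a lang_empty[OF q1 U True] lang_empty[OF q2 U True]
      unfolding agree_def input_simps by blast
  next
    case False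
    then obtain e where e: "lmem e type_code" "represents e U"
      using ex_represents[OF type_table_type_code U False] by blast
    then have "e < type_code" by (simp add: lmem_less)
    then show ?thesis using a e(1) lang_represents[OF q1 U e(2)] lang_represents[OF q2 U e(2)]
      unfolding agree_def input_simps by blast
  qed
  then show "lang q1 = lang q2" unfolding pa_lang_def by blast
next
  assume eq: "lang q1 = lang q2"
  have "sp k lpo_empty" by (rule sp.sp_empty) (simp add: lpo_empty_def lpo_iso_refl)
  moreover have "fst lpo_empty = {}" by (simp add: lpo_empty_def)
  ultimately have "(\<exists>f<in_n input. lmem f (in_F input) \<and> expand_entry fact_code q1 f 1 1) \<longleftrightarrow>
      (\<exists>f<in_n input. lmem f (in_F input) \<and> expand_entry fact_code q2 f 1 1)"
    using eq lang_empty[OF q1] lang_empty[OF q2] by blast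
  moreover have "(\<exists>f<in_n input. lmem f (in_F input) \<and> run_entry e (list_encode [q1])
    (list_encode [f])) \<longleftrightarrow>
      (\<exists>f<in_n input. lmem f (in_F input) \<and> run_entry e (list_encode [q2]) (list_encode [f]))" if e:
        "lmem e type_code" for e
  proof -
    obtain U where "sp k U" "represents e U" using type_code_realized[OF e] unfolding realized_def
      by blast
    then show ?thesis using eq lang_represents[OF q1] lang_represents[OF q2] by blast
  qed
  ultimately show "agree input fact_code type_code" unfolding agree_def input_simps(2,3) by blast
qed

end

theorem theorem5p17:
  fixes k :: nat
  shows "\<exists>prog. \<forall>d q1 q2.
     valid_desc k d \<and> q1 < desc_states d \<and> q2 < desc_states d \<and>
     fork_acyclic k (desc_delta d) (desc_gamma d) \<and>
     well_structured (desc_F d) (desc_gamma d) \<longrightarrow>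
     eval prog [encode_input d q1 q2]
       (if pa_lang k (desc_F d) (desc_delta d) (desc_gamma d) q1 =
           pa_lang k (desc_F d) (desc_delta d) (desc_gamma d) q2 then 1 else 0)"
proof -
  obtain prog where prog: "\<And>x. \<exists>c. fact_table x c \<Longrightarrow> \<exists>c. type_table k x (LEAST c. fact_table x c) c \<Longrightarrow>
     eval prog [x] (of_bool (agree x (LEAST c. fact_table x c)
       (LEAST c. type_table k x (LEAST c. fact_table x c) c)))"
    using decision_program by blast
  show ?thesis
  proof (intro exI[of _ prog] allI impI, elim conjE)
    fix d q1 q2
    assume "valid_desc k d" "q1 < desc_states d" "q2 < desc_states d"
      "fork_acyclic k (desc_delta d) (desc_gamma d)"
    then interpret desc_pa k d q1 q2 by unfold_locales
    show "eval prog [encode_input d q1 q2]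
       (if pa_lang k (desc_F d) (desc_delta d) (desc_gamma d) q1 =
           pa_lang k (desc_F d) (desc_delta d) (desc_gamma d) q2 then 1 else 0)"
      using prog[OF ex_fact_table ex_type_table] unfolding agree_iff of_bool_def .
  qed
qed

end
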